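(* Let $T>0$, $D=(0,1)$, and let $\mu\in\mathbb R$ and $\kappa\in\mathbb N$ satisfy $(\kappa-1)^2\pi^2\le\mu<\kappa^2\pi^2$. Let $u$ be the mild solution of the linear Cahn-Hilliard-Cook problem forced by $\partial_x\dot W$, and, for $N_\star,J_\star\in\mathbb N$ with $\Delta t=T/N_\star$, $\Delta x=1/J_\star$, let $\widehat u$ be the solution of the regularized problem forced by $\partial_x\widehat W$ (both as defined in the context). Then there exists a real constant $\widetilde C>0$, independent of $\Delta t$ and $\Delta x$, such that $$\max_{t\in[0,T]}\left(\mathbb E\left[\|u(t,\cdot)-\widehat u(t,\cdot)\|_{L^2(D)}^2\right]\right)^{\frac12}\le\widetilde C\left[\omega_0(\Delta t)\,\Delta t^{\frac18}+\epsilon^{-\frac12}\,\Delta x^{\frac12-\epsilon}\right]\qquad\forall\,\epsilon\in\left(0,\tfrac12\right],$$ where $\omega_0(\Delta t):=\sqrt{1+\Delta t^{\frac34}}$.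
   Context: $\mathbb N$ denotes the positive integers. $(\Omega,\mathcal F,P)$ is a complete probability space, $\mathbb E$ is the expectation, and $\dot W$ is a space-time white noise on $[0,T]\times D$; $\int\!\int\cdots dW$ denotes the corresponding (Walsh) stochastic integral. Set $\lambda_k:=k\pi$, $\varepsilon_k(z):=\sqrt2\sin(\lambda_k z)$ for $k\in\mathbb N$, and $$\Psi(t;x,y):=-\sum_{k=1}^\infty e^{-\lambda_k^2(\lambda_k^2-\mu)t}\,\varepsilon_k(x)\,\varepsilon_k'(y),\quad (t,x,y)\in(0,T]\times\overline D\times\overline D.$$ The function $u$ is the mild solution of $$\partial_tu+\partial_x^4u+\mu\,\partial_x^2u=\partial_x\dot W\ \text{ in }(0,T]\times D,\qquad u=\partial_x^2u=0\ \text{ on }(0,T]\times\partial D,\qquad u(0,\cdot)=0,$$ that is, $u(t,x)=\int_0^t\int_D\Psi(t-s;x,y)\,dW(s,y)$. Regularized noise: let $t_n:=n\Delta t$ ($n=0,\dots,N_\star$), $x_j:=j\Delta x$ ($j=0,\dots,J_\star$), $T_n:=(t_{n-1},t_n)$. Let $(\psi_i)_{i=1}^{J_\star+1}$ be the hat-function basis of the space of continuous functions on $\overline D$ that are affine on each $(x_{j-1},x_j)$: $\psi_i$ is the element of this space with $\psi_i(x_{j})=1$ if $j=i-1$ and $0$ otherwise. Let $G$ be the symmetric positive definite $(J_\star+1)\times(J_\star+1)$ matrix $G_{i,j}:=\int_D\psi_j\psi_i\,dx$, let $R_{n,i}:=\int_{T_n}\int_D\psi_i(x)\,dW(t,x)$,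 and let $$\widehat W(t,x):=\tfrac1{\Delta t}\sum_{n=1}^{N_\star}\mathcal X_{T_n}(t)\sum_{\ell=1}^{J_\star+1}\left(\sum_{m=1}^{J_\star+1}G^{-1}_{\ell,m}R_{n,m}\right)\psi_\ell(x),$$ where $\mathcal X_A$ is the indicator function of $A$. The function $\widehat u$ is the solution of the same initial-boundary value problem with $\partial_x\dot W$ replaced by $\partial_x\widehat W$; it is given by $\widehat u(t,x)=\int_0^t\int_D\Psi(t-s;x,y)\,\widehat W(s,y)\,dy\,ds$. *)

theory Defs
  imports "HOL-Probability.Probability" "Jordan_Normal_Form.Gauss_Jordan_Elimination"
begin

section \<open>White noise and the Walsh integral of deterministic integrands\<close>

definition space_time :: "real \<Rightarrow> (real \<times> real) measure" where
  "space_time T = restrict_space lborel ({0..T} \<times> {0<..<1})"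

definition finite_sets :: "'b measure \<Rightarrow> 'b set set" where
  "finite_sets E = {A \<in> sets E. emeasure E A < \<infinity>}"

text \<open>White noise with intensity \<open>E\<close>, in the sense of Walsh: an independently scattered,
  almost surely additive random set function with \<open>W A \<sim> N(0, E A)\<close>. The degenerate law
  \<open>N(0, 0)\<close> has no density and is treated separately.\<close>

definition white_noise :: "'w measure \<Rightarrow> 'b measure \<Rightarrow> ('b set \<Rightarrow> 'w \<Rightarrow> real) \<Rightarrow> bool" where
  "white_noise M E W \<longleftrightarrow>
     (\<forall>A \<in> finite_sets E.
        W A \<in> borel_measurable M \<and>
        (if measure E A = 0 then AE \<omega> in M. W A \<omega> = 0
         else distributed M lborel (W A) (normal_density 0 (sqrt (measure E A))))) \<and>
     (\<forall>\<A> \<subseteq> finite_sets E. finite \<A> \<longrightarrow> disjoint \<A> \<longrightarrow>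
        prob_space.indep_vars M (\<lambda>_. borel) W \<A>) \<and>
     (\<forall>A \<in> finite_sets E. \<forall>B \<in> finite_sets E. A \<inter> B = {} \<longrightarrow>
        (AE \<omega> in M. W (A \<union> B) \<omega> = W A \<omega> + W B \<omega>))"

text \<open>\<open>has_walsh_integral M E W f X\<close>: the random variable \<open>X\<close> is (a version of) \<open>\<integral> f dW\<close>.
  The integral of \<open>\<Sum>A. c A * indicator A\<close> is \<open>\<Sum>A. c A * W A\<close>, and the integral of a
  square-integrable \<open>f\<close> is the limit in \<open>L\<^sup>2(M)\<close> of the integrals of elementary functions
  converging to \<open>f\<close> in \<open>L\<^sup>2(E)\<close>. It is a relation since \<open>X\<close> is unique only up to null sets.\<close>

definition has_walsh_integral ::
  "'w measure \<Rightarrow> 'b measure \<Rightarrow> ('b set \<Rightarrow> 'w \<Rightarrow> real) \<Rightarrow> ('b \<Rightarrow> real) \<Rightarrow> ('w \<Rightarrow> real) \<Rightarrow> bool" where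
  "has_walsh_integral M E W f X \<longleftrightarrow>
     f \<in> borel_measurable E \<and> integrable E (\<lambda>z. (f z)\<^sup>2) \<and> X \<in> borel_measurable M \<and>
     (\<exists>(\<A> :: nat \<Rightarrow> 'b set set) (c :: nat \<Rightarrow> 'b set \<Rightarrow> real).
        (\<forall>n. finite (\<A> n) \<and> \<A> n \<subseteq> finite_sets E) \<and>
        (\<lambda>n. \<integral>\<^sup>+z. ennreal ((f z - (\<Sum>A\<in>\<A> n. c n A * indicator A z))\<^sup>2) \<partial>E) \<longlonglongrightarrow> 0 \<and>
        (\<lambda>n. \<integral>\<^sup>+\<omega>. ennreal ((X \<omega> - (\<Sum>A\<in>\<A> n. c n A * W A \<omega>))\<^sup>2) \<partial>M) \<longlonglongrightarrow> 0)"


section \<open>The mild solution\<close>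

definition lam :: "nat \<Rightarrow> real" where
  "lam k = real k * pi"

definition eps :: "nat \<Rightarrow> real \<Rightarrow> real" where
  "eps k z = sqrt 2 * sin (lam k * z)"

definition Psi :: "real \<Rightarrow> real \<Rightarrow> real \<Rightarrow> real \<Rightarrow> real" where
  "Psi \<mu> t x y =
     - (\<Sum>i. let k = Suc i in
          exp (- ((lam k)\<^sup>2 * ((lam k)\<^sup>2 - \<mu>) * t)) * eps k x * deriv (eps k) y)"

text \<open>Since the Walsh integral is only defined up to null sets for each \<open>(t, x)\<close>, a version that
  is jointly measurable in \<open>(x, \<omega>)\<close> is required, as is implicit in taking the expectation of
  \<open>L\<^sup>2(D)\<close>-norms.\<close>

definition mild_solution ::
  "'w measure \<Rightarrow> ((real \<times> real) set \<Rightarrow> 'w \<Rightarrow> real) \<Rightarrow> real \<Rightarrow> real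
     \<Rightarrow> (real \<Rightarrow> real \<Rightarrow> 'w \<Rightarrow> real) \<Rightarrow> bool" where
  "mild_solution M W T \<mu> u \<longleftrightarrow>
     (\<forall>t\<in>{0..T}.
        (\<lambda>(x, \<omega>). u t x \<omega>) \<in> borel_measurable (restrict_space lborel {0..1} \<Otimes>\<^sub>M M) \<and>
        (\<forall>x\<in>{0..1}.
           has_walsh_integral M (space_time T) W
             (\<lambda>(s, y). indicator {0<..<t} s * Psi \<mu> (t - s) x y) (u t x)))"


section \<open>The regularized noise and the regularized solution\<close>

definition time_slab :: "real \<Rightarrow> nat \<Rightarrow> nat \<Rightarrow> real set" where
  "time_slab T N n = (let \<Delta>t = T / real N in {(real n - 1) * \<Delta>t <..< real n * \<Delta>t})"

definition node :: "nat \<Rightarrow> nat \<Rightarrow> real" where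
  "node J j = real j * (1 / real J)"

definition spline_space :: "nat \<Rightarrow> (real \<Rightarrow> real) set" where
  "spline_space J = {f. continuous_on {0..1} f \<and>
     (\<forall>j\<in>{1..J}. \<exists>a b. \<forall>x\<in>{node J (j - 1)<..<node J j}. f x = a + b * x)}"

text \<open>The choice operator is used because the values outside \<open>[0, 1]\<close> are irrelevant and not
  determined.\<close>

definition hat :: "nat \<Rightarrow> nat \<Rightarrow> real \<Rightarrow> real" where
  "hat J i = (SOME f. f \<in> spline_space J \<and>
     (\<forall>j\<in>{0..J}. f (node J j) = (if j + 1 = i then 1 else 0)))"

lemma hat_spec:
  assumes "J \<ge> 1" "i \<in> {1..J+1}"
  shows "hat J i \<in> spline_space J \<and> (\<forall>j\<in>{0..J}. hat J i (node J j) = (if j + 1 = i then 1 else 0))"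
  unfolding hat_def
proof (rule someI [of _ "\<lambda>x. max 0 (1 - \<bar>real J * x - (real i - 1)\<bar>)"])
  let ?f = "\<lambda>x. max 0 (1 - \<bar>real J * x - (real i - 1)\<bar>)"
  have J: "real J > 0" using assms by simp
  have "\<exists>a b. \<forall>x\<in>{node J (j - 1)<..<node J j}. ?f x = a + b * x" if j: "j \<in> {1..J}" for j
  proof -
    have r: "real j - 1 < real J * x \<and> real J * x < real j"
      if "x \<in> {node J (j - 1)<..<node J j}" for x
      using that j J by (auto simp: node_def field_simps of_nat_diff)
    consider "j + 1 < i" | "j + 1 = i" | "j = i" | "j > i" by linarith
    then show ?thesis
    proof cases
      case 1
      then have "real j + 2 \<le> real i" by linarith
      then have "?f x = 0 + 0 * x" if "x \<in> {node J (j - 1)<..<node J j}" for x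
        using r[OF that] by simp
      then show ?thesis by blast
    next
      case 2
      then have "real i = real j + 1" by linarith
      then have "?f x = (1 - real j) + real J * x" if "x \<in> {node J (j - 1)<..<node J j}" for x
        using r[OF that] by simp
      then show ?thesis by blast
    next
      case 3
      then have "?f x = real j + (- real J) * x" if "x \<in> {node J (j - 1)<..<node J j}" for x
        using r[OF that] by simp
      then show ?thesis by blast
    next
      case 4
      then have "real i + 1 \<le> real j" by linarith
      then have "?f x = 0 + 0 * x" if "x \<in> {node J (j - 1)<..<node J j}" for x
        using r[OF that] by simp
      then show ?thesis by blast
    qed
  qed
  moreover have "continuous_on {0..1} ?f" by (intro continuous_intros)
  moreover have "?f (node J j) = (if j + 1 = i then 1 else 0)" if "j \<in> {0..J}" for j
  proof -
    have "real J * node J j = real j" using J by (simp add: node_def)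
    moreover have "\<bar>real j - (real i - 1)\<bar> \<ge> 1" if "j + 1 \<noteq> i"
      using that by linarith
    ultimately show ?thesis by auto
  qed
  ultimately show "?f \<in> spline_space J \<and>
      (\<forall>j\<in>{0..J}. ?f (node J j) = (if j + 1 = i then 1 else 0))"
    by (auto simp: spline_space_def)
qed

text \<open>Matrix indices start at 0, so entry \<open>(i, j)\<close> of \<open>gram J\<close> is \<open>G\<^bsub>i+1,j+1\<^esub>\<close>.\<close>

definition gram :: "nat \<Rightarrow> real Matrix.mat" where
  "gram J = Matrix.mat (J + 1) (J + 1)
     (\<lambda>(i, j). LINT x:{0<..<1}|lborel. hat J (j + 1) x * hat J (i + 1) x)"

definition gram_inv :: "nat \<Rightarrow> nat \<Rightarrow> nat \<Rightarrow> real" where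
  "gram_inv J l m = the (mat_inverse (gram J)) $$ (l - 1, m - 1)"

definition noise_coeffs ::
  "'w measure \<Rightarrow> ((real \<times> real) set \<Rightarrow> 'w \<Rightarrow> real) \<Rightarrow> real \<Rightarrow> nat \<Rightarrow> nat
     \<Rightarrow> (nat \<Rightarrow> nat \<Rightarrow> 'w \<Rightarrow> real) \<Rightarrow> bool" where
  "noise_coeffs M W T N J R \<longleftrightarrow>
     (\<forall>n\<in>{1..N}. \<forall>i\<in>{1..J+1}.
        has_walsh_integral M (space_time T) W
          (\<lambda>(t, x). indicator (time_slab T N n) t * hat J i x) (R n i))"

definition W_hat ::
  "real \<Rightarrow> nat \<Rightarrow> nat \<Rightarrow> (nat \<Rightarrow> nat \<Rightarrow> 'w \<Rightarrow> real) \<Rightarrow> real \<Rightarrow> real \<Rightarrow> 'w \<Rightarrow> real" where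
  "W_hat T N J R t x \<omega> =
     1 / (T / real N) *
     (\<Sum>n\<in>{1..N}. indicator (time_slab T N n) t *
        (\<Sum>l\<in>{1..J+1}. (\<Sum>m\<in>{1..J+1}. gram_inv J l m * R n m \<omega>) * hat J l x))"

definition u_hat ::
  "real \<Rightarrow> real \<Rightarrow> nat \<Rightarrow> nat \<Rightarrow> (nat \<Rightarrow> nat \<Rightarrow> 'w \<Rightarrow> real) \<Rightarrow> real \<Rightarrow> real \<Rightarrow> 'w \<Rightarrow> real" where
  "u_hat \<mu> T N J R t x \<omega> =
     (LINT s:{0<..<t}|lborel. LINT y:{0<..<1}|lborel. Psi \<mu> (t - s) x y * W_hat T N J R s y \<omega>)"


section \<open>The error\<close>

text \<open>Norm and expectation are extended-valued, so that a bound on them includes finiteness.\<close>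

definition ennsqrt :: "ennreal \<Rightarrow> ennreal" where
  "ennsqrt a = (if a = \<infinity> then \<infinity> else ennreal (sqrt (enn2real a)))"

definition L2_norm_D :: "(real \<Rightarrow> real) \<Rightarrow> ennreal" where
  "L2_norm_D v = ennsqrt (\<integral>\<^sup>+x\<in>{0<..<1}. ennreal ((v x)\<^sup>2) \<partial>lborel)"

definition rms_error ::
  "'w measure \<Rightarrow> (real \<Rightarrow> 'w \<Rightarrow> real) \<Rightarrow> (real \<Rightarrow> 'w \<Rightarrow> real) \<Rightarrow> ennreal" where
  "rms_error M v w = ennsqrt (\<integral>\<^sup>+\<omega>. (L2_norm_D (\<lambda>x. v x \<omega> - w x \<omega>))\<^sup>2 \<partial>M)"

definition omega0 :: "real \<Rightarrow> real" where
  "omega0 \<Delta>t = sqrt (1 + \<Delta>t powr (3/4))"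

end

(*
  The Walsh isometry turns the mean square error into the L^2 norm of (I - P) applied to the kernel
  of u, where P is the L^2 projection onto the tensor products of piecewise constants in time and
  linear splines in space. Expanding in the sine basis in x, the squared error is the sum over k of
  E_k = |(I - P)(a_k (x) eps_k')|^2 with a_k(s) = exp(-rate k (t - s)) for s < t. Since a_k has
  squared norm O(k^-4), E_k = O(k^-2); since a_k is monotone apart from one jump, sampling it in time
  and interpolating eps_k' in space gives E_k = O(k^2 dt + dx^2) for k <= J. Cutting the sum at
  min(dt^(-1/4), J) yields O(dt^(1/4) (1 + dt^(3/4)) + dx). The series converges uniformly and
  its terms are continuous in t, so the maximum over [0,T] is attained.
*)

theory Submission
  imports Defs "Jordan_Normal_Form.Determinant"
begin

section \<open>Isometry of the Walsh integral\<close>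

text \<open>The projection arises because the inverse hat Gram matrix divided by the time step
  inverts the Gram matrix of the products of a slab indicator and a hat. So \<open>u_hat\<close> is
  the Walsh integral of the projected kernel, and the inverse matrix never has to be estimated: best
  approximation admits any explicit spline as competitor. Two obstacles shape the rest. The
  available pointwise bound on the kernel degenerates as s approaches t; hence the projection is
  estimated on single modes, which are bounded, and the kernel enters only through its moments
  against the basis. Parseval is applied in x at fixed (s, y), where the projection acts, so it
  passes through the expansion. Secondly, sampling a_k with a Lipschitz bound would cost a factor of
  order k^4, whereas bounded variation gives O(dt) uniformly in k. The exponent 1/4 balances k^3 dt,
  the accumulated sampling error up to k, with 1/k, the tail of the k^-2 bounds; the final square
  root halves it to 1/8.\<close>

lemma integrable_mult_of_squares:
  fixes f g :: "'a \<Rightarrow> real"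
  assumes [measurable]: "f \<in> borel_measurable M" "g \<in> borel_measurable M"
    and "integrable M (\<lambda>x. (f x)\<^sup>2)" "integrable M (\<lambda>x. (g x)\<^sup>2)"
  shows "integrable M (\<lambda>x. f x * g x)"
proof (rule Bochner_Integration.integrable_bound)
  show "integrable M (\<lambda>x. (f x)\<^sup>2 + (g x)\<^sup>2)" using assms by simp
  have "\<bar>f x * g x\<bar> \<le> (f x)\<^sup>2 + (g x)\<^sup>2" for x
  proof -
    have "0 \<le> (\<bar>f x\<bar> - \<bar>g x\<bar>)\<^sup>2" "0 \<le> \<bar>f x\<bar> * \<bar>g x\<bar>" by simp_all
    then show ?thesis unfolding power2_diff abs_mult power2_abs by linarith
  qed
  then show "AE x in M. norm (f x * g x) \<le> norm ((f x)\<^sup>2 + (g x)\<^sup>2)" by simp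
qed simp

text \<open>A substitute for the L^2 triangle inequality that avoids roots of extended integrals:
  the factor of \<open>y\<^sup>2\<close> can be brought as close to 1 as desired, at the price of a
  large factor on the error.\<close>

lemma square_le_weighted:
  fixes x y \<delta> :: real
  assumes "\<delta> > 0"
  shows "x\<^sup>2 \<le> (1 + \<delta>) * y\<^sup>2 + (1 + 1/\<delta>) * (x - y)\<^sup>2"
proof -
  have "0 \<le> (\<delta> * y - (x - y))\<^sup>2 / \<delta>" using assms by simp
  also have "\<dots> = (1 + \<delta>) * y\<^sup>2 + (1 + 1/\<delta>) * (x - y)\<^sup>2 - x\<^sup>2"
    using assms by (simp add: field_simps power2_eq_square)
  finally show ?thesis by simp
qed

lemma nn_integral_square_le_weighted:
  fixes f g :: "'a \<Rightarrow> real"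
  assumes [measurable]: "f \<in> borel_measurable M" "g \<in> borel_measurable M" and "\<delta> > 0"
  shows "(\<integral>\<^sup>+x. ennreal ((f x)\<^sup>2) \<partial>M) \<le> ennreal (1 + \<delta>) * (\<integral>\<^sup>+x. ennreal ((g x)\<^sup>2) \<partial>M)
           + ennreal (1 + 1/\<delta>) * (\<integral>\<^sup>+x. ennreal ((f x - g x)\<^sup>2) \<partial>M)"
proof -
  have "(\<integral>\<^sup>+x. ennreal ((f x)\<^sup>2) \<partial>M)
      \<le> (\<integral>\<^sup>+x. ennreal (1 + \<delta>) * ennreal ((g x)\<^sup>2) + ennreal (1 + 1/\<delta>) * ennreal ((f x - g x)\<^sup>2) \<partial>M)"
    using assms square_le_weighted[OF \<open>\<delta> > 0\<close>]
    by (intro nn_integral_mono) (simp flip: ennreal_mult ennreal_plus)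
  then show ?thesis by (simp add: nn_integral_add nn_integral_cmult)
qed

text \<open>The chain \<open>f\<close>, \<open>fn n\<close>, \<open>gn n\<close>, \<open>g\<close>
  costs a factor \<open>1 + \<delta>\<close> at each end plus errors that vanish with n. Letting n
  tend to infinity and then \<delta> to 0 leaves the constant 1. Square integrability of
  \<open>f\<close> is part of the conclusion.\<close>

lemma nn_integral_square_limit_le:
  fixes f :: "'a \<Rightarrow> real" and g :: "'b \<Rightarrow> real"
  assumes [measurable]: "f \<in> borel_measurable M" "\<And>n. fn n \<in> borel_measurable M"
      "g \<in> borel_measurable E" "\<And>n. gn n \<in> borel_measurable E"
    and lf: "(\<lambda>n. \<integral>\<^sup>+x. ennreal ((f x - fn n x)\<^sup>2) \<partial>M) \<longlonglongrightarrow> 0"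
    and lg: "(\<lambda>n. \<integral>\<^sup>+x. ennreal ((g x - gn n x)\<^sup>2) \<partial>E) \<longlonglongrightarrow> 0"
    and eq: "\<And>n. (\<integral>\<^sup>+x. ennreal ((fn n x)\<^sup>2) \<partial>M) = (\<integral>\<^sup>+x. ennreal ((gn n x)\<^sup>2) \<partial>E)"
    and fin: "(\<integral>\<^sup>+x. ennreal ((g x)\<^sup>2) \<partial>E) < \<infinity>"
  shows "(\<integral>\<^sup>+x. ennreal ((f x)\<^sup>2) \<partial>M) \<le> (\<integral>\<^sup>+x. ennreal ((g x)\<^sup>2) \<partial>E)"
proof -
  let ?F = "\<integral>\<^sup>+x. ennreal ((f x)\<^sup>2) \<partial>M" and ?G = "\<integral>\<^sup>+x. ennreal ((g x)\<^sup>2) \<partial>E"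
  have le: "?F \<le> ennreal (1 + \<delta>) * (ennreal (1 + \<delta>) * ?G)" if d: "\<delta> > 0" for \<delta>
  proof (rule LIMSEQ_le_const)
    let ?e = "\<lambda>n. \<integral>\<^sup>+x. ennreal ((f x - fn n x)\<^sup>2) \<partial>M"
    let ?e' = "\<lambda>n. \<integral>\<^sup>+x. ennreal ((g x - gn n x)\<^sup>2) \<partial>E"
    have "(\<lambda>n. ennreal (1 + \<delta>) * (ennreal (1 + \<delta>) * ?G + ennreal (1 + 1/\<delta>) * ?e' n)
          + ennreal (1 + 1/\<delta>) * ?e n) \<longlonglongrightarrow>
        ennreal (1 + \<delta>) * (ennreal (1 + \<delta>) * ?G + ennreal (1 + 1/\<delta>) * 0) + ennreal (1 + 1/\<delta>) * 0"
      by (intro tendsto_add tendsto_mult_ennreal tendsto_const lf lg) auto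
    then show "(\<lambda>n. ennreal (1 + \<delta>) * (ennreal (1 + \<delta>) * ?G + ennreal (1 + 1/\<delta>) * ?e' n)
          + ennreal (1 + 1/\<delta>) * ?e n) \<longlonglongrightarrow> ennreal (1 + \<delta>) * (ennreal (1 + \<delta>) * ?G)"
      by simp
    have "?F \<le> ennreal (1 + \<delta>) * (ennreal (1 + \<delta>) * ?G + ennreal (1 + 1/\<delta>) * ?e' n)
          + ennreal (1 + 1/\<delta>) * ?e n" for n
    proof -
      have "(\<integral>\<^sup>+x. ennreal ((gn n x)\<^sup>2) \<partial>E) \<le> ennreal (1 + \<delta>) * ?G + ennreal (1 + 1/\<delta>) * ?e' n"
        using nn_integral_square_le_weighted[of "gn n" E g \<delta>] d by (simp add: power2_commute)
      moreover have "?F \<le> ennreal (1 + \<delta>) * (\<integral>\<^sup>+x. ennreal ((fn n x)\<^sup>2) \<partial>M) + ennreal (1 + 1/\<delta>) * ?e n"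
        using nn_integral_square_le_weighted[of f M "fn n" \<delta>] d by simp
      ultimately show ?thesis unfolding eq by (meson add_right_mono mult_left_mono order_trans zero_le)
    qed
    then show "\<exists>N. \<forall>n\<ge>N. ?F \<le> ennreal (1 + \<delta>) * (ennreal (1 + \<delta>) * ?G + ennreal (1 + 1/\<delta>) * ?e' n)
          + ennreal (1 + 1/\<delta>) * ?e n" by blast
  qed
  have "((\<lambda>\<delta>. ennreal (1 + \<delta>) * (ennreal (1 + \<delta>) * ?G)) \<longlongrightarrow> ennreal (1 + 0) * (ennreal (1 + 0) * ?G)) (at_right 0)"
    using fin by (intro tendsto_mult_ennreal tendsto_const tendsto_ennrealI tendsto_intros) (auto simp: ennreal_mult_eq_top_iff)
  moreover have "\<forall>\<^sub>F \<delta> in at_right 0. ?F \<le> ennreal (1 + \<delta>) * (ennreal (1 + \<delta>) * ?G)"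
    using eventually_at_right_less[of 0] by eventually_elim (rule le)
  ultimately show ?thesis using tendsto_lowerbound[of _ _ "at_right (0::real)" ?F] by fastforce
qed

lemma white_noise_measurable:
  "white_noise M E W \<Longrightarrow> A \<in> finite_sets E \<Longrightarrow> W A \<in> borel_measurable M"
  by (auto simp: white_noise_def)

lemma white_noise_moments:
  assumes "prob_space M" and wn: "white_noise M E W" and A: "A \<in> finite_sets E"
  shows "integrable M (\<lambda>\<omega>. (W A \<omega>)\<^sup>2)" "integrable M (W A)"
    "(LINT \<omega>|M. W A \<omega>) = 0" "(LINT \<omega>|M. (W A \<omega>)\<^sup>2) = measure E A"
proof -
  interpret prob_space M by fact
  note [measurable] = white_noise_measurable[OF wn A]
  have "integrable M (\<lambda>\<omega>. (W A \<omega>)\<^sup>2) \<and> integrable M (W A) \<and> (LINT \<omega>|M. W A \<omega>) = 0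
      \<and> (LINT \<omega>|M. (W A \<omega>)\<^sup>2) = measure E A"
  proof (cases "measure E A = 0")
    case True
    then have ae: "AE \<omega> in M. W A \<omega> = 0" using wn A by (auto simp: white_noise_def)
    have "integrable M (\<lambda>\<omega>. (W A \<omega>)\<^sup>2) \<longleftrightarrow> integrable M (\<lambda>\<omega>. 0::real)"
      by (rule integrable_cong_AE) (use ae in auto)
    moreover have "integrable M (W A) \<longleftrightarrow> integrable M (\<lambda>\<omega>. 0::real)"
      by (rule integrable_cong_AE) (use ae in auto)
    moreover have "(LINT \<omega>|M. W A \<omega>) = (LINT \<omega>|M. 0)"
      by (rule integral_cong_AE) (use ae in auto)
    moreover have "(LINT \<omega>|M. (W A \<omega>)\<^sup>2) = (LINT \<omega>|M. 0)"
      by (rule integral_cong_AE) (use ae in auto)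
    ultimately show ?thesis using True by simp
  next
    case False
    then have s: "sqrt (measure E A) > 0" by (simp add: zero_less_measure_iff)
    have D: "distributed M lborel (W A) (normal_density 0 (sqrt (measure E A)))"
      using wn A False by (auto simp: white_noise_def)
    have e: "expectation (W A) = 0" by (rule normal_distributed_expectation[OF s D])
    have v: "variance (W A) = measure E A" using normal_distributed_variance[OF s D] by simp
    have "integrable M (\<lambda>\<omega>. (W A \<omega>)^k)" for k
      using distributed_integrable[OF D, of "\<lambda>x. x ^ k"] integrable_normal_moment[OF s, of 0 k]
      by simp
    from this[of 2] this[of 1] e v show ?thesis by simp
  qed
  then show "integrable M (\<lambda>\<omega>. (W A \<omega>)\<^sup>2)" "integrable M (W A)"
    "(LINT \<omega>|M. W A \<omega>) = 0" "(LINT \<omega>|M. (W A \<omega>)\<^sup>2) = measure E A" by auto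
qed

lemma white_noise_integrable_mult:
  assumes "prob_space M" "white_noise M E W" "A \<in> finite_sets E" "B \<in> finite_sets E"
  shows "integrable M (\<lambda>\<omega>. W A \<omega> * W B \<omega>)"
  by (intro integrable_mult_of_squares white_noise_moments(1)[OF assms(1,2)] white_noise_measurable[OF assms(2)] assms)

lemma white_noise_cov_disjoint:
  assumes "prob_space M" and wn: "white_noise M E W" and A: "A \<in> finite_sets E" "B \<in> finite_sets E"
    and disj: "A \<inter> B = {}"
  shows "(LINT \<omega>|M. W A \<omega> * W B \<omega>) = 0"
proof (cases "A = B")
  \<comment> \<open>Disjointness forces both sets to be empty. The family \<open>{A, B}\<close> then
    has one member and independence says nothing, so the variance of \<open>W {}\<close> is used
    instead.\<close>
  case True
  then have "A = {}" using disj by auto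
  then show ?thesis using white_noise_moments(4)[OF assms(1) wn A(1)] True by (simp add: power2_eq_square)
next
  case False
  interpret prob_space M by fact
  have "indep_vars (\<lambda>_. borel) W {A, B}"
  proof -
    have "{A, B} \<subseteq> finite_sets E" "finite {A, B}" "disjoint {A, B}"
      using A disj by (auto simp: disjoint_def)
    then show ?thesis using wn unfolding white_noise_def by blast
  qed
  moreover have "integrable M (W C)" if "C \<in> {A, B}" for C
    using that A white_noise_moments(2)[OF assms(1) wn] by auto
  ultimately have "expectation (\<lambda>\<omega>. \<Prod>C\<in>{A, B}. W C \<omega>) = (\<Prod>C\<in>{A, B}. expectation (W C))"
    by (intro indep_vars_lebesgue_integral) simp_all
  then show ?thesis using False white_noise_moments(3)[OF assms(1) wn] A by simp
qed

text \<open>Split both sets along their intersection. Additivity, which holds almost surely, turns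
  the product into four terms; three of them pair disjoint sets and have mean zero.\<close>

lemma white_noise_cov:
  assumes "prob_space M" and wn: "white_noise M E W" and A: "A \<in> finite_sets E" "B \<in> finite_sets E"
  shows "(LINT \<omega>|M. W A \<omega> * W B \<omega>) = measure E (A \<inter> B)"
proof -
  have fs: "S \<in> finite_sets E" if "S \<in> sets E" "S \<subseteq> A \<or> S \<subseteq> B" for S
    using that A by (auto simp: finite_sets_def) (meson emeasure_mono order_le_less_trans)+
  have sets: "A \<in> sets E" "B \<in> sets E" using A by (auto simp: finite_sets_def)
  let ?I = "A \<inter> B" and ?A = "A - B" and ?B = "B - A"
  have f: "?I \<in> finite_sets E" "?A \<in> finite_sets E" "?B \<in> finite_sets E"
    using sets by (auto intro!: fs)
  have add: "AE \<omega> in M. W (S \<union> S') \<omega> = W S \<omega> + W S' \<omega>"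
    if "S \<in> finite_sets E" "S' \<in> finite_sets E" "S \<inter> S' = {}" for S S'
    using wn that by (auto simp: white_noise_def)
  have aA: "AE \<omega> in M. W A \<omega> = W ?I \<omega> + W ?A \<omega>"
  proof -
    have "?I \<union> ?A = A" "?I \<inter> ?A = {}" by auto
    then show ?thesis using add[OF f(1,2)] by simp
  qed
  have aB: "AE \<omega> in M. W B \<omega> = W ?I \<omega> + W ?B \<omega>"
  proof -
    have "?I \<union> ?B = B" "?I \<inter> ?B = {}" by auto
    then show ?thesis using add[OF f(1,3)] by simp
  qed
  note [measurable] = white_noise_measurable[OF wn f(1)] white_noise_measurable[OF wn f(2)]
    white_noise_measurable[OF wn f(3)] white_noise_measurable[OF wn A(1)] white_noise_measurable[OF wn A(2)]
  note int = white_noise_integrable_mult[OF assms(1) wn]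
  note cov0 = white_noise_cov_disjoint[OF assms(1) wn]
  have "(LINT \<omega>|M. W A \<omega> * W B \<omega>) = (LINT \<omega>|M. W ?I \<omega> * W ?I \<omega> + W ?I \<omega> * W ?B \<omega> + W ?A \<omega> * W ?I \<omega> + W ?A \<omega> * W ?B \<omega>)"
    by (rule integral_cong_AE) (use aA aB in \<open>auto simp: algebra_simps\<close>)
  also have "\<dots> = (LINT \<omega>|M. W ?I \<omega> * W ?I \<omega>) + (LINT \<omega>|M. W ?I \<omega> * W ?B \<omega>)
      + (LINT \<omega>|M. W ?A \<omega> * W ?I \<omega>) + (LINT \<omega>|M. W ?A \<omega> * W ?B \<omega>)"
    using int f by simp
  also have "\<dots> = measure E (A \<inter> B)"
  proof -
    have "?I \<inter> ?B = {}" "?A \<inter> ?I = {}" "?A \<inter> ?B = {}" by auto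
    then show ?thesis
      using white_noise_moments(4)[OF assms(1) wn f(1)] cov0[OF f(1,3)] cov0[OF f(2,1)] cov0[OF f(2,3)]
      by (simp add: power2_eq_square)
  qed
  finally show ?thesis .
qed

text \<open>The sets in \<open>\<A>\<close> may overlap, so both squares are expanded into double
  sums and compared term by term through \<open>measure E (A \<inter> B)\<close>.\<close>

lemma walsh_isometry_elementary:
  assumes "prob_space M" and wn: "white_noise M E W" and fin: "finite \<A>" and sub: "\<A> \<subseteq> finite_sets E"
  shows "(\<integral>\<^sup>+\<omega>. ennreal ((\<Sum>A\<in>\<A>. c A * W A \<omega>)\<^sup>2) \<partial>M)
       = (\<integral>\<^sup>+z. ennreal ((\<Sum>A\<in>\<A>. c A * indicator A z)\<^sup>2) \<partial>E)"
proof -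
  have sets: "A \<in> sets E" "emeasure E A < \<infinity>" if "A \<in> \<A>" for A using that sub by (auto simp: finite_sets_def)
  have fs: "A \<in> finite_sets E" if "A \<in> \<A>" for A using that sub by auto
  have em: "emeasure E (A \<inter> B) < \<infinity>" if "A \<in> \<A>" "B \<in> \<A>" for A B
    using sets[OF that(1)] sets[OF that(2)] emeasure_mono[of "A \<inter> B" A E] by (meson Int_lower1 order_le_less_trans)
  have ex: "(\<Sum>A\<in>\<A>. c A * F A)\<^sup>2 = (\<Sum>A\<in>\<A>. \<Sum>B\<in>\<A>. c A * c B * (F A * F B))" for F :: "_ \<Rightarrow> real"
    by (simp add: power2_eq_square sum_product mult_ac)
  have iW: "integrable M (\<lambda>\<omega>. c A * c B * (W A \<omega> * W B \<omega>))" if "A \<in> \<A>" "B \<in> \<A>" for A B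
    using white_noise_integrable_mult[OF assms(1) wn fs[OF that(1)] fs[OF that(2)]] by simp
  have iI: "integrable E (\<lambda>z. c A * c B * (indicator A z * indicator B z))" if "A \<in> \<A>" "B \<in> \<A>" for A B
    using sets em that by (simp flip: indicator_inter_arith add: integrable_mult_right)
  have "(LINT \<omega>|M. (\<Sum>A\<in>\<A>. c A * W A \<omega>)\<^sup>2) = (\<Sum>A\<in>\<A>. \<Sum>B\<in>\<A>. c A * c B * measure E (A \<inter> B))"
    unfolding ex using iW white_noise_cov[OF assms(1) wn fs fs] by (simp add: integral_sum)
  also have "\<dots> = (LINT z|E. (\<Sum>A\<in>\<A>. c A * indicator A z)\<^sup>2)"
    unfolding ex using iI sets em by (simp add: integral_sum integrable_sum flip: indicator_inter_arith)
  finally have eq: "(LINT \<omega>|M. (\<Sum>A\<in>\<A>. c A * W A \<omega>)\<^sup>2) = (LINT z|E. (\<Sum>A\<in>\<A>. c A * indicator A z)\<^sup>2)" .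
  have "integrable M (\<lambda>\<omega>. (\<Sum>A\<in>\<A>. c A * W A \<omega>)\<^sup>2)" unfolding ex by (intro Bochner_Integration.integrable_sum iW)
  moreover have "integrable E (\<lambda>z. (\<Sum>A\<in>\<A>. c A * indicator A z)\<^sup>2)" unfolding ex by (intro Bochner_Integration.integrable_sum iI)
  ultimately show ?thesis using eq by (simp add: nn_integral_eq_integral)
qed

lemma walsh_isometry:
  assumes "prob_space M" and wn: "white_noise M E W" and f: "has_walsh_integral M E W f X"
  shows "(\<integral>\<^sup>+\<omega>. ennreal ((X \<omega>)\<^sup>2) \<partial>M) = (\<integral>\<^sup>+z. ennreal ((f z)\<^sup>2) \<partial>E)"
proof -
  obtain \<A> c where A: "\<And>n. finite (\<A> n)" "\<And>n. \<A> n \<subseteq> finite_sets E"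
    and lf: "(\<lambda>n. \<integral>\<^sup>+z. ennreal ((f z - (\<Sum>A\<in>\<A> n. c n A * indicator A z))\<^sup>2) \<partial>E) \<longlonglongrightarrow> 0"
    and lX: "(\<lambda>n. \<integral>\<^sup>+\<omega>. ennreal ((X \<omega> - (\<Sum>A\<in>\<A> n. c n A * W A \<omega>))\<^sup>2) \<partial>M) \<longlonglongrightarrow> 0"
    using f unfolding has_walsh_integral_def by blast
  have [measurable]: "f \<in> borel_measurable E" "X \<in> borel_measurable M" and i: "integrable E (\<lambda>z. (f z)\<^sup>2)"
    using f by (auto simp: has_walsh_integral_def)
  have m1: "(\<lambda>z. \<Sum>A\<in>\<A> n. c n A * indicator A z) \<in> borel_measurable E" for n
    using A(2)[of n] by (intro borel_measurable_sum borel_measurable_times borel_measurable_const borel_measurable_indicator)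
      (auto simp: finite_sets_def)
  have m2: "(\<lambda>\<omega>. \<Sum>A\<in>\<A> n. c n A * W A \<omega>) \<in> borel_measurable M" for n
    using A(2)[of n] by (intro borel_measurable_sum borel_measurable_times borel_measurable_const white_noise_measurable[OF wn]) auto
  note iso = walsh_isometry_elementary[OF assms(1) wn A]
  have fin: "(\<integral>\<^sup>+z. ennreal ((f z)\<^sup>2) \<partial>E) < \<infinity>" using i by (simp add: nn_integral_eq_integral)
  have 1: "(\<integral>\<^sup>+\<omega>. ennreal ((X \<omega>)\<^sup>2) \<partial>M) \<le> (\<integral>\<^sup>+z. ennreal ((f z)\<^sup>2) \<partial>E)"
    by (rule nn_integral_square_limit_le[OF _ m2 _ m1 lX lf iso fin]) auto
  \<comment> \<open>The limit lemma wants a finite right-hand side; for the reverse inequality the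
    first one supplies it.\<close>
  then have "(\<integral>\<^sup>+\<omega>. ennreal ((X \<omega>)\<^sup>2) \<partial>M) < \<infinity>" using fin by (rule order_le_less_trans)
  then have "(\<integral>\<^sup>+z. ennreal ((f z)\<^sup>2) \<partial>E) \<le> (\<integral>\<^sup>+\<omega>. ennreal ((X \<omega>)\<^sup>2) \<partial>M)"
    by (intro nn_integral_square_limit_le[OF _ m1 _ m2 lf lX iso[symmetric]]) auto
  with 1 show ?thesis by (rule antisym)
qed

lemma nn_integral_square_combination_tendsto_0:
  fixes f g :: "'a \<Rightarrow> real"
  assumes [measurable]: "f \<in> borel_measurable M" "g \<in> borel_measurable M"
      "\<And>n. fn n \<in> borel_measurable M" "\<And>n. gn n \<in> borel_measurable M"
    and lf: "(\<lambda>n. \<integral>\<^sup>+x. ennreal ((f x - fn n x)\<^sup>2) \<partial>M) \<longlonglongrightarrow> 0"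
    and lg: "(\<lambda>n. \<integral>\<^sup>+x. ennreal ((g x - gn n x)\<^sup>2) \<partial>M) \<longlonglongrightarrow> 0"
  shows "(\<lambda>n. \<integral>\<^sup>+x. ennreal ((a * f x + b * g x - (a * fn n x + b * gn n x))\<^sup>2) \<partial>M) \<longlonglongrightarrow> 0"
proof (rule tendsto_sandwich[OF _ _ tendsto_const])
  let ?F = "\<lambda>n. \<integral>\<^sup>+x. ennreal ((f x - fn n x)\<^sup>2) \<partial>M"
  let ?G = "\<lambda>n. \<integral>\<^sup>+x. ennreal ((g x - gn n x)\<^sup>2) \<partial>M"
  have "(\<lambda>n. ennreal (2 * a\<^sup>2) * ?F n + ennreal (2 * b\<^sup>2) * ?G n) \<longlonglongrightarrow> ennreal (2 * a\<^sup>2) * 0 + ennreal (2 * b\<^sup>2) * 0"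
    by (intro tendsto_add tendsto_mult_ennreal tendsto_const lf lg) auto
  then show "(\<lambda>n. ennreal (2 * a\<^sup>2) * ?F n + ennreal (2 * b\<^sup>2) * ?G n) \<longlonglongrightarrow> 0" by simp
  have pw: "(a * x + b * y - (a * x' + b * y'))\<^sup>2 \<le> 2 * a\<^sup>2 * (x - x')\<^sup>2 + 2 * b\<^sup>2 * (y - y')\<^sup>2" for x y x' y' :: real
  proof -
    have "0 \<le> (a * (x - x') - b * (y - y'))\<^sup>2" by simp
    then show ?thesis by (simp add: power2_eq_square algebra_simps)
  qed
  have "(\<integral>\<^sup>+x. ennreal ((a * f x + b * g x - (a * fn n x + b * gn n x))\<^sup>2) \<partial>M)
     \<le> (\<integral>\<^sup>+x. ennreal (2 * a\<^sup>2) * ennreal ((f x - fn n x)\<^sup>2) + ennreal (2 * b\<^sup>2) * ennreal ((g x - gn n x)\<^sup>2) \<partial>M)" for n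
    by (intro nn_integral_mono) (use pw in \<open>simp flip: ennreal_mult ennreal_plus\<close>)
  then show "\<forall>\<^sub>F n in sequentially. (\<integral>\<^sup>+x. ennreal ((a * f x + b * g x - (a * fn n x + b * gn n x))\<^sup>2) \<partial>M)
     \<le> ennreal (2 * a\<^sup>2) * ?F n + ennreal (2 * b\<^sup>2) * ?G n"
    by (simp add: nn_integral_add nn_integral_cmult)
qed simp

lemma has_walsh_integral_combination:
  assumes wn: "white_noise M E W"
    and f: "has_walsh_integral M E W f X" and g: "has_walsh_integral M E W g Y"
  shows "has_walsh_integral M E W (\<lambda>z. a * f z + b * g z) (\<lambda>\<omega>. a * X \<omega> + b * Y \<omega>)"
proof -
  obtain \<A> c where A: "\<And>n. finite (\<A> n)" "\<And>n. \<A> n \<subseteq> finite_sets E"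
    and lf: "(\<lambda>n. \<integral>\<^sup>+z. ennreal ((f z - (\<Sum>A\<in>\<A> n. c n A * indicator A z))\<^sup>2) \<partial>E) \<longlonglongrightarrow> 0"
    and lX: "(\<lambda>n. \<integral>\<^sup>+\<omega>. ennreal ((X \<omega> - (\<Sum>A\<in>\<A> n. c n A * W A \<omega>))\<^sup>2) \<partial>M) \<longlonglongrightarrow> 0"
    using f unfolding has_walsh_integral_def by blast
  obtain \<B> d where B: "\<And>n. finite (\<B> n)" "\<And>n. \<B> n \<subseteq> finite_sets E"
    and lg: "(\<lambda>n. \<integral>\<^sup>+z. ennreal ((g z - (\<Sum>A\<in>\<B> n. d n A * indicator A z))\<^sup>2) \<partial>E) \<longlonglongrightarrow> 0"
    and lY: "(\<lambda>n. \<integral>\<^sup>+\<omega>. ennreal ((Y \<omega> - (\<Sum>A\<in>\<B> n. d n A * W A \<omega>))\<^sup>2) \<partial>M) \<longlonglongrightarrow> 0"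
    using g unfolding has_walsh_integral_def by blast
  have [measurable]: "f \<in> borel_measurable E" "X \<in> borel_measurable M" "g \<in> borel_measurable E" "Y \<in> borel_measurable M"
    and i: "integrable E (\<lambda>z. (f z)\<^sup>2)" "integrable E (\<lambda>z. (g z)\<^sup>2)"
    using f g by (auto simp: has_walsh_integral_def)
  have m1: "(\<lambda>z. \<Sum>A\<in>\<S>. c A * indicator A z) \<in> borel_measurable E" if "\<S> \<subseteq> finite_sets E" for \<S> and c :: "_ \<Rightarrow> real"
    using that by (intro borel_measurable_sum borel_measurable_times borel_measurable_const borel_measurable_indicator)
      (auto simp: finite_sets_def)
  have m2: "(\<lambda>\<omega>. \<Sum>A\<in>\<S>. c A * W A \<omega>) \<in> borel_measurable M" if "\<S> \<subseteq> finite_sets E" for \<S> and c :: "_ \<Rightarrow> real"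
    using that by (intro borel_measurable_sum borel_measurable_times borel_measurable_const white_noise_measurable[OF wn]) auto
  \<comment> \<open>A set may occur in both families. Extending each coefficient function by zero
    lets the union index both sums, and the contributions of a common set add up.\<close>
  let ?e = "\<lambda>n A. a * (if A \<in> \<A> n then c n A else 0) + b * (if A \<in> \<B> n then d n A else 0)"
  have e: "(\<Sum>A\<in>\<A> n \<union> \<B> n. ?e n A * F A) = a * (\<Sum>A\<in>\<A> n. c n A * F A) + b * (\<Sum>A\<in>\<B> n. d n A * F A)"
    for n and F :: "_ \<Rightarrow> real"
  proof -
    have "(\<Sum>A\<in>\<A> n. c n A * F A) = (\<Sum>A\<in>\<A> n \<union> \<B> n. (if A \<in> \<A> n then c n A else 0) * F A)"
      using A(1)[of n] B(1)[of n] by (intro sum.mono_neutral_cong_left) auto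
    moreover have "(\<Sum>A\<in>\<B> n. d n A * F A) = (\<Sum>A\<in>\<A> n \<union> \<B> n. (if A \<in> \<B> n then d n A else 0) * F A)"
      using A(1)[of n] B(1)[of n] by (intro sum.mono_neutral_cong_left) auto
    ultimately show ?thesis by (simp add: sum_distrib_left sum.distrib algebra_simps)
  qed
  have int: "integrable E (\<lambda>z. (a * f z + b * g z)\<^sup>2)"
  proof -
    have "integrable E (\<lambda>z. a\<^sup>2 * (f z)\<^sup>2 + b\<^sup>2 * (g z)\<^sup>2 + 2 * a * b * (f z * g z))"
      using i integrable_mult_of_squares[of f E g] by auto
    also have "(\<lambda>z. a\<^sup>2 * (f z)\<^sup>2 + b\<^sup>2 * (g z)\<^sup>2 + 2 * a * b * (f z * g z)) = (\<lambda>z. (a * f z + b * g z)\<^sup>2)"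
      by (simp add: fun_eq_iff power2_eq_square algebra_simps)
    finally show ?thesis .
  qed
  show ?thesis unfolding has_walsh_integral_def
  proof (intro conjI exI[of _ "\<lambda>n. \<A> n \<union> \<B> n"] exI[of _ ?e] allI)
    show "(\<lambda>n. \<integral>\<^sup>+z. ennreal ((a * f z + b * g z - (\<Sum>A\<in>\<A> n \<union> \<B> n. ?e n A * indicator A z))\<^sup>2) \<partial>E) \<longlonglongrightarrow> 0"
      unfolding e by (intro nn_integral_square_combination_tendsto_0 lf lg m1 A B) auto
    show "(\<lambda>n. \<integral>\<^sup>+z. ennreal ((a * X z + b * Y z - (\<Sum>A\<in>\<A> n \<union> \<B> n. ?e n A * W A z))\<^sup>2) \<partial>M) \<longlonglongrightarrow> 0"
      unfolding e by (intro nn_integral_square_combination_tendsto_0 lX lY m2 A B) auto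
  qed (use A B int in auto)
qed

lemma has_walsh_integral_sum:
  assumes wn: "white_noise M E W" and "finite I"
    and "\<And>i. i \<in> I \<Longrightarrow> has_walsh_integral M E W (f i) (X i)"
  shows "has_walsh_integral M E W (\<lambda>z. \<Sum>i\<in>I. c i * f i z) (\<lambda>\<omega>. \<Sum>i\<in>I. c i * X i \<omega>)"
  using assms(2,3)
proof (induction I rule: finite_induct)
  case empty
  show ?case unfolding has_walsh_integral_def
    by (intro conjI exI[of _ "\<lambda>n. {}"]) auto
next
  case (insert i I)
  then show ?case using has_walsh_integral_combination[OF wn, of "f i" "X i" _ _ "c i" 1] by simp
qed

section \<open>Projections and linear splines\<close>

text \<open>On a finite measure this class is closed under sums and products and consists of
  integrable functions, so one predicate settles the integrability side conditions. The bound is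
  asked on \<open>space E\<close> only, because the hats are arbitrary outside [0,1].\<close>

definition bounded_measurable :: "'a measure \<Rightarrow> ('a \<Rightarrow> real) \<Rightarrow> bool" where
  "bounded_measurable E f \<longleftrightarrow> f \<in> borel_measurable E \<and> (\<exists>c. \<forall>z\<in>space E. \<bar>f z\<bar> \<le> c)"

lemma bounded_measurableI:
  "f \<in> borel_measurable E \<Longrightarrow> (\<And>z. z \<in> space E \<Longrightarrow> \<bar>f z\<bar> \<le> c) \<Longrightarrow> bounded_measurable E f"
  by (auto simp: bounded_measurable_def)

lemma bounded_measurable_measurable: "bounded_measurable E f \<Longrightarrow> f \<in> borel_measurable E"
  by (simp add: bounded_measurable_def)

lemma bounded_measurable_const: "bounded_measurable E (\<lambda>_. c)"
  by (auto simp: bounded_measurable_def)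

lemma bounded_measurable_add:
  assumes "bounded_measurable E f" "bounded_measurable E g"
  shows "bounded_measurable E (\<lambda>z. f z + g z)"
proof -
  obtain c d where "\<forall>z\<in>space E. \<bar>f z\<bar> \<le> c" "\<forall>z\<in>space E. \<bar>g z\<bar> \<le> d"
    using assms by (auto simp: bounded_measurable_def)
  then have "\<forall>z\<in>space E. \<bar>f z + g z\<bar> \<le> c + d" by (smt (verit, best))
  then show ?thesis using assms unfolding bounded_measurable_def by auto
qed

lemma bounded_measurable_mult:
  assumes "bounded_measurable E f" "bounded_measurable E g"
  shows "bounded_measurable E (\<lambda>z. f z * g z)"
proof -
  obtain c d where cd: "\<forall>z\<in>space E. \<bar>f z\<bar> \<le> c" "\<forall>z\<in>space E. \<bar>g z\<bar> \<le> d"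
    using assms by (auto simp: bounded_measurable_def)
  have "\<bar>f z * g z\<bar> \<le> c * d" if "z \<in> space E" for z
    unfolding abs_mult using cd that by (intro mult_mono) (auto intro: order_trans[OF abs_ge_zero])
  then show ?thesis using assms unfolding bounded_measurable_def by auto
qed

lemma bounded_measurable_diff:
  assumes "bounded_measurable E f" "bounded_measurable E g"
  shows "bounded_measurable E (\<lambda>z. f z - g z)"
  using bounded_measurable_add[OF assms(1) bounded_measurable_mult[OF bounded_measurable_const[of E "-1"] assms(2)]]
  by simp

lemma bounded_measurable_power2:
  assumes "bounded_measurable E f"
  shows "bounded_measurable E (\<lambda>z. (f z)\<^sup>2)"
  unfolding power2_eq_square by (rule bounded_measurable_mult[OF assms assms])

lemma bounded_measurable_sum:
  assumes "\<And>i. i \<in> I \<Longrightarrow> bounded_measurable E (f i)"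
  shows "bounded_measurable E (\<lambda>z. \<Sum>i\<in>I. f i z)"
  using assms by (induction I rule: infinite_finite_induct)
    (auto intro: bounded_measurable_const bounded_measurable_add)

lemmas bounded_measurable_intros = bounded_measurable_const bounded_measurable_add
  bounded_measurable_mult bounded_measurable_diff bounded_measurable_power2 bounded_measurable_sum

lemma (in finite_measure) bounded_measurable_integrable:
  assumes "bounded_measurable M f"
  shows "integrable M f"
proof -
  obtain c where "\<forall>z\<in>space M. \<bar>f z\<bar> \<le> c" using assms by (auto simp: bounded_measurable_def)
  then show ?thesis using assms
    by (intro integrable_const_bound[where B = c]) (auto simp: bounded_measurable_def)
qed

text \<open>This is the orthogonal projection onto the span of \<open>b\<close> only if \<open>K\<close> is a left inverse of
  the Gram matrix of \<open>b\<close>.\<close>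

definition span_proj ::
  "'a measure \<Rightarrow> 'i set \<Rightarrow> ('i \<Rightarrow> 'i \<Rightarrow> real) \<Rightarrow> ('i \<Rightarrow> 'a \<Rightarrow> real) \<Rightarrow> ('a \<Rightarrow> real) \<Rightarrow> 'a \<Rightarrow> real" where
  "span_proj E I K b g z = (\<Sum>j\<in>I. (\<Sum>i\<in>I. K i j * (LINT w|E. g w * b i w)) * b j z)"

lemma bounded_measurable_span_proj:
  "(\<And>i. i \<in> I \<Longrightarrow> bounded_measurable E (b i)) \<Longrightarrow> bounded_measurable E (span_proj E I K b g)"
  unfolding span_proj_def by (intro bounded_measurable_intros) auto

text \<open>Interchanging the sums puts the product of \<open>K\<close> with the Gram matrix in
  front of the moments of \<open>g\<close>, and the duality reduces it to a Kronecker delta.\<close>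

lemma span_proj_orthogonal:
  assumes "finite_measure E" "finite I"
    and b: "\<And>i. i \<in> I \<Longrightarrow> bounded_measurable E (b i)" and g: "bounded_measurable E g"
    and dual: "\<And>i k. i \<in> I \<Longrightarrow> k \<in> I \<Longrightarrow>
      (\<Sum>j\<in>I. K i j * (LINT w|E. b j w * b k w)) = (if i = k then 1 else 0)"
    and k: "k \<in> I"
  shows "(LINT z|E. (g z - span_proj E I K b g z) * b k z) = 0"
proof -
  interpret finite_measure E by fact
  have "(LINT z|E. span_proj E I K b g z * b k z)
      = (LINT z|E. (\<Sum>j\<in>I. (\<Sum>i\<in>I. K i j * (LINT w|E. g w * b i w)) * (b j z * b k z)))"
    by (simp add: span_proj_def sum_distrib_right mult.assoc)
  also have "\<dots> = (\<Sum>j\<in>I. (\<Sum>i\<in>I. K i j * (LINT w|E. g w * b i w)) * (LINT z|E. b j z * b k z))"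
    using b k by (subst Bochner_Integration.integral_sum)
      (auto intro!: bounded_measurable_integrable bounded_measurable_intros)
  also have "\<dots> = (\<Sum>i\<in>I. (LINT w|E. g w * b i w) * (\<Sum>j\<in>I. K i j * (LINT z|E. b j z * b k z)))"
    unfolding sum_distrib_right sum_distrib_left by (subst sum.swap) (simp add: mult_ac)
  also have "\<dots> = (\<Sum>i\<in>I. if i = k then (LINT w|E. g w * b i w) else 0)"
    using dual[OF _ k] by (intro sum.cong) auto
  also have "\<dots> = (LINT w|E. g w * b k w)" using k \<open>finite I\<close> by simp
  finally have "(LINT z|E. span_proj E I K b g z * b k z) = (LINT w|E. g w * b k w)" .
  then show ?thesis using b g k bounded_measurable_span_proj[of I E b K g]
    by (simp add: left_diff_distrib bounded_measurable_integrable bounded_measurable_mult)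
qed

text \<open>Pythagoras: the projection minus the competitor lies in the span and is orthogonal to
  the residual. This is what replaces the projection, which involves an inverse matrix, by
  hand-picked coefficients \<open>c\<close>.\<close>

lemma span_proj_best_approximation:
  assumes "finite_measure E" "finite I"
    and b: "\<And>i. i \<in> I \<Longrightarrow> bounded_measurable E (b i)" and g: "bounded_measurable E g"
    and dual: "\<And>i k. i \<in> I \<Longrightarrow> k \<in> I \<Longrightarrow>
      (\<Sum>j\<in>I. K i j * (LINT w|E. b j w * b k w)) = (if i = k then 1 else 0)"
  shows "(LINT z|E. (g z - span_proj E I K b g z)\<^sup>2) \<le> (LINT z|E. (g z - (\<Sum>j\<in>I. c j * b j z))\<^sup>2)"
proof -
  interpret finite_measure E by fact
  let ?P = "span_proj E I K b g"
  let ?v = "\<lambda>z. \<Sum>j\<in>I. c j * b j z"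
  define d where "d j = (\<Sum>i\<in>I. K i j * (LINT w|E. g w * b i w)) - c j" for j
  have w: "?P z - ?v z = (\<Sum>j\<in>I. d j * b j z)" for z
    by (simp add: span_proj_def d_def sum_subtractf left_diff_distrib)
  have P: "bounded_measurable E ?P" using b by (rule bounded_measurable_span_proj)
  have v: "bounded_measurable E ?v" using b by (intro bounded_measurable_intros)
  have "(LINT z|E. (g z - ?P z) * (?P z - ?v z)) = (LINT z|E. (\<Sum>j\<in>I. d j * ((g z - ?P z) * b j z)))"
    unfolding w sum_distrib_left by (simp add: mult_ac)
  also have "\<dots> = (\<Sum>j\<in>I. d j * (LINT z|E. (g z - ?P z) * b j z))"
    using b g P by (subst Bochner_Integration.integral_sum)
      (auto intro!: bounded_measurable_integrable bounded_measurable_intros)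
  also have "\<dots> = 0" using span_proj_orthogonal[OF assms] by simp
  finally have 0: "(LINT z|E. (g z - ?P z) * (?P z - ?v z)) = 0" .
  have "(LINT z|E. (g z - ?v z)\<^sup>2)
      = (LINT z|E. (g z - ?P z)\<^sup>2 + 2 * ((g z - ?P z) * (?P z - ?v z)) + (?P z - ?v z)\<^sup>2)"
    by (intro Bochner_Integration.integral_cong) (auto simp: power2_eq_square algebra_simps)
  also have "\<dots> = (LINT z|E. (g z - ?P z)\<^sup>2) + 2 * (LINT z|E. (g z - ?P z) * (?P z - ?v z)) + (LINT z|E. (?P z - ?v z)\<^sup>2)"
    using g P v by (simp add: bounded_measurable_integrable bounded_measurable_intros)
  finally show ?thesis using 0 by simp
qed

section \<open>Linear splines on the spatial grid\<close>

lemma spline_affine: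
  assumes J: "J \<ge> 1" and f: "f \<in> spline_space J" and j: "j \<in> {1..J}"
    and x: "x \<in> {node J (j - 1)..node J j}"
  shows "f x = (real j - real J * x) * f (node J (j - 1)) + (real J * x - (real j - 1)) * f (node J j)"
proof -
  let ?I = "{node J (j - 1)<..<node J j}"
  have lt: "node J (j - 1) < node J j" using J j by (auto simp: node_def field_simps)
  have cl: "closure ?I = {node J (j - 1)..node J j}" using lt by (rule closure_greaterThanLessThan)
  have sub: "{node J (j - 1)..node J j} \<subseteq> {0..1}" using J j by (auto simp: node_def field_simps)
  obtain a b where ab: "\<And>y. y \<in> ?I \<Longrightarrow> f y = a + b * y" using f j unfolding spline_space_def by blast
  \<comment> \<open>\<open>spline_space\<close> prescribes affine values on open cells only.
    Continuity carries the formula to the two nodes, where it is evaluated to express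
    \<open>a\<close> and \<open>b\<close> by nodal values.\<close>
  have "continuous_on {node J (j - 1)..node J j} f"
    using f sub unfolding spline_space_def by (auto intro: continuous_on_subset)
  then have "continuous_on (closure ?I) (\<lambda>y. f y - (a + b * y))"
    unfolding cl by (intro continuous_intros)
  from continuous_constant_on_closure[OF this, of 0] ab
  have aff: "f y = a + b * y" if "y \<in> {node J (j - 1)..node J j}" for y
    using that unfolding cl by (metis (no_types, lifting) diff_self eq_iff_diff_eq_0)
  have "node J (j - 1) \<in> {node J (j - 1)..node J j}" "node J j \<in> {node J (j - 1)..node J j}" using lt by auto
  note eqs = aff[OF this(1)] aff[OF this(2)] aff[OF x]
  show ?thesis unfolding eqs using J j by (simp add: node_def of_nat_diff field_simps)
qed

lemma cell_exists:
  assumes J: "J \<ge> 1" and x: "x \<in> {0..1}"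
  obtains j where "j \<in> {1..J}" "x \<in> {node J (j - 1)..node J j}"
proof (cases "x = 1")
  \<comment> \<open>At the right end the floor used below would select a cell \<open>J + 1\<close>;
    the last cell is taken instead.\<close>
  case True
  then show ?thesis using J by (intro that[of J]) (auto simp: node_def field_simps of_nat_diff)
next
  case False
  define k where "k = nat \<lfloor>real J * x\<rfloor>"
  have Jx: "real J * x \<ge> 0" "real J * x < real J" using x False J by auto
  have k: "real k \<le> real J * x" "real J * x < real k + 1" using Jx unfolding k_def by linarith+
  then have "k < J" using Jx by linarith
  then show ?thesis using k J by (intro that[of "k + 1"]) (auto simp: node_def field_simps)
qed

text \<open>Hat \<open>i\<close> belongs to node \<open>i - 1\<close>, so cell \<open>j\<close>,
  which lies between nodes \<open>j - 1\<close> and \<open>j\<close>, sees only hats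
  \<open>j\<close> and \<open>j + 1\<close>.\<close>

lemma spline_combination:
  assumes J: "J \<ge> 1" and j: "j \<in> {1..J}" and x: "x \<in> {node J (j - 1)..node J j}"
  shows "(\<Sum>i\<in>{1..J+1}. c i * hat J i x) = (real j - real J * x) * c j + (real J * x - (real j - 1)) * c (j + 1)"
proof -
  have h: "hat J i x = (if i = j then real j - real J * x else 0) + (if i = j + 1 then real J * x - (real j - 1) else 0)"
    if "i \<in> {1..J+1}" for i
  proof -
    note hs = hat_spec[OF J that]
    have "hat J i (node J (j - 1)) = (if i = j then 1 else 0)" "hat J i (node J j) = (if i = j + 1 then 1 else 0)"
      using hs j by auto
    then show ?thesis using spline_affine[OF J conjunct1[OF hs] j x] by simp
  qed
  have "(\<Sum>i\<in>{1..J+1}. c i * hat J i x) = (\<Sum>i\<in>{1..J+1}. (if i = j then c i * (real j - real J * x) else 0)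
      + (if i = j + 1 then c i * (real J * x - (real j - 1)) else 0))"
    by (intro sum.cong refl) (simp add: h)
  also have "\<dots> = (real j - real J * x) * c j + (real J * x - (real j - 1)) * c (j + 1)"
    using j by (simp add: sum.distrib)
  finally show ?thesis .
qed

lemma hat_bounds:
  assumes J: "J \<ge> 1" and i: "i \<in> {1..J+1}" and x: "x \<in> {0..1}"
  shows "0 \<le> hat J i x" "hat J i x \<le> 1"
proof -
  obtain j where j: "j \<in> {1..J}" "x \<in> {node J (j - 1)..node J j}" using cell_exists[OF J x] .
  have r: "real j - 1 \<le> real J * x" "real J * x \<le> real j"
    using j J by (auto simp: node_def field_simps of_nat_diff)
  have "hat J i x = (\<Sum>k\<in>{1..J+1}. (if k = i then 1 else 0) * hat J k x)"
    using i by (simp add: if_distrib[of "\<lambda>c. c * _"] cong: if_cong)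
  also have "\<dots> = (real j - real J * x) * (if j = i then 1 else 0) + (real J * x - (real j - 1)) * (if j + 1 = i then 1 else 0)"
    by (rule spline_combination[OF J j])
  finally show "0 \<le> hat J i x" "hat J i x \<le> 1" using r by auto
qed

text \<open>On a cell the interpolant is a convex combination of two nodal values, hence the error
  is one of two increments over a distance of at most \<open>1 / real J\<close>. First order is
  enough: the modes have Lipschitz constant of order k^2, which the norm of \<open>decay\<close>, of
  order k^-2, cancels.\<close>

lemma spline_interpolation_error:
  assumes J: "J \<ge> 1" and x: "x \<in> {0..1}"
    and lip: "\<And>y y'. y \<in> {0..1} \<Longrightarrow> y' \<in> {0..1} \<Longrightarrow> \<bar>\<phi> y - \<phi> y'\<bar> \<le> L * \<bar>y - y'\<bar>" and L: "L \<ge> 0"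
  shows "\<bar>\<phi> x - (\<Sum>i\<in>{1..J+1}. \<phi> (node J (i - 1)) * hat J i x)\<bar> \<le> L * (1 / real J)"
proof -
  obtain j where j: "j \<in> {1..J}" "x \<in> {node J (j - 1)..node J j}" using cell_exists[OF J x] .
  have r: "real j - 1 \<le> real J * x" "real J * x \<le> real j"
    using j J by (auto simp: node_def field_simps of_nat_diff)
  define \<theta> where "\<theta> = real J * x - (real j - 1)"
  have th: "0 \<le> \<theta>" "\<theta> \<le> 1" using r by (auto simp: \<theta>_def)
  have n01: "node J (j - 1) \<in> {0..1}" "node J j \<in> {0..1}" using j J by (auto simp: node_def field_simps)
  have d: "\<bar>x - node J (j - 1)\<bar> \<le> 1 / real J" "\<bar>x - node J j\<bar> \<le> 1 / real J"
  proof -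
    have "x - node J (j - 1) = (real J * x - (real j - 1)) / real J" "x - node J j = (real J * x - real j) / real J"
      using J j by (auto simp: node_def of_nat_diff diff_divide_distrib)
    then show "\<bar>x - node J (j - 1)\<bar> \<le> 1 / real J" "\<bar>x - node J j\<bar> \<le> 1 / real J"
      using r by (auto simp: divide_right_mono)
  qed
  have e: "\<bar>\<phi> x - \<phi> (node J (j - 1))\<bar> \<le> L * (1 / real J)" "\<bar>\<phi> x - \<phi> (node J j)\<bar> \<le> L * (1 / real J)"
    using lip[OF x n01(1)] lip[OF x n01(2)] d L by (meson mult_left_mono order_trans)+
  have "(\<Sum>i\<in>{1..J+1}. \<phi> (node J (i - 1)) * hat J i x) = (1 - \<theta>) * \<phi> (node J (j - 1)) + \<theta> * \<phi> (node J j)"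
    using spline_combination[OF J j, of "\<lambda>i. \<phi> (node J (i - 1))"] by (simp add: \<theta>_def algebra_simps)
  then have "\<phi> x - (\<Sum>i\<in>{1..J+1}. \<phi> (node J (i - 1)) * hat J i x)
      = (1 - \<theta>) * (\<phi> x - \<phi> (node J (j - 1))) + \<theta> * (\<phi> x - \<phi> (node J j))"
    by (simp add: algebra_simps)
  also have "\<bar>\<dots>\<bar> \<le> (1 - \<theta>) * (L * (1 / real J)) + \<theta> * (L * (1 / real J))"
  proof -
    have "\<bar>(1 - \<theta>) * a + \<theta> * b\<bar> \<le> (1 - \<theta>) * \<bar>a\<bar> + \<theta> * \<bar>b\<bar>" for a b :: real
      using th by (intro order_trans[OF abs_triangle_ineq]) (simp add: abs_mult)
    also have "(1 - \<theta>) * \<bar>\<phi> x - \<phi> (node J (j - 1))\<bar> + \<theta> * \<bar>\<phi> x - \<phi> (node J j)\<bar>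
        \<le> (1 - \<theta>) * (L * (1 / real J)) + \<theta> * (L * (1 / real J))"
      by (intro add_mono mult_left_mono e) (use th in auto)
    finally show ?thesis .
  qed
  also have "\<dots> = L * (1 / real J)" by (simp only: left_diff_distrib)
  finally show ?thesis .
qed

lemma continuous_on_hat: "J \<ge> 1 \<Longrightarrow> i \<in> {1..J+1} \<Longrightarrow> continuous_on {0..1} (hat J i)"
  using hat_spec[of J i] by (auto simp: spline_space_def)

lemma set_integrable_continuous_unit:
  fixes f :: "real \<Rightarrow> real"
  assumes "continuous_on {0..1} f"
  shows "set_integrable lborel {0<..<1} f"
  by (rule set_integrable_subset[OF borel_integrable_atLeastAtMost']) (use assms in auto)

lemma set_integral_double_sum:
  fixes F :: "'i \<Rightarrow> 'i \<Rightarrow> 'a \<Rightarrow> real"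
  assumes "\<And>a b. a \<in> S \<Longrightarrow> b \<in> S \<Longrightarrow> set_integrable M A (F a b)"
  shows "(LINT x:A|M. (\<Sum>a\<in>S. \<Sum>b\<in>S. c a b * F a b x)) = (\<Sum>a\<in>S. \<Sum>b\<in>S. c a b * (LINT x:A|M. F a b x))"
proof -
  have "(LINT x:A|M. (\<Sum>a\<in>S. \<Sum>b\<in>S. c a b * F a b x))
      = (LINT x|M. (\<Sum>a\<in>S. \<Sum>b\<in>S. c a b * (indicator A x *\<^sub>R F a b x)))"
    by (simp add: set_lebesgue_integral_def sum_distrib_left mult.left_commute)
  also have "\<dots> = (\<Sum>a\<in>S. \<Sum>b\<in>S. c a b * (LINT x:A|M. F a b x))"
    using assms unfolding set_integrable_def set_lebesgue_integral_def
    by (simp add: Bochner_Integration.integral_sum Bochner_Integration.integrable_sum)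
  finally show ?thesis .
qed

text \<open>The quadratic form of \<open>gram J\<close> at \<open>v\<close> is the squared norm of
  the spline with nodal values \<open>v\<close>, so the kernel is trivial. Nonsingularity is what
  makes the value chosen by \<open>the\<close> in \<open>gram_inv\<close> a genuine inverse.\<close>

lemma gram_inverse:
  assumes J: "J \<ge> 1" and i: "i \<in> {1..J+1}" and k: "k \<in> {1..J+1}"
  shows "(\<Sum>m\<in>{1..J+1}. gram_inv J i m * (LINT x:{0<..<1}|lborel. hat J m x * hat J k x)) = (if i = k then 1 else 0)"
proof -
  let ?n = "J + 1" and ?G = "gram J"
  let ?ip = "\<lambda>f g :: real \<Rightarrow> real. LINT x:{0<..<1}|lborel. f x * g x"
  have G: "?G \<in> carrier_mat ?n ?n" by (simp add: gram_def)
  have Gij: "?G $$ (a, b) = ?ip (hat J (b + 1)) (hat J (a + 1))" if "a < ?n" "b < ?n" for a b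
    using that by (simp add: gram_def)
  have int: "set_integrable lborel {0<..<1} (\<lambda>x. hat J (a + 1) x * hat J (b + 1) x)" if "a < ?n" "b < ?n" for a b
    using that J by (intro set_integrable_continuous_unit continuous_on_mult continuous_on_hat) auto
  have "v = 0\<^sub>v ?n" if v: "v \<in> carrier_vec ?n" and z: "?G *\<^sub>v v = 0\<^sub>v ?n" for v
  proof -
    let ?c = "\<lambda>i. v $ (i - 1)"
    let ?s = "\<lambda>x. \<Sum>i\<in>{1..?n}. ?c i * hat J i x"
    have s: "?s x = (\<Sum>a<?n. v $ a * hat J (a + 1) x)" for x
      by (rule sum.reindex_bij_witness[of _ "\<lambda>a. a + 1" "\<lambda>i. i - 1"]) auto
    have row: "(\<Sum>b<?n. ?G $$ (a, b) * v $ b) = 0" if "a < ?n" for a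
      using arg_cong[OF z, of "\<lambda>w. w $ a"] that v G by (simp add: scalar_prod_def lessThan_atLeast0)
    have s2: "(?s x)\<^sup>2 = (\<Sum>a<?n. \<Sum>b<?n. v $ a * v $ b * (hat J (b + 1) x * hat J (a + 1) x))" for x
      unfolding s power2_eq_square sum_product by (simp only: mult_ac)
    have "(LINT x:{0<..<1}|lborel. (?s x)\<^sup>2)
        = (LINT x:{0<..<1}|lborel. (\<Sum>a<?n. \<Sum>b<?n. v $ a * v $ b * (hat J (b + 1) x * hat J (a + 1) x)))"
      by (simp only: s2)
    also have "\<dots> = (\<Sum>a<?n. \<Sum>b<?n. v $ a * v $ b * ?ip (hat J (b + 1)) (hat J (a + 1)))"
      using int by (intro set_integral_double_sum) auto
    also have "\<dots> = (\<Sum>a<?n. v $ a * (\<Sum>b<?n. ?G $$ (a, b) * v $ b))"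
      unfolding sum_distrib_left by (intro sum.cong refl) (simp add: Gij mult_ac)
    also have "\<dots> = 0" using row by simp
    finally have 0: "(LINT x:{0<..<1}|lborel. (?s x)\<^sup>2) = 0" .
    have cont: "continuous_on {0..1} (\<lambda>x. (?s x)\<^sup>2)"
      by (intro continuous_intros continuous_on_hat J)
    \<comment> \<open>On the closed interval a continuous nonnegative function with zero integral
      vanishes at every point, so the spline may be evaluated at all nodes, including the two
      ends.\<close>
    have "integral {0..1} (\<lambda>x. (?s x)\<^sup>2) = 0"
      using set_borel_integral_eq_integral(2)[OF set_integrable_continuous_unit[OF cont]] 0
        integral_open_interval[of 0 "1::real" "\<lambda>x. (?s x)\<^sup>2"] by simp
    then have "\<forall>x\<in>{0..1}. (?s x)\<^sup>2 = 0" using integral_eq_0_iff[OF cont] by simp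
    then have s0: "?s x = 0" if "x \<in> {0..1}" for x using that by simp
    have "v $ a = 0" if a: "a < ?n" for a
    proof -
      have n: "node J a \<in> {0..1}" using a J by (auto simp: node_def field_simps)
      have "?s (node J a) = (\<Sum>i\<in>{1..?n}. if i = a + 1 then v $ a else 0)"
        using hat_spec[OF J] a by (intro sum.cong refl) auto
      then show ?thesis using s0[OF n] a by (auto split: if_splits)
    qed
    then show ?thesis using v by (intro eq_vecI) auto
  qed
  then have "det ?G \<noteq> 0" using det_0_iff_vec_prod_zero[OF G] by blast
  then have "?G \<in> Units (ring_mat TYPE(real) ?n ())" by (rule det_non_zero_imp_unit[OF G])
  then obtain B where B: "mat_inverse ?G = Some B" using mat_inverse(1)[OF G] by fastforce
  from mat_inverse(2)[OF G B] have BG: "B * ?G = 1\<^sub>m ?n" and Bc: "B \<in> carrier_mat ?n ?n" by auto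
  have "(\<Sum>m\<in>{1..?n}. gram_inv J i m * ?ip (hat J m) (hat J k)) = (\<Sum>a<?n. B $$ (i - 1, a) * ?G $$ (a, k - 1))"
    using k by (intro sum.reindex_bij_witness[of _ "\<lambda>a. a + 1" "\<lambda>i. i - 1"])
      (auto simp: gram_inv_def B Gij mult.commute)
  also have "\<dots> = (B * ?G) $$ (i - 1, k - 1)"
  proof -
    have "i - 1 < ?n" "k - 1 < ?n" using i k by auto
    then show ?thesis using G Bc
      by (subst index_mult_mat(1)) (auto simp del: sum.lessThan_Suc simp: scalar_prod_def lessThan_atLeast0)
  qed
  also have "\<dots> = (if i = k then 1 else 0)" unfolding BG using i k by auto
  finally show ?thesis by simp
qed

section \<open>The space-time spline basis\<close>

lemma space_space_time: "space (space_time T) = {0..T} \<times> {0<..<1}"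
  by (simp add: space_time_def space_restrict_space)

lemma rectangle_in_sets_borel [measurable]: "{0..T::real} \<times> {0<..<1::real} \<in> sets borel"
  by (subst borel_prod[symmetric]) (intro pair_measureI; simp)

lemma borel_measurable_space_timeI:
  "f \<in> borel_measurable borel \<Longrightarrow> f \<in> borel_measurable (space_time T)"
  unfolding space_time_def by (intro measurable_restrict_space1) simp

lemma nn_integral_space_time:
  assumes "f \<in> borel_measurable (space_time T)"
  shows "(\<integral>\<^sup>+z. f z \<partial>space_time T) = (\<integral>\<^sup>+s\<in>{0..T}. (\<integral>\<^sup>+y\<in>{0<..<1}. f (s, y) \<partial>lborel) \<partial>lborel)"
proof -
  let ?S = "{0..T} \<times> {0<..<1::real}"
  have "(\<lambda>z. f z * indicator ?S z) \<in> borel_measurable lborel"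
    using assms unfolding space_time_def by (subst (asm) borel_measurable_restrict_space_iff_ennreal) auto
  then have m: "(\<lambda>z. f z * indicator ?S z) \<in> borel_measurable (lborel \<Otimes>\<^sub>M lborel)"
    by (simp add: lborel_prod)
  have "(\<integral>\<^sup>+z. f z \<partial>space_time T) = (\<integral>\<^sup>+z. f z * indicator ?S z \<partial>(lborel \<Otimes>\<^sub>M lborel))"
    unfolding space_time_def lborel_prod by (intro nn_integral_restrict_space) (simp add: rectangle_in_sets_borel)
  also have "\<dots> = (\<integral>\<^sup>+s. (\<integral>\<^sup>+y. f (s, y) * indicator ?S (s, y) \<partial>lborel) \<partial>lborel)"
    by (rule lborel.nn_integral_fst[OF m, symmetric])
  also have "\<dots> = (\<integral>\<^sup>+s\<in>{0..T}. (\<integral>\<^sup>+y\<in>{0<..<1}. f (s, y) \<partial>lborel) \<partial>lborel)"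
    by (intro nn_integral_cong) (auto simp: indicator_def)
  finally show ?thesis .
qed

lemma nn_integral_space_time_fst:
  assumes "F \<in> borel_measurable borel"
  shows "(\<integral>\<^sup>+z. F (fst z) \<partial>space_time T) = (\<integral>\<^sup>+s\<in>{0..T}. F s \<partial>lborel)"
  using assms by (subst nn_integral_space_time)
    (auto intro!: borel_measurable_space_timeI measurable_compose[OF _ assms] borel_measurable_continuous_onI
      continuous_on_fst continuous_on_id simp: nn_integral_cmult_indicator)

lemma finite_measure_space_time: "finite_measure (space_time T)"
proof
  have "emeasure (space_time T) (space (space_time T)) = (\<integral>\<^sup>+z. 1 \<partial>space_time T)" by simp
  also have "\<dots> = (\<integral>\<^sup>+s\<in>{0..T}. 1 \<partial>lborel)" using nn_integral_space_time_fst[of "\<lambda>_. 1" T] by simp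
  also have "\<dots> < \<infinity>" by (cases "0 \<le> T") auto
  finally show "emeasure (space_time T) (space (space_time T)) \<noteq> \<infinity>" by simp
qed

lemma integral_space_time:
  fixes f :: "real \<times> real \<Rightarrow> real"
  assumes "integrable (space_time T) f"
  shows "(LINT z|space_time T. f z) = (LINT s:{0..T}|lborel. LINT y:{0<..<1}|lborel. f (s, y))"
proof -
  let ?S = "{0..T} \<times> {0<..<1::real}"
  have "integrable lborel (\<lambda>z. indicator ?S z *\<^sub>R f z)"
    using assms unfolding space_time_def by (subst (asm) integrable_restrict_space) auto
  then have i: "integrable (lborel \<Otimes>\<^sub>M lborel) (\<lambda>z. indicator ?S z *\<^sub>R f z)" by (simp add: lborel_prod)
  have "(LINT z|space_time T. f z) = (LINT z|(lborel \<Otimes>\<^sub>M lborel). indicator ?S z *\<^sub>R f z)"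
    unfolding space_time_def lborel_prod by (intro integral_restrict_space) (simp add: rectangle_in_sets_borel)
  also have "\<dots> = (LINT s|lborel. LINT y|lborel. indicator ?S (s, y) *\<^sub>R f (s, y))"
    by (rule lborel_pair.integral_fst'[OF i, symmetric])
  also have "\<dots> = (LINT s:{0..T}|lborel. LINT y:{0<..<1}|lborel. f (s, y))"
    unfolding set_lebesgue_integral_def by (simp add: indicator_times mult.assoc)
  finally show ?thesis .
qed

definition spline_basis :: "real \<Rightarrow> nat \<Rightarrow> nat \<Rightarrow> nat \<times> nat \<Rightarrow> real \<times> real \<Rightarrow> real" where
  "spline_basis T N J = (\<lambda>(n, i) (s, y). indicator (time_slab T N n) s * hat J i y)"

text \<open>Inverse Gram matrix of \<open>spline_basis\<close>: the slabs are disjoint and equally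
  long, so that Gram matrix is block diagonal with one copy of the step length times
  \<open>gram J\<close> per slab.\<close>

definition dual_coeff :: "real \<Rightarrow> nat \<Rightarrow> nat \<Rightarrow> nat \<times> nat \<Rightarrow> nat \<times> nat \<Rightarrow> real" where
  "dual_coeff T N J = (\<lambda>(n, l) (n', m). if n = n' then 1 / (T / real N) * gram_inv J l m else 0)"

definition basis_index :: "nat \<Rightarrow> nat \<Rightarrow> (nat \<times> nat) set" where
  "basis_index N J = {1..N} \<times> {1..J+1}"

lemma time_slab_measurable [measurable]: "time_slab T N n \<in> sets borel"
  by (simp add: time_slab_def Let_def)

text \<open>A hat is an arbitrary function outside [0,1], so it is cut off before its measurability
  is claimed.\<close>

lemma borel_measurable_hat_restrict:
  assumes "J \<ge> 1" "i \<in> {1..J+1}"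
  shows "(\<lambda>y. indicator {0<..<1} y * hat J i y) \<in> borel_measurable borel"
proof -
  have "set_borel_measurable borel {0<..<1} (hat J i)"
    using continuous_on_hat[OF assms]
    by (intro set_measurable_continuous_on) (auto intro: continuous_on_subset)
  then show ?thesis by (simp add: set_borel_measurable_def)
qed

lemma bounded_measurable_spline_basis:
  assumes "J \<ge> 1" "i \<in> basis_index N J"
  shows "bounded_measurable (space_time T) (spline_basis T N J i)"
proof -
  obtain n l where i: "i = (n, l)" "l \<in> {1..J+1}" using assms by (auto simp: basis_index_def)
  have [measurable]: "(\<lambda>y. indicator {0<..<1} y * hat J l y) \<in> borel_measurable borel"
    using borel_measurable_hat_restrict assms i by blast
  show ?thesis
  proof (rule bounded_measurableI[where c = 1])
    have m: "(\<lambda>z. indicator (time_slab T N n) (fst z) * (indicator {0<..<1} (snd z) * hat J l (snd z)))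
        \<in> borel_measurable (space_time T)"
      by (rule borel_measurable_space_timeI) (simp add: borel_prod[symmetric])
    show "spline_basis T N J i \<in> borel_measurable (space_time T)"
      by (rule measurable_cong[THEN iffD1, OF _ m]) (auto simp: spline_basis_def i space_space_time)
    show "\<bar>spline_basis T N J i z\<bar> \<le> 1" if "z \<in> space (space_time T)" for z
      using that hat_bounds[OF assms(1) i(2)]
      by (cases z) (auto simp: spline_basis_def i space_space_time indicator_def)
  qed
qed

lemma time_slab_subset: "N \<ge> 1 \<Longrightarrow> n \<in> {1..N} \<Longrightarrow> T > 0 \<Longrightarrow> time_slab T N n \<subseteq> {0..T}"
proof -
  assume a: "N \<ge> 1" "n \<in> {1..N}" "T > 0"
  have "0 \<le> (real n - 1) * (T / real N)" using a by simp
  moreover have "real n * (T / real N) \<le> T"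
    using a mult_right_mono[of "real n" "real N" "T / real N"] by simp
  ultimately show ?thesis by (auto simp: time_slab_def Let_def)
qed

lemma time_slab_disjoint:
  assumes "T > 0" "N \<ge> 1" "s \<in> time_slab T N n" "s \<in> time_slab T N m"
  shows "n = m"
proof -
  let ?d = "T / real N"
  have d: "?d > 0" using assms by simp
  have "(real n - 1) * ?d < real m * ?d" "(real m - 1) * ?d < real n * ?d"
    using assms(3,4) by (auto simp: time_slab_def Let_def)
  then have "real n - 1 < real m" "real m - 1 < real n"
    using d by (simp_all only: mult_less_cancel_right_pos)
  then show ?thesis by linarith
qed

lemma measure_time_slab:
  assumes "T > 0"
  shows "emeasure lborel (time_slab T N n) = ennreal (T / real N)"
  using assms by (simp add: time_slab_def Let_def field_simps)

text \<open>Inner products factor by Fubini. Those over different slabs vanish; over the same slab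
  the step length cancels against \<open>dual_coeff\<close> and \<open>gram_inverse\<close>
  remains.\<close>

lemma dual_coeff_dual:
  assumes T: "T > 0" and N: "N \<ge> 1" and J: "J \<ge> 1"
    and i: "i \<in> basis_index N J" and k: "k \<in> basis_index N J"
  shows "(\<Sum>j\<in>basis_index N J. dual_coeff T N J i j *
            (LINT w|space_time T. spline_basis T N J j w * spline_basis T N J k w)) = (if i = k then 1 else 0)"
proof -
  interpret finite_measure "space_time T" by (rule finite_measure_space_time)
  obtain n l where il: "i = (n, l)" "n \<in> {1..N}" "l \<in> {1..J+1}" using i by (auto simp: basis_index_def)
  obtain n' l' where kl: "k = (n', l')" "n' \<in> {1..N}" "l' \<in> {1..J+1}" using k by (auto simp: basis_index_def)
  let ?ip = "\<lambda>m. LINT y:{0<..<1}|lborel. hat J m y * hat J l' y"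
  have d: "T / real N > 0" using T N by simp
  have ip: "(LINT w|space_time T. spline_basis T N J (n, m) w * spline_basis T N J (n', l') w)
      = (if n = n' then T / real N * ?ip m else 0)" if m: "m \<in> {1..J+1}" for m
  proof -
    have I: "(n, m) \<in> basis_index N J" "(n', l') \<in> basis_index N J"
      using il kl m by (auto simp: basis_index_def)
    have "(LINT w|space_time T. spline_basis T N J (n, m) w * spline_basis T N J (n', l') w)
        = (LINT s:{0..T}|lborel. LINT y:{0<..<1}|lborel.
            spline_basis T N J (n, m) (s, y) * spline_basis T N J (n', l') (s, y))"
      by (intro integral_space_time bounded_measurable_integrable bounded_measurable_mult
          bounded_measurable_spline_basis J I)
    also have "\<dots> = (LINT s:{0..T}|lborel. (if n = n' then indicator (time_slab T N n) s * ?ip m else 0))"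
    proof (intro set_lebesgue_integral_cong allI impI)
      fix s
      have ind: "indicator (time_slab T N n) s * indicator (time_slab T N n') s
          = (if n = n' then indicator (time_slab T N n) s else (0::real))"
        using time_slab_disjoint[OF T N, of s n n'] by (auto simp: indicator_def)
      have "(LINT y:{0<..<1}|lborel. spline_basis T N J (n, m) (s, y) * spline_basis T N J (n', l') (s, y))
          = (LINT y:{0<..<1}|lborel. (indicator (time_slab T N n) s * indicator (time_slab T N n') s) * (hat J m y * hat J l' y))"
        by (simp add: spline_basis_def mult_ac)
      also have "\<dots> = (indicator (time_slab T N n) s * indicator (time_slab T N n') s) * ?ip m"
        by (rule set_integral_mult_right)
      finally show "(LINT y:{0<..<1}|lborel. spline_basis T N J (n, m) (s, y) * spline_basis T N J (n', l') (s, y))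
          = (if n = n' then indicator (time_slab T N n) s * ?ip m else 0)" unfolding ind by simp
    qed simp
    also have "\<dots> = (if n = n' then T / real N * ?ip m else 0)"
    proof (cases "n = n'")
      case True
      have "(LINT s:{0..T}|lborel. indicator (time_slab T N n) s * ?ip m)
          = (LINT s|lborel. indicator (time_slab T N n) s * ?ip m)"
        unfolding set_lebesgue_integral_def using time_slab_subset[OF N il(2) T]
        by (intro Bochner_Integration.integral_cong) (auto simp: indicator_def)
      also have "\<dots> = measure lborel (time_slab T N n) * ?ip m"
        by (simp add: time_slab_measurable)
      also have "measure lborel (time_slab T N n) = T / real N"
        using d measure_time_slab[OF T, of N n] by (simp add: measure_def)
      finally show ?thesis using True by simp
    qed (simp add: set_lebesgue_integral_def)
    finally show ?thesis .
  qed
  have "(\<Sum>j\<in>basis_index N J. dual_coeff T N J i j *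
            (LINT w|space_time T. spline_basis T N J j w * spline_basis T N J k w))
      = (\<Sum>m\<in>{1..N}. \<Sum>m'\<in>{1..J+1}. dual_coeff T N J (n, l) (m, m') *
            (LINT w|space_time T. spline_basis T N J (m, m') w * spline_basis T N J (n', l') w))"
    unfolding basis_index_def il kl by (subst sum.cartesian_product) (simp add: case_prod_unfold)
  also have "\<dots> = (\<Sum>m\<in>{1..N}. if m = n then (\<Sum>m'\<in>{1..J+1}. 1 / (T / real N) * gram_inv J l m' *
            (LINT w|space_time T. spline_basis T N J (n, m') w * spline_basis T N J (n', l') w)) else 0)"
    by (intro sum.cong refl) (simp add: dual_coeff_def)
  also have "\<dots> = (\<Sum>m'\<in>{1..J+1}. 1 / (T / real N) * gram_inv J l m' *
            (LINT w|space_time T. spline_basis T N J (n, m') w * spline_basis T N J (n', l') w))"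
    using il by (simp add: sum.delta)
  also have "\<dots> = (\<Sum>m'\<in>{1..J+1}. if n = n' then gram_inv J l m' * ?ip m' else 0)"
  proof (intro sum.cong refl)
    fix m' assume "m' \<in> {1..J+1}"
    then show "1 / (T / real N) * gram_inv J l m' *
            (LINT w|space_time T. spline_basis T N J (n, m') w * spline_basis T N J (n', l') w)
        = (if n = n' then gram_inv J l m' * ?ip m' else 0)"
      unfolding ip[OF \<open>m' \<in> {1..J+1}\<close>] using T N by simp
  qed
  also have "\<dots> = (if n = n' then \<Sum>m'\<in>{1..J+1}. gram_inv J l m' * ?ip m' else 0)" by simp
  also have "\<dots> = (if i = k then 1 else 0)"
    unfolding gram_inverse[OF J il(3) kl(3)] using il kl by auto
  finally show ?thesis .
qed

section \<open>Time decay of the modes\<close>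

definition rate :: "real \<Rightarrow> nat \<Rightarrow> real" where
  "rate \<mu> k = (lam k)\<^sup>2 * ((lam k)\<^sup>2 - \<mu>)"

definition decay :: "real \<Rightarrow> nat \<Rightarrow> real \<Rightarrow> real \<Rightarrow> real" where
  "decay \<mu> k t s = indicator {0<..<t} s * exp (- (rate \<mu> k * (t - s)))"

definition mode :: "nat \<Rightarrow> real \<Rightarrow> real" where
  "mode k y = sqrt 2 * lam k * cos (lam k * y)"

text \<open>The subtracted \<mu> can make \<open>rate\<close> negative for small k. Since
  \<open>\<mu> * (lam k)\<^sup>2 \<le> (lam k) ^ 4 / 2 + \<mu>\<^sup>2 / 2\<close>, half of the
  fourth power survives; the constant \<open>\<mu>\<^sup>2 / 2\<close>, accumulated over a time of
  at most T, gives this factor, common to all modes.\<close>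

definition growth :: "real \<Rightarrow> real \<Rightarrow> real" where
  "growth \<mu> T = exp (\<mu>\<^sup>2 * T / 2)"

lemma deriv_eps: "deriv (eps k) y = mode k y"
  unfolding eps_def[abs_def] mode_def
  by (rule DERIV_imp_deriv) (auto intro!: derivative_eq_intros)

lemma lam_pos: "k \<ge> 1 \<Longrightarrow> lam k > 0"
  by (simp add: lam_def)

lemma exp_rate_le:
  assumes "0 \<le> \<tau>" "\<tau> \<le> T"
  shows "exp (- (rate \<mu> k * \<tau>)) \<le> growth \<mu> T * exp (- ((lam k) ^ 4 / 2 * \<tau>))"
proof -
  have "0 \<le> ((lam k)\<^sup>2 - \<mu>)\<^sup>2" by simp
  then have "rate \<mu> k \<ge> (lam k) ^ 4 / 2 - \<mu>\<^sup>2 / 2"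
    by (simp add: rate_def power2_eq_square power4_eq_xxxx algebra_simps)
  then have "rate \<mu> k * \<tau> \<ge> ((lam k) ^ 4 / 2 - \<mu>\<^sup>2 / 2) * \<tau>"
    using assms by (intro mult_right_mono)
  moreover have "\<mu>\<^sup>2 * \<tau> \<le> \<mu>\<^sup>2 * T" using assms by (intro mult_left_mono) auto
  ultimately have "- (rate \<mu> k * \<tau>) \<le> \<mu>\<^sup>2 * T / 2 + - ((lam k) ^ 4 / 2 * \<tau>)"
    by (simp add: algebra_simps)
  then show ?thesis unfolding growth_def by (simp flip: exp_add)
qed

lemma exp_rate_le_growth:
  assumes "0 \<le> \<tau>" "\<tau> \<le> T"
  shows "exp (- (rate \<mu> k * \<tau>)) \<le> growth \<mu> T"
proof -
  have "growth \<mu> T * exp (- ((lam k) ^ 4 / 2 * \<tau>)) \<le> growth \<mu> T * 1"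
    using assms by (intro mult_left_mono) (auto simp: growth_def)
  then show ?thesis using exp_rate_le[OF assms, of \<mu> k] by simp
qed

lemma decay_measurable [measurable]: "decay \<mu> k t \<in> borel_measurable borel"
  unfolding decay_def by measurable

lemma decay_nonneg: "0 \<le> decay \<mu> k t s"
  by (simp add: decay_def)

lemma decay_le: "t \<le> T \<Longrightarrow> decay \<mu> k t s \<le> growth \<mu> T"
  using exp_rate_le_growth[of "t - s" T \<mu> k] by (auto simp: decay_def indicator_def growth_def)

lemma nn_integral_exp_decay_le:
  assumes c: "c > 0" and t: "t \<ge> 0"
  shows "(\<integral>\<^sup>+s. ennreal (indicator {0<..<t} s * exp (- (c * (t - s)))) \<partial>lborel) \<le> ennreal (1 / c)"
proof -
  have "(\<integral>\<^sup>+s. ennreal (indicator {0<..<t} s * exp (- (c * (t - s)))) \<partial>lborel)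
      \<le> (\<integral>\<^sup>+s. ennreal (exp (- (c * (t - s)))) * indicator {0..t} s \<partial>lborel)"
    by (intro nn_integral_mono) (auto simp: indicator_def)
  also have "\<dots> = ennreal (exp (- (c * (t - t))) / c - exp (- (c * (t - 0))) / c)"
    using c t by (intro nn_integral_FTC_Icc) (auto intro!: derivative_eq_intros)
  also have "\<dots> \<le> ennreal (1 / c)" using c by (intro ennreal_leI) simp
  finally show ?thesis .
qed

text \<open>The L^1 bound serves the interchange of series and integrals, the L^2 bound after it
  serves the energies. Squaring doubles the exponent, which is why the constant 2 is absent
  there.\<close>

lemma nn_integral_decay_le:
  assumes "0 \<le> t" "t \<le> T" "k \<ge> 1"
  shows "(\<integral>\<^sup>+s. ennreal (decay \<mu> k t s) \<partial>lborel) \<le> ennreal (2 * growth \<mu> T / (lam k) ^ 4)"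
proof -
  let ?c = "(lam k) ^ 4 / 2"
  have c: "?c > 0" using lam_pos[OF assms(3)] by simp
  have "(\<integral>\<^sup>+s. ennreal (decay \<mu> k t s) \<partial>lborel)
      \<le> (\<integral>\<^sup>+s. ennreal (growth \<mu> T) * ennreal (indicator {0<..<t} s * exp (- (?c * (t - s)))) \<partial>lborel)"
  proof (intro nn_integral_mono)
    fix s show "ennreal (decay \<mu> k t s) \<le> ennreal (growth \<mu> T) * ennreal (indicator {0<..<t} s * exp (- (?c * (t - s))))"
      using exp_rate_le[of "t - s" T \<mu> k] assms
      by (subst ennreal_mult[symmetric]) (auto simp: decay_def indicator_def growth_def intro!: ennreal_leI)
  qed
  also have "\<dots> = ennreal (growth \<mu> T) * (\<integral>\<^sup>+s. ennreal (indicator {0<..<t} s * exp (- (?c * (t - s)))) \<partial>lborel)"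
    by (intro nn_integral_cmult) measurable
  also have "\<dots> \<le> ennreal (growth \<mu> T) * ennreal (1 / ?c)"
    by (intro mult_left_mono nn_integral_exp_decay_le c assms) simp
  also have "\<dots> = ennreal (2 * growth \<mu> T / (lam k) ^ 4)"
    using c by (subst ennreal_mult[symmetric]) (auto simp: growth_def)
  finally show ?thesis .
qed

lemma nn_integral_decay_square_le:
  assumes "0 \<le> t" "t \<le> T" "k \<ge> 1"
  shows "(\<integral>\<^sup>+s. ennreal ((decay \<mu> k t s)\<^sup>2) \<partial>lborel) \<le> ennreal ((growth \<mu> T)\<^sup>2 / (lam k) ^ 4)"
proof -
  let ?c = "(lam k) ^ 4"
  have c: "?c > 0" using lam_pos[OF assms(3)] by simp
  have "(\<integral>\<^sup>+s. ennreal ((decay \<mu> k t s)\<^sup>2) \<partial>lborel)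
      \<le> (\<integral>\<^sup>+s. ennreal ((growth \<mu> T)\<^sup>2) * ennreal (indicator {0<..<t} s * exp (- (?c * (t - s)))) \<partial>lborel)"
  proof (intro nn_integral_mono)
    fix s
    have "(decay \<mu> k t s)\<^sup>2 \<le> (growth \<mu> T)\<^sup>2 * (indicator {0<..<t} s * exp (- (?c * (t - s))))"
    proof (cases "s \<in> {0<..<t}")
      case True
      then have "exp (- (rate \<mu> k * (t - s))) \<le> growth \<mu> T * exp (- (?c / 2 * (t - s)))"
        using assms by (intro exp_rate_le) auto
      then have "(exp (- (rate \<mu> k * (t - s))))\<^sup>2 \<le> (growth \<mu> T * exp (- (?c / 2 * (t - s))))\<^sup>2"
        by (intro power_mono) auto
      also have "\<dots> = (growth \<mu> T)\<^sup>2 * exp (- (?c * (t - s)))"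
        by (simp add: power_mult_distrib flip: exp_double)
      finally show ?thesis using True by (simp add: decay_def)
    qed (simp add: decay_def)
    then show "ennreal ((decay \<mu> k t s)\<^sup>2) \<le> ennreal ((growth \<mu> T)\<^sup>2) * ennreal (indicator {0<..<t} s * exp (- (?c * (t - s))))"
      by (subst ennreal_mult[symmetric]) (auto intro!: ennreal_leI)
  qed
  also have "\<dots> = ennreal ((growth \<mu> T)\<^sup>2) * (\<integral>\<^sup>+s. ennreal (indicator {0<..<t} s * exp (- (?c * (t - s)))) \<partial>lborel)"
    by (intro nn_integral_cmult) measurable
  also have "\<dots> \<le> ennreal ((growth \<mu> T)\<^sup>2) * ennreal (1 / ?c)"
    by (intro mult_left_mono nn_integral_exp_decay_le c assms) simp
  also have "\<dots> = ennreal ((growth \<mu> T)\<^sup>2 / (lam k) ^ 4)"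
    using c by (subst ennreal_mult[symmetric]) auto
  finally show ?thesis .
qed

text \<open>On slabs entirely before t this is the exponential at the left end. That is not always a
  value of \<open>decay\<close>, which vanishes at s = 0. The slab straddling t gets the value 0,
  like those after t.\<close>

definition sample :: "real \<Rightarrow> real \<Rightarrow> nat \<Rightarrow> nat \<Rightarrow> real \<Rightarrow> nat \<Rightarrow> real" where
  "sample \<mu> T N k t n = (if real n * (T / real N) \<le> t
     then exp (- (rate \<mu> k * (t - (real n - 1) * (T / real N)))) else 0)"

text \<open>The slabs are open, so they miss the grid points, a finite set.\<close>

lemma AE_time_slab:
  assumes T: "T > 0" and N: "N \<ge> 1"
  shows "AE s in lborel. s \<in> {0..T} \<longrightarrow> (\<exists>n\<in>{1..N}. s \<in> time_slab T N n)"
proof -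
  let ?d = "T / real N"
  have d: "?d > 0" using T N by simp
  have "AE s in lborel. s \<notin> (\<lambda>n. real n * ?d) ` {..N}"
    by (intro AE_not_in countable_imp_null_set_lborel) auto
  then show ?thesis
  proof eventually_elim
    case (elim s)
    show ?case
    proof
      assume s: "s \<in> {0..T}"
      define m where "m = nat \<lfloor>s / ?d\<rfloor>"
      have m: "real m \<le> s / ?d" "s / ?d < real m + 1" using s d unfolding m_def by auto
      then have m': "real m * ?d \<le> s" "s < (real m + 1) * ?d"
        using d by (simp_all only: pos_le_divide_eq pos_divide_less_eq)
      have "real m * ?d \<le> real N * ?d" using m'(1) s N by simp
      then have "m \<le> N" using d by (simp only: mult_le_cancel_right_pos of_nat_le_iff)
      then have ne: "real m * ?d \<noteq> s" using elim by auto
      have "real N * ?d \<in> (\<lambda>n. real n * ?d) ` {..N}" by (intro imageI) auto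
      then have "s \<noteq> real N * ?d" using elim by metis
      then have "m \<noteq> N" using m'(1) s N by auto
      then have "m + 1 \<in> {1..N}" using \<open>m \<le> N\<close> by simp
      moreover have "s \<in> time_slab T N (m + 1)" using m' ne by (simp add: time_slab_def Let_def add.commute)
      ultimately show "\<exists>n\<in>{1..N}. s \<in> time_slab T N n" by blast
    qed
  qed
qed

text \<open>One factor of the squared error is bounded by the supremum, the other by the increment
  of a monotone function over the slab. The increments telescope, so no derivative of the
  exponential appears and the bound is uniform in \<open>k\<close>. Of the constant 2, one unit is
  the total variation and one the slab straddling t.\<close>

lemma decay_sample_error:
  assumes T: "T > 0" and N: "N \<ge> 1" and t: "t \<in> {0..T}"
  shows "(\<integral>\<^sup>+s\<in>{0..T}. ennreal ((decay \<mu> k t s - (\<Sum>n\<in>{1..N}. sample \<mu> T N k t n * indicator (time_slab T N n) s))\<^sup>2) \<partial>lborel)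
    \<le> ennreal (2 * (growth \<mu> T)\<^sup>2 * (T / real N))"
proof -
  let ?d = "T / real N" and ?B = "growth \<mu> T" and ?\<sigma> = "rate \<mu> k"
  have d: "?d > 0" and B: "?B \<ge> 0" using T N by (auto simp: growth_def)
  \<comment> \<open>Freezing the exponential at the value 1 beyond t keeps \<open>g\<close> monotone
    on the whole line and bounded by \<open>growth\<close> at every node of [0,T].\<close>
  define g where "g s = exp (- (?\<sigma> * (t - min s t)))" for s
  have gB: "0 \<le> g s" "g s \<le> ?B" if "s \<ge> 0" for s
    using exp_rate_le_growth[of "t - min s t" T \<mu> k] that t by (auto simp: g_def)
  have mono: "(x \<le> y \<longrightarrow> g x \<le> g y)" if "?\<sigma> \<ge> 0" for x y
    using that by (auto simp: g_def intro!: mult_left_mono)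
  have anti: "(x \<le> y \<longrightarrow> g y \<le> g x)" if "?\<sigma> \<le> 0" for x y
    using that by (auto simp: g_def intro!: mult_left_mono_neg)
  \<comment> \<open>A bound for the squared error on slab n: the increment term covers slabs before
    t, the indicator term the slab straddling t. After t the error is zero.\<close>
  define w where "w n = ?B * \<bar>g (real n * ?d) - g ((real n - 1) * ?d)\<bar>
      + ?B\<^sup>2 * (if (real n - 1) * ?d < t \<and> t < real n * ?d then 1 else 0)" for n
  have w0: "w n \<ge> 0" for n using B by (simp add: w_def)
  have pt: "(decay \<mu> k t s - sample \<mu> T N k t n)\<^sup>2 \<le> w n" if n: "n \<in> {1..N}" and s: "s \<in> time_slab T N n" for n s
  proof -
    let ?a = "(real n - 1) * ?d" and ?b = "real n * ?d"
    have ab: "?a < s" "s < ?b" using s by (auto simp: time_slab_def Let_def)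
    have a0: "?a \<ge> 0" using n d by (intro mult_nonneg_nonneg) auto
    show ?thesis
    proof (cases "?b \<le> t")
      case True
      have e1: "decay \<mu> k t s = g s" using True ab a0 by (simp add: decay_def g_def indicator_def)
      have e2: "sample \<mu> T N k t n = g ?a" using True ab by (simp add: sample_def g_def)
      have le: "\<bar>g s - g ?a\<bar> \<le> \<bar>g ?b - g ?a\<bar>"
        using mono[of ?a s] mono[of s ?b] anti[of ?a s] anti[of s ?b] ab by (cases "?\<sigma> \<ge> 0") auto
      have leB: "\<bar>g s - g ?a\<bar> \<le> ?B" using gB[of s] gB[of ?a] a0 ab by auto
      have "(g s - g ?a)\<^sup>2 = \<bar>g s - g ?a\<bar> * \<bar>g s - g ?a\<bar>" by (simp add: power2_eq_square)
      also have "\<dots> \<le> ?B * \<bar>g ?b - g ?a\<bar>" using le leB by (intro mult_mono) auto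
      also have "\<dots> \<le> w n" by (simp add: w_def)
      finally show ?thesis using e1 e2 by simp
    next
      case False
      then have e2: "sample \<mu> T N k t n = 0" by (simp add: sample_def)
      show ?thesis
      proof (cases "s < t")
        case True
        have "(decay \<mu> k t s)\<^sup>2 \<le> ?B\<^sup>2" using t decay_nonneg decay_le by (intro power_mono) auto
        also have "\<dots> \<le> w n" using True False ab B by (simp add: w_def)
        finally show ?thesis using e2 by simp
      qed (use e2 w0 in \<open>simp add: decay_def\<close>)
    qed
  qed
  \<comment> \<open>The direction of monotonicity depends on the sign of the rate; in either case
    all increments have one sign, so the absolute values can be taken outside the sum.\<close>
  have tele: "(\<Sum>n\<in>{1..N}. \<bar>g (real n * ?d) - g ((real n - 1) * ?d)\<bar>) \<le> ?B"
  proof -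
    have ss: "(\<Sum>n\<in>{1..M}. g (real n * ?d) - g ((real n - 1) * ?d)) = g (real M * ?d) - g 0" for M
      by (induction M) simp_all
    have step: "(real n - 1) * ?d \<le> real n * ?d" for n using d by (intro mult_right_mono) auto
    have "(\<Sum>n\<in>{1..N}. \<bar>g (real n * ?d) - g ((real n - 1) * ?d)\<bar>) = \<bar>\<Sum>n\<in>{1..N}. g (real n * ?d) - g ((real n - 1) * ?d)\<bar>"
    proof (cases "?\<sigma> \<ge> 0")
      case True
      then have "g ((real n - 1) * ?d) \<le> g (real n * ?d)" for n using mono step by blast
      then show ?thesis by (simp add: sum_nonneg)
    next
      case False
      then have le: "g (real n * ?d) \<le> g ((real n - 1) * ?d)" for n using anti[OF _] step by simp
      then have "(\<Sum>n\<in>{1..N}. g (real n * ?d) - g ((real n - 1) * ?d)) \<le> 0" by (intro sum_nonpos) simp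
      then show ?thesis using le by (simp add: abs_of_nonpos sum_negf[symmetric])
    qed
    moreover have "0 \<le> real N * ?d" using d by (intro mult_nonneg_nonneg) auto
    ultimately show ?thesis unfolding ss using gB[of "real N * ?d"] gB[of 0] by linarith
  qed
  have straddle: "(\<Sum>n\<in>{1..N}. (if (real n - 1) * ?d < t \<and> t < real n * ?d then 1 else 0)) \<le> (1::real)"
  proof -
    let ?S = "{n \<in> {1..N}. (real n - 1) * ?d < t \<and> t < real n * ?d}"
    have "\<forall>n\<in>?S. \<forall>m\<in>?S. n = m"
    proof (intro ballI)
      fix n m assume "n \<in> ?S" "m \<in> ?S"
      then show "n = m"
        by (intro time_slab_disjoint[OF T N, of t]) (auto simp only: time_slab_def Let_def greaterThanLessThan_iff)
    qed
    moreover have "finite ?S" by simp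
    ultimately have "card ?S \<le> Suc 0" by (simp only: card_le_Suc0_iff_eq)
    then show ?thesis by (simp add: sum.If_cases Int_def)
  qed
  have ws: "(\<Sum>n\<in>{1..N}. w n) \<le> 2 * ?B\<^sup>2"
  proof -
    have "(\<Sum>n\<in>{1..N}. w n) = ?B * (\<Sum>n\<in>{1..N}. \<bar>g (real n * ?d) - g ((real n - 1) * ?d)\<bar>)
        + ?B\<^sup>2 * (\<Sum>n\<in>{1..N}. (if (real n - 1) * ?d < t \<and> t < real n * ?d then 1 else 0))"
      unfolding w_def sum.distrib by (simp only: sum_distrib_left)
    also have "\<dots> \<le> ?B * ?B + ?B\<^sup>2 * 1"
      using B by (intro add_mono mult_left_mono tele straddle) auto
    finally show ?thesis by (simp add: power2_eq_square)
  qed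
  have "(\<integral>\<^sup>+s\<in>{0..T}. ennreal ((decay \<mu> k t s - (\<Sum>n\<in>{1..N}. sample \<mu> T N k t n * indicator (time_slab T N n) s))\<^sup>2) \<partial>lborel)
      \<le> (\<integral>\<^sup>+s. (\<Sum>n\<in>{1..N}. ennreal (w n) * indicator (time_slab T N n) s) \<partial>lborel)"
    using AE_time_slab[OF T N]
  proof (intro nn_integral_mono_AE, eventually_elim)
    case (elim s)
    show ?case
    proof (cases "s \<in> {0..T}")
      case True
      then obtain n where n: "n \<in> {1..N}" "s \<in> time_slab T N n" using elim by blast
      have neq: "s \<notin> time_slab T N m" if "m \<noteq> n" for m
        using time_slab_disjoint[OF T N _ n(2)] that by blast
      have "(\<Sum>m\<in>{1..N}. sample \<mu> T N k t m * indicator (time_slab T N m) s)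
          = (\<Sum>m\<in>{1..N}. if m = n then sample \<mu> T N k t n else 0)"
        using neq n(2) by (intro sum.cong refl) (auto simp: indicator_def)
      moreover have "(\<Sum>m\<in>{1..N}. ennreal (w m) * indicator (time_slab T N m) s)
          = (\<Sum>m\<in>{1..N}. if m = n then ennreal (w n) else 0)"
        using neq n(2) by (intro sum.cong refl) (auto simp: indicator_def)
      moreover have "indicator {0..T} s = (1 :: ennreal)" using True by (rule indicator_simps)
      ultimately show ?thesis using pt[OF n] n by (simp add: ennreal_leI)
    qed simp
  qed
  also have "\<dots> = (\<Sum>n\<in>{1..N}. ennreal (w n) * ennreal ?d)"
    using measure_time_slab[OF T] by (subst nn_integral_sum) (auto simp: nn_integral_cmult_indicator)
  also have "\<dots> = ennreal ((\<Sum>n\<in>{1..N}. w n) * ?d)"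
  proof -
    have "(\<Sum>n\<in>{1..N}. ennreal (w n) * ennreal ?d) = (\<Sum>n\<in>{1..N}. ennreal (w n * ?d))"
      using w0 d by (intro sum.cong refl ennreal_mult[symmetric]) auto
    also have "\<dots> = ennreal (\<Sum>n\<in>{1..N}. w n * ?d)"
      using w0 d by (intro sum_ennreal mult_nonneg_nonneg) auto
    finally show ?thesis unfolding sum_distrib_right .
  qed
  also have "\<dots> \<le> ennreal (2 * ?B\<^sup>2 * ?d)" using ws d by (intro ennreal_leI mult_right_mono) auto
  finally show ?thesis .
qed

section \<open>Projection error of a single mode\<close>

definition source :: "real \<Rightarrow> nat \<Rightarrow> real \<Rightarrow> real \<times> real \<Rightarrow> real" where
  "source \<mu> k t = (\<lambda>(s, y). decay \<mu> k t s * mode k y)"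

definition proj_noise :: "real \<Rightarrow> nat \<Rightarrow> nat \<Rightarrow> (real \<times> real \<Rightarrow> real) \<Rightarrow> real \<times> real \<Rightarrow> real" where
  "proj_noise T N J = span_proj (space_time T) (basis_index N J) (dual_coeff T N J) (spline_basis T N J)"

definition residual :: "real \<Rightarrow> real \<Rightarrow> nat \<Rightarrow> nat \<Rightarrow> nat \<Rightarrow> real \<Rightarrow> real \<times> real \<Rightarrow> real" where
  "residual \<mu> T N J k t z = source \<mu> k t z - proj_noise T N J (source \<mu> k t) z"

text \<open>The quantity E_k of the overview, as a function of the time t at which the error is
  measured.\<close>

definition energy :: "real \<Rightarrow> real \<Rightarrow> nat \<Rightarrow> nat \<Rightarrow> nat \<Rightarrow> real \<Rightarrow> real" where
  "energy \<mu> T N J k t = (LINT z|space_time T. (residual \<mu> T N J k t z)\<^sup>2)"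

lemma mode_measurable [measurable]: "mode k \<in> borel_measurable borel"
  unfolding mode_def by measurable

lemma abs_mode_le: "\<bar>mode k y\<bar> \<le> sqrt 2 * lam k"
proof -
  have "sqrt 2 * lam k * \<bar>cos (lam k * y)\<bar> \<le> sqrt 2 * lam k * 1"
    by (intro mult_left_mono) (auto simp: lam_def)
  then show ?thesis by (simp add: mode_def abs_mult lam_def)
qed

lemma mode_square_le: "(mode k y)\<^sup>2 \<le> 2 * (lam k)\<^sup>2"
  using power_mono[OF abs_mode_le[of k y], of 2] by (simp add: power_mult_distrib)

lemma mode_lipschitz: "\<bar>mode k y - mode k y'\<bar> \<le> sqrt 2 * (lam k)\<^sup>2 * \<bar>y - y'\<bar>"
proof -
  let ?a = "lam k * y" and ?b = "lam k * y'"
  have "\<bar>cos ?a - cos ?b\<bar> = 2 * (\<bar>sin ((?a + ?b) / 2)\<bar> * \<bar>sin ((?b - ?a) / 2)\<bar>)"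
    by (simp add: cos_diff_cos abs_mult)
  also have "\<dots> \<le> 2 * (1 * \<bar>(?b - ?a) / 2\<bar>)"
    by (intro mult_left_mono mult_mono abs_sin_x_le_abs_x) auto
  also have "\<dots> = lam k * \<bar>y - y'\<bar>"
    by (simp add: lam_def abs_mult abs_minus_commute flip: right_diff_distrib)
  finally have "sqrt 2 * lam k * \<bar>cos ?a - cos ?b\<bar> \<le> sqrt 2 * lam k * (lam k * \<bar>y - y'\<bar>)"
    by (intro mult_left_mono) (auto simp: lam_def)
  moreover have "\<bar>mode k y - mode k y'\<bar> = sqrt 2 * lam k * \<bar>cos ?a - cos ?b\<bar>"
    by (simp add: mode_def lam_def abs_mult flip: right_diff_distrib)
  ultimately show ?thesis by (simp add: power2_eq_square mult_ac)
qed

lemma borel_measurable_fst_comp: "F \<in> borel_measurable borel \<Longrightarrow> (\<lambda>z. F (fst z)) \<in> borel_measurable (space_time T)"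
  by (rule borel_measurable_space_timeI, rule measurable_compose[of fst _ borel])
    (auto intro!: borel_measurable_continuous_onI continuous_on_fst continuous_on_id)

lemma borel_measurable_snd_comp: "F \<in> borel_measurable borel \<Longrightarrow> (\<lambda>z. F (snd z)) \<in> borel_measurable (space_time T)"
  by (rule borel_measurable_space_timeI, rule measurable_compose[of snd _ borel])
    (auto intro!: borel_measurable_continuous_onI continuous_on_snd continuous_on_id)

lemma source_measurable [measurable]: "source \<mu> k t \<in> borel_measurable (space_time T)"
proof -
  have "(\<lambda>z. decay \<mu> k t (fst z) * mode k (snd z)) \<in> borel_measurable (space_time T)"
    by (intro borel_measurable_times borel_measurable_fst_comp borel_measurable_snd_comp) measurable
  then show ?thesis by (simp add: source_def case_prod_unfold)
qed

lemma abs_source_le: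
  assumes "t \<le> T"
  shows "\<bar>source \<mu> k t z\<bar> \<le> growth \<mu> T * (sqrt 2 * lam k)"
  using decay_nonneg[of \<mu> k t "fst z"] decay_le[OF assms, of \<mu> k "fst z"] abs_mode_le[of k "snd z"]
  by (auto simp: source_def case_prod_unfold abs_mult growth_def intro!: mult_mono)

lemma bounded_measurable_source:
  assumes "t \<le> T"
  shows "bounded_measurable (space_time T) (source \<mu> k t)"
  using abs_source_le[OF assms] by (intro bounded_measurableI) auto

lemma bounded_measurable_residual:
  assumes "t \<le> T" "J \<ge> 1"
  shows "bounded_measurable (space_time T) (residual \<mu> T N J k t)"
  unfolding residual_def proj_noise_def
  by (intro bounded_measurable_diff bounded_measurable_source bounded_measurable_span_proj
      bounded_measurable_spline_basis assms)

lemma energy_nonneg: "energy \<mu> T N J k t \<ge> 0"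
  by (simp add: energy_def)

lemma finite_basis_index: "finite (basis_index N J)"
  by (simp add: basis_index_def)

text \<open>The majorant \<open>F\<close> depends on time alone; since D has length 1, the
  space-time integral becomes an integral over [0,T], where the bounds on \<open>decay\<close>
  apply.\<close>

lemma energy_best_approximation:
  assumes T: "T > 0" and N: "N \<ge> 1" and J: "J \<ge> 1" and t: "t \<in> {0..T}"
    and F: "F \<in> borel_measurable borel" and c: "c \<ge> 0"
    and le: "\<And>s y. s \<in> {0..T} \<Longrightarrow> y \<in> {0<..<1} \<Longrightarrow>
      (source \<mu> k t (s, y) - (\<Sum>j\<in>basis_index N J. d j * spline_basis T N J j (s, y)))\<^sup>2 \<le> F s"
    and int: "(\<integral>\<^sup>+s\<in>{0..T}. ennreal (F s) \<partial>lborel) \<le> ennreal c"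
  shows "energy \<mu> T N J k t \<le> c"
proof -
  interpret finite_measure "space_time T" by (rule finite_measure_space_time)
  have b: "bounded_measurable (space_time T) (spline_basis T N J j)" if "j \<in> basis_index N J" for j
    using bounded_measurable_spline_basis[OF J that] .
  have g: "bounded_measurable (space_time T) (source \<mu> k t)" using t by (intro bounded_measurable_source) auto
  let ?v = "\<lambda>z. source \<mu> k t z - (\<Sum>j\<in>basis_index N J. d j * spline_basis T N J j z)"
  have v: "bounded_measurable (space_time T) (\<lambda>z. (?v z)\<^sup>2)"
    using b by (intro bounded_measurable_intros g) auto
  have "energy \<mu> T N J k t \<le> (LINT z|space_time T. (?v z)\<^sup>2)"
    unfolding energy_def residual_def proj_noise_def
    by (rule span_proj_best_approximation[OF finite_measure_space_time finite_basis_index b g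
          dual_coeff_dual[OF T N J]])
  moreover have "ennreal (LINT z|space_time T. (?v z)\<^sup>2) = (\<integral>\<^sup>+z. ennreal ((?v z)\<^sup>2) \<partial>space_time T)"
    using bounded_measurable_integrable[OF v] by (simp add: nn_integral_eq_integral)
  moreover have "(\<integral>\<^sup>+z. ennreal ((?v z)\<^sup>2) \<partial>space_time T) \<le> (\<integral>\<^sup>+z. ennreal (F (fst z)) \<partial>space_time T)"
    using le by (intro nn_integral_mono) (auto simp: space_space_time intro!: ennreal_leI)
  moreover have "(\<integral>\<^sup>+z. ennreal (F (fst z)) \<partial>space_time T) = (\<integral>\<^sup>+s\<in>{0..T}. ennreal (F s) \<partial>lborel)"
    using F by (intro nn_integral_space_time_fst) auto
  ultimately have "energy \<mu> T N J k t \<le> (LINT z|space_time T. (?v z)\<^sup>2)"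
    "ennreal (LINT z|space_time T. (?v z)\<^sup>2) \<le> ennreal c" using int by auto
  then show ?thesis using c by (simp add: ennreal_le_iff)
qed

text \<open>The competitor is zero, so this is the squared norm of the mode itself:
  \<open>2 * (lam k)\<^sup>2\<close> from space against the inverse fourth power from time.\<close>

lemma energy_le_inverse_square:
  assumes T: "T > 0" and N: "N \<ge> 1" and J: "J \<ge> 1" and t: "t \<in> {0..T}" and k: "k \<ge> 1"
  shows "energy \<mu> T N J k t \<le> 2 * (growth \<mu> T)\<^sup>2 / (lam k)\<^sup>2"
proof (rule energy_best_approximation[OF T N J t, where d = "\<lambda>_. 0" and F = "\<lambda>s. 2 * (lam k)\<^sup>2 * (decay \<mu> k t s)\<^sup>2"])
  show "(source \<mu> k t (s, y) - (\<Sum>j\<in>basis_index N J. 0 * spline_basis T N J j (s, y)))\<^sup>2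
      \<le> 2 * (lam k)\<^sup>2 * (decay \<mu> k t s)\<^sup>2" for s y
    using mult_right_mono[OF mode_square_le[of k y], of "(decay \<mu> k t s)\<^sup>2"]
    by (simp add: source_def power_mult_distrib mult_ac)
  have "(\<integral>\<^sup>+s\<in>{0..T}. ennreal (2 * (lam k)\<^sup>2 * (decay \<mu> k t s)\<^sup>2) \<partial>lborel)
      \<le> (\<integral>\<^sup>+s. ennreal (2 * (lam k)\<^sup>2) * ennreal ((decay \<mu> k t s)\<^sup>2) \<partial>lborel)"
    by (intro nn_integral_mono) (auto simp: indicator_def ennreal_mult)
  also have "\<dots> = ennreal (2 * (lam k)\<^sup>2) * (\<integral>\<^sup>+s. ennreal ((decay \<mu> k t s)\<^sup>2) \<partial>lborel)"
    by (intro nn_integral_cmult) measurable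
  also have "\<dots> \<le> ennreal (2 * (lam k)\<^sup>2) * ennreal ((growth \<mu> T)\<^sup>2 / (lam k) ^ 4)"
    using t k by (intro mult_left_mono nn_integral_decay_square_le) auto
  also have "\<dots> = ennreal (2 * (growth \<mu> T)\<^sup>2 / (lam k)\<^sup>2)"
    using lam_pos[OF k] by (subst ennreal_mult[symmetric]) (auto simp: power2_eq_square power4_eq_xxxx)
  finally show "(\<integral>\<^sup>+s\<in>{0..T}. ennreal (2 * (lam k)\<^sup>2 * (decay \<mu> k t s)\<^sup>2) \<partial>lborel)
      \<le> ennreal (2 * (growth \<mu> T)\<^sup>2 / (lam k)\<^sup>2)" .
qed auto

text \<open>The competitor is the sampled decay times the nodal interpolant of the mode. The three
  terms are the sampling error, the interpolation error and their product.\<close>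

lemma energy_le_mesh:
  fixes \<mu> :: real
  assumes T: "T > 0" and N: "N \<ge> 1" and J: "J \<ge> 1" and t: "t \<in> {0..T}" and k: "k \<ge> 1"
  defines "\<Delta> \<equiv> T / real N" and "h \<equiv> 1 / real J" and "B \<equiv> growth \<mu> T"
  shows "energy \<mu> T N J k t \<le> 8 * B\<^sup>2 * (lam k)\<^sup>2 * \<Delta> + 8 * B\<^sup>2 * h\<^sup>2 + 16 * B\<^sup>2 * (lam k) ^ 4 * h\<^sup>2 * \<Delta>"
proof -
  define p where "p s = (\<Sum>n\<in>{1..N}. sample \<mu> T N k t n * indicator (time_slab T N n) s)" for s
  define q where "q y = (\<Sum>i\<in>{1..J+1}. mode k (node J (i - 1)) * hat J i y)" for y
  define a where "a s = decay \<mu> k t s" for s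
  have [measurable]: "p \<in> borel_measurable borel" "a \<in> borel_measurable borel"
    unfolding p_def a_def by measurable
  have D: "\<Delta> > 0" using T N by (simp add: \<Delta>_def)
  let ?l = "lam k"
  have l: "?l > 0" using k by (rule lam_pos)
  \<comment> \<open>Coefficients that factor into a time and a space part give a product
    spline.\<close>
  have prod: "(\<Sum>j\<in>basis_index N J. (case j of (n, i) \<Rightarrow> sample \<mu> T N k t n * mode k (node J (i - 1))) * spline_basis T N J j (s, y))
      = p s * q y" for s y
    unfolding p_def q_def sum_product basis_index_def sum.cartesian_product
    by (intro sum.cong refl) (auto simp: spline_basis_def)
  let ?F = "\<lambda>s. (4 * ?l\<^sup>2 + 8 * ?l ^ 4 * h\<^sup>2) * (a s - p s)\<^sup>2 + 8 * ?l ^ 4 * h\<^sup>2 * (a s)\<^sup>2"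
  have pt: "(a s * mode k y - p s * q y)\<^sup>2 \<le> ?F s" if y: "y \<in> {0<..<1}" for s y
  proof -
    have "\<bar>mode k y - q y\<bar> \<le> sqrt 2 * ?l\<^sup>2 * (1 / real J)"
      unfolding q_def using y by (intro spline_interpolation_error J mode_lipschitz) auto
    from power_mono[OF this, of 2] have mq: "(mode k y - q y)\<^sup>2 \<le> 2 * ?l ^ 4 * h\<^sup>2"
      by (simp add: h_def power_mult_distrib power_divide)
    have "(a s * mode k y - p s * q y)\<^sup>2 \<le> 2 * ((a s - p s)\<^sup>2 * (mode k y)\<^sup>2) + 2 * ((p s)\<^sup>2 * (mode k y - q y)\<^sup>2)"
    proof -
      have "0 \<le> ((a s - p s) * mode k y - p s * (mode k y - q y))\<^sup>2" by simp
      then show ?thesis by (simp add: power2_eq_square algebra_simps)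
    qed
    also have "\<dots> \<le> 2 * ((a s - p s)\<^sup>2 * (2 * ?l\<^sup>2)) + 2 * ((p s)\<^sup>2 * (2 * ?l ^ 4 * h\<^sup>2))"
      by (intro add_mono mult_left_mono mode_square_le mq) auto
    also have "\<dots> = 4 * ?l\<^sup>2 * (a s - p s)\<^sup>2 + 4 * ?l ^ 4 * h\<^sup>2 * (p s)\<^sup>2" by simp
    \<comment> \<open>Here \<open>p\<close> is traded for \<open>a\<close> up to the sampling error,
      since it is \<open>a\<close> whose squared norm is known to be of order
      \<open>1 / ?l ^ 4\<close>, which cancels the fourth power from the interpolation.\<close>
    also have "\<dots> \<le> 4 * ?l\<^sup>2 * (a s - p s)\<^sup>2 + 4 * ?l ^ 4 * h\<^sup>2 * (2 * (a s - p s)\<^sup>2 + 2 * (a s)\<^sup>2)"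
    proof (intro add_left_mono mult_left_mono)
      have "0 \<le> (2 * a s - p s)\<^sup>2" by simp
      then show "(p s)\<^sup>2 \<le> 2 * (a s - p s)\<^sup>2 + 2 * (a s)\<^sup>2" by (simp add: power2_eq_square algebra_simps)
    qed auto
    also have "\<dots> = ?F s" by (simp add: algebra_simps)
    finally show ?thesis .
  qed
  let ?c1 = "4 * ?l\<^sup>2 + 8 * ?l ^ 4 * h\<^sup>2" and ?c2 = "8 * ?l ^ 4 * h\<^sup>2"
  have c12: "?c1 \<ge> 0" "?c2 \<ge> 0" by auto
  have "(\<integral>\<^sup>+s\<in>{0..T}. ennreal (?F s) \<partial>lborel)
      = (\<integral>\<^sup>+s. ennreal ?c1 * (ennreal ((a s - p s)\<^sup>2) * indicator {0..T} s) + ennreal ?c2 * (ennreal ((a s)\<^sup>2) * indicator {0..T} s) \<partial>lborel)"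
    by (intro nn_integral_cong) (use c12 in \<open>auto simp: indicator_def ennreal_mult ennreal_plus\<close>)
  also have "\<dots> = ennreal ?c1 * (\<integral>\<^sup>+s\<in>{0..T}. ennreal ((a s - p s)\<^sup>2) \<partial>lborel)
      + ennreal ?c2 * (\<integral>\<^sup>+s\<in>{0..T}. ennreal ((a s)\<^sup>2) \<partial>lborel)"
    by (simp add: nn_integral_add nn_integral_cmult)
  also have "\<dots> \<le> ennreal ?c1 * ennreal (2 * B\<^sup>2 * \<Delta>) + ennreal ?c2 * ennreal (B\<^sup>2 / ?l ^ 4)"
  proof (intro add_mono mult_left_mono)
    show "(\<integral>\<^sup>+s\<in>{0..T}. ennreal ((a s - p s)\<^sup>2) \<partial>lborel) \<le> ennreal (2 * B\<^sup>2 * \<Delta>)"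
      unfolding a_def p_def B_def \<Delta>_def by (rule decay_sample_error[OF T N t])
    have "(\<integral>\<^sup>+s\<in>{0..T}. ennreal ((a s)\<^sup>2) \<partial>lborel) \<le> (\<integral>\<^sup>+s. ennreal ((a s)\<^sup>2) \<partial>lborel)"
      by (intro nn_integral_mono) (auto simp: indicator_def)
    also have "\<dots> \<le> ennreal (B\<^sup>2 / ?l ^ 4)"
      unfolding a_def B_def using t k by (intro nn_integral_decay_square_le) auto
    finally show "(\<integral>\<^sup>+s\<in>{0..T}. ennreal ((a s)\<^sup>2) \<partial>lborel) \<le> ennreal (B\<^sup>2 / ?l ^ 4)" .
  qed auto
  also have "\<dots> = ennreal (?c1 * (2 * B\<^sup>2 * \<Delta>) + ?c2 * (B\<^sup>2 / ?l ^ 4))"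
  proof -
    have "ennreal a * ennreal b + ennreal c * ennreal d = ennreal (a * b + c * d)"
      if "a \<ge> 0" "b \<ge> 0" "c \<ge> 0" "d \<ge> 0" for a b c d
      using that by (simp add: ennreal_mult ennreal_plus)
    from this[of ?c1 "2 * B\<^sup>2 * \<Delta>" ?c2 "B\<^sup>2 / ?l ^ 4"] show ?thesis using c12 D by simp
  qed
  also have "?c1 * (2 * B\<^sup>2 * \<Delta>) + ?c2 * (B\<^sup>2 / ?l ^ 4)
      = 8 * B\<^sup>2 * ?l\<^sup>2 * \<Delta> + 8 * B\<^sup>2 * h\<^sup>2 + 16 * B\<^sup>2 * ?l ^ 4 * h\<^sup>2 * \<Delta>"
    using l by (simp add: algebra_simps)
  finally have "(\<integral>\<^sup>+s\<in>{0..T}. ennreal (?F s) \<partial>lborel)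
      \<le> ennreal (8 * B\<^sup>2 * ?l\<^sup>2 * \<Delta> + 8 * B\<^sup>2 * h\<^sup>2 + 16 * B\<^sup>2 * ?l ^ 4 * h\<^sup>2 * \<Delta>)" .
  then show ?thesis
    using pt D prod
    by (intro energy_best_approximation[OF T N J t, where F = ?F
          and d = "\<lambda>(n, i). sample \<mu> T N k t n * mode k (node J (i - 1))"])
      (auto simp: source_def a_def[symmetric] intro!: add_nonneg_nonneg mult_nonneg_nonneg)
qed

text \<open>Expanded, \<open>8 * pi\<^sup>2 + 16 * pi ^ 4\<close> times the squared growth: the
  coefficient of k^2 dt once the mixed term of \<open>energy_le_mesh\<close> is absorbed. It also
  dominates the constants of the other bounds.\<close>

definition energy_const :: "real \<Rightarrow> real \<Rightarrow> real" where
  "energy_const \<mu> T = 8 * (growth \<mu> T)\<^sup>2 * pi\<^sup>2 * (1 + 2 * pi\<^sup>2)"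

lemma energy_le_inverse_square':
  assumes "T > 0" "N \<ge> 1" "J \<ge> 1" "t \<in> {0..T}" "k \<ge> 1"
  shows "energy \<mu> T N J k t \<le> energy_const \<mu> T / (real k)\<^sup>2"
proof -
  have pi: "1 \<le> pi\<^sup>2" using pi_ge_two by (simp add: one_le_power)
  have "2 * (growth \<mu> T)\<^sup>2 / (lam k)\<^sup>2 = 2 * (growth \<mu> T)\<^sup>2 / pi\<^sup>2 / (real k)\<^sup>2"
    by (simp add: lam_def power_mult_distrib)
  also have "\<dots> \<le> energy_const \<mu> T / (real k)\<^sup>2"
  proof (rule divide_right_mono)
    have "2 * (growth \<mu> T)\<^sup>2 / pi\<^sup>2 \<le> 2 * (growth \<mu> T)\<^sup>2 / 1" using pi by (intro divide_left_mono) auto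
    also have "\<dots> \<le> 8 * (growth \<mu> T)\<^sup>2 * 1 * 1" by simp
    also have "\<dots> \<le> energy_const \<mu> T" unfolding energy_const_def using pi by (intro mult_mono) auto
    finally show "2 * (growth \<mu> T)\<^sup>2 / pi\<^sup>2 \<le> energy_const \<mu> T" .
  qed simp
  finally show ?thesis using energy_le_inverse_square[OF assms, of \<mu>] by simp
qed

text \<open>For \<open>k \<le> J\<close> the product of \<open>lam k\<close> and the mesh width is
  at most \<open>pi\<close>, so the mixed term is at most a multiple of the pure sampling
  term.\<close>

lemma energy_le_mesh':
  assumes T: "T > 0" "N \<ge> 1" "J \<ge> 1" "t \<in> {0..T}" "k \<ge> 1" and kJ: "k \<le> J"
  shows "energy \<mu> T N J k t \<le> energy_const \<mu> T * ((real k)\<^sup>2 * (T / real N) + (1 / real J)\<^sup>2)"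
proof -
  let ?B = "growth \<mu> T" and ?D = "T / real N" and ?h = "1 / real J" and ?l = "lam k"
  have D: "?D > 0" using T by simp
  have pi: "1 \<le> pi\<^sup>2" using pi_ge_two by (simp add: one_le_power)
  have "real k * ?h \<le> 1" using kJ T by simp
  then have "(real k * ?h)\<^sup>2 \<le> 1" by (simp add: power_le_one)
  then have "pi\<^sup>2 * (real k * ?h)\<^sup>2 \<le> pi\<^sup>2 * 1" by (intro mult_left_mono) auto
  moreover have "?l\<^sup>2 * ?h\<^sup>2 = pi\<^sup>2 * (real k * ?h)\<^sup>2" by (simp only: lam_def power_mult_distrib mult_ac)
  ultimately have lh: "?l\<^sup>2 * ?h\<^sup>2 \<le> pi\<^sup>2" by simp
  have "16 * ?B\<^sup>2 * ?l ^ 4 * ?h\<^sup>2 * ?D = (16 * ?B\<^sup>2 * ?l\<^sup>2 * ?D) * (?l\<^sup>2 * ?h\<^sup>2)"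
    by (simp add: power2_eq_square power4_eq_xxxx mult_ac)
  also have "\<dots> \<le> (16 * ?B\<^sup>2 * ?l\<^sup>2 * ?D) * pi\<^sup>2" using lh less_imp_le[OF D] by (intro mult_left_mono mult_nonneg_nonneg) simp_all
  finally have "energy \<mu> T N J k t \<le> 8 * ?B\<^sup>2 * ?l\<^sup>2 * ?D + 8 * ?B\<^sup>2 * ?h\<^sup>2 + (16 * ?B\<^sup>2 * ?l\<^sup>2 * ?D) * pi\<^sup>2"
    using energy_le_mesh[OF T, of \<mu>] by linarith
  also have "\<dots> = energy_const \<mu> T * ((real k)\<^sup>2 * ?D) + 8 * ?B\<^sup>2 * 1 * 1 * ?h\<^sup>2"
    by (simp add: energy_const_def lam_def power_mult_distrib algebra_simps)
  also have "\<dots> \<le> energy_const \<mu> T * ((real k)\<^sup>2 * ?D) + energy_const \<mu> T * ?h\<^sup>2"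
    unfolding energy_const_def using pi by (intro add_left_mono mult_right_mono mult_mono) auto
  finally show ?thesis by (simp add: distrib_left)
qed

section \<open>Sine series\<close>

abbreviation unit_measure :: "real measure" where
  "unit_measure \<equiv> restrict_space lborel {0<..<1}"

lemma finite_measure_unit: "finite_measure unit_measure"
  by (intro finite_measureI) (simp add: space_restrict_space emeasure_restrict_space)

lemma integral_cos_int:
  assumes "m \<noteq> (0::int)"
  shows "integral {0..1} (\<lambda>x. cos (of_int m * pi * x)) = 0"
proof -
  have "((\<lambda>x. cos (of_int m * pi * x)) has_integral
      (sin (of_int m * pi * 1) / (of_int m * pi) - sin (of_int m * pi * 0) / (of_int m * pi))) {0..1}"
    using assms by (intro fundamental_theorem_of_calculus)
      (auto intro!: derivative_eq_intros simp flip: has_real_derivative_iff_has_vector_derivative)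
  then show ?thesis by (simp add: integral_unique mult.commute)
qed

lemma eps_orthonormal:
  assumes "j \<ge> 1" "k \<ge> 1"
  shows "(LINT x|unit_measure. eps j x * eps k x) = (if j = k then 1 else 0)"
proof -
  have cont: "continuous_on {0..1} (\<lambda>x. eps j x * eps k x)" unfolding eps_def by (intro continuous_intros)
  have eq: "eps j x * eps k x = cos (of_int (int j - int k) * pi * x) - cos (of_int (int j + int k) * pi * x)" for x
  proof -
    have "eps j x * eps k x = (sqrt 2 * sqrt 2) * (sin (lam j * x) * sin (lam k * x))"
      by (simp only: eps_def mult_ac)
    then show ?thesis by (simp add: lam_def sin_times_sin algebra_simps)
  qed
  have "(LINT x|unit_measure. eps j x * eps k x) = (LINT x:{0<..<1}|lborel. eps j x * eps k x)"
    by (simp add: integral_restrict_space set_lebesgue_integral_def)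
  also have "\<dots> = integral {0..1} (\<lambda>x. eps j x * eps k x)"
    using set_borel_integral_eq_integral(2)[OF set_integrable_continuous_unit[OF cont]]
      integral_open_interval[of 0 "1::real" "\<lambda>x. eps j x * eps k x"] by simp
  also have "\<dots> = integral {0..1} (\<lambda>x. cos (of_int (int j - int k) * pi * x))
      - integral {0..1} (\<lambda>x. cos (of_int (int j + int k) * pi * x))"
    unfolding eq by (intro Henstock_Kurzweil_Integration.integral_diff integrable_continuous_real continuous_intros)
  also have "\<dots> = (if j = k then 1 else 0)"
  proof -
    \<comment> \<open>\<open>j + k\<close> is positive because the indices start at 1. Only
      \<open>j - k\<close> can vanish, and then the integrand is 1.\<close>
    have "integral {0..1} (\<lambda>x. cos (of_int (int j + int k) * pi * x)) = 0"
      using assms by (intro integral_cos_int) auto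
    moreover have "integral {0..1} (\<lambda>x. cos (of_int (int j - int k) * pi * x)) = (if j = k then 1 else 0)"
      using integral_cos_int[of "int j - int k"] by (cases "j = k") auto
    ultimately show ?thesis by simp
  qed
  finally show ?thesis .
qed

lemma eps_measurable [measurable]: "eps k \<in> borel_measurable borel"
  unfolding eps_def by measurable

lemma abs_eps_le: "\<bar>eps k x\<bar> \<le> sqrt 2"
  by (simp add: eps_def abs_mult mult_left_le)

lemma bounded_measurable_eps: "bounded_measurable unit_measure (eps k)"
  by (rule bounded_measurableI[OF _ abs_eps_le]) (auto intro!: measurable_restrict_space1)

lemma summable_mult_eps:
  assumes "summable (\<lambda>i. \<bar>c i\<bar>)"
  shows "summable (\<lambda>i. \<bar>c i * eps (k i) x\<bar>)"
proof (rule summable_comparison_test'[where N = 0])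
  show "summable (\<lambda>i. \<bar>c i\<bar> * sqrt 2)" using assms by (rule summable_mult2)
  show "norm \<bar>c i * eps (k i) x\<bar> \<le> \<bar>c i\<bar> * sqrt 2" for i
    by (simp add: abs_mult mult_left_mono abs_eps_le)
qed

text \<open>Absolute summability bounds all partial sums by one constant, so dominated convergence
  carries the finite Pythagoras identity to the limit.\<close>

lemma nn_integral_sine_series_square:
  fixes c :: "nat \<Rightarrow> real"
  assumes c: "summable (\<lambda>i. \<bar>c i\<bar>)"
  shows "(\<integral>\<^sup>+x. ennreal ((\<Sum>i. c i * eps (Suc i) x)\<^sup>2) \<partial>unit_measure) = (\<Sum>i. ennreal ((c i)\<^sup>2))"
proof -
  interpret finite_measure unit_measure by (rule finite_measure_unit)
  let ?S = "\<lambda>n x. \<Sum>i<n. c i * eps (Suc i) x"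
  let ?f = "\<lambda>x. \<Sum>i. c i * eps (Suc i) x"
  define C where "C = (\<Sum>i. \<bar>c i\<bar>) * sqrt 2"
  have sm: "summable (\<lambda>i. c i * eps (Suc i) x)" for x
    using summable_mult_eps[OF c, of Suc x] by (rule summable_rabs_cancel)
  have bm: "bounded_measurable unit_measure (?S n)" for n
    by (intro bounded_measurable_intros bounded_measurable_eps)
  have SC: "\<bar>?S n x\<bar> \<le> C" for n x
  proof -
    have "\<bar>?S n x\<bar> \<le> (\<Sum>i<n. \<bar>c i\<bar> * sqrt 2)"
      by (intro order_trans[OF sum_abs] sum_mono) (simp add: abs_mult mult_left_mono abs_eps_le)
    also have "\<dots> \<le> C" unfolding C_def sum_distrib_right[symmetric]
      by (intro mult_right_mono sum_le_suminf c) auto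
    finally show ?thesis .
  qed
  have lim: "(\<lambda>n. ?S n x) \<longlonglongrightarrow> ?f x" for x using sm by (rule summable_LIMSEQ)
  have fC: "\<bar>?f x\<bar> \<le> C" for x
    by (rule LIMSEQ_le_const2[OF tendsto_rabs[OF lim]]) (use SC in blast)
  have fm: "?f \<in> borel_measurable unit_measure"
    using bm by (intro borel_measurable_LIMSEQ_real[OF lim] bounded_measurable_measurable)
  have fb: "bounded_measurable unit_measure ?f" using fm fC by (rule bounded_measurableI)
  have Sn: "(LINT x|unit_measure. (?S n x)\<^sup>2) = (\<Sum>i<n. (c i)\<^sup>2)" for n
  proof -
    have "(LINT x|unit_measure. (?S n x)\<^sup>2) = (LINT x|unit_measure. (\<Sum>i<n. \<Sum>j<n. c i * c j * (eps (Suc i) x * eps (Suc j) x)))"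
      by (simp only: power2_eq_square sum_product mult_ac)
    also have "\<dots> = (\<Sum>i<n. \<Sum>j<n. c i * c j * (LINT x|unit_measure. eps (Suc i) x * eps (Suc j) x))"
      by (simp add: Bochner_Integration.integral_sum Bochner_Integration.integrable_sum bounded_measurable_integrable bounded_measurable_mult bounded_measurable_eps)
    also have "\<dots> = (\<Sum>i<n. \<Sum>j<n. if i = j then (c i)\<^sup>2 else 0)"
      by (intro sum.cong refl) (simp add: eps_orthonormal power2_eq_square)
    also have "\<dots> = (\<Sum>i<n. (c i)\<^sup>2)" by simp
    finally show ?thesis .
  qed
  have "(\<lambda>n. LINT x|unit_measure. (?S n x)\<^sup>2) \<longlonglongrightarrow> (LINT x|unit_measure. (?f x)\<^sup>2)"
  proof (rule integral_dominated_convergence[where w = "\<lambda>_. C\<^sup>2"])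
    show "AE x in unit_measure. (\<lambda>n. (?S n x)\<^sup>2) \<longlonglongrightarrow> (?f x)\<^sup>2"
      by (intro AE_I2 tendsto_power lim)
    show "AE x in unit_measure. norm ((?S n x)\<^sup>2) \<le> C\<^sup>2" for n
    proof (rule AE_I2)
      show "norm ((?S n x)\<^sup>2) \<le> C\<^sup>2" for x using power_mono[OF SC[where n = n and x = x], of 2] by simp
    qed
    show "(\<lambda>x. (?S n x)\<^sup>2) \<in> borel_measurable unit_measure" for n
      by (intro bounded_measurable_measurable bounded_measurable_power2 bm)
    show "(\<lambda>x. (?f x)\<^sup>2) \<in> borel_measurable unit_measure"
      by (intro bounded_measurable_measurable bounded_measurable_power2 fb)
  qed simp
  then have sums: "(\<lambda>i. (c i)\<^sup>2) sums (LINT x|unit_measure. (?f x)\<^sup>2)" unfolding Sn sums_def .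
  have "(\<integral>\<^sup>+x. ennreal ((?f x)\<^sup>2) \<partial>unit_measure) = ennreal (LINT x|unit_measure. (?f x)\<^sup>2)"
    using fb by (intro nn_integral_eq_integral bounded_measurable_integrable bounded_measurable_power2) auto
  also have "\<dots> = (\<Sum>i. ennreal ((c i)\<^sup>2))"
    using sums by (intro suminf_ennreal_eq[symmetric]) auto
  finally show ?thesis .
qed

section \<open>Absolute summability of the modes and of their moments\<close>

definition source_moment :: "real \<Rightarrow> real \<Rightarrow> nat \<Rightarrow> nat \<Rightarrow> nat \<Rightarrow> real \<Rightarrow> nat \<times> nat \<Rightarrow> real" where
  "source_moment \<mu> T N J k t j = (LINT z|space_time T. source \<mu> k t z * spline_basis T N J j z)"

lemma abs_spline_basis_le:
  assumes "J \<ge> 1" "j \<in> basis_index N J" "z \<in> space (space_time T)"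
  shows "\<bar>spline_basis T N J j z\<bar> \<le> 1"
  using assms hat_bounds[OF assms(1), of "snd j" "snd z"]
  by (cases z; cases j) (auto simp: spline_basis_def basis_index_def space_space_time indicator_def)

lemma inverse_power_Suc_summable:
  fixes C :: real
  assumes "m \<ge> 2"
  shows "summable (\<lambda>i. C * (1 / real (Suc i) ^ m))"
proof (rule summable_mult)
  have "summable (\<lambda>n. 1 / real n ^ m)"
    using inverse_power_summable[OF assms, where 'a = real] by (simp add: inverse_eq_divide power_one_over)
  then show "summable (\<lambda>i. 1 / real (Suc i) ^ m)" by (subst summable_Suc_iff)
qed

text \<open>For fixed 0 < s < t, bounding \<open>exp (- x)\<close> by \<open>1 / x\<close> gives
  k^-4, which beats the growth k of the mode. The bound carries the factor
  \<open>1 / (t - s)\<close>, so it is not uniform near s = t.\<close>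

lemma source_summable:
  assumes "t \<in> {0..T}"
  shows "summable (\<lambda>i. \<bar>source \<mu> (Suc i) t z\<bar>)"
proof (cases "fst z \<in> {0<..<t}")
  case True
  obtain s y where z: "z = (s, y)" by (cases z)
  let ?B = "growth \<mu> T"
  have \<tau>: "t - s > 0" "t - s \<le> T" using True assms by (auto simp: z)
  have bound: "\<bar>source \<mu> (Suc i) t z\<bar> \<le> ?B * 2 * sqrt 2 / (pi ^ 3 * (t - s)) * (1 / real (Suc i) ^ 3)" for i
  proof -
    let ?l = "lam (Suc i)"
    have l: "?l > 0" by (simp add: lam_def)
    let ?x = "?l ^ 4 / 2 * (t - s)"
    have x: "?x > 0" using l \<tau> by simp
    have "exp (- ?x) \<le> 1 / ?x"
      using exp_ge_add_one_self[of ?x] x by (simp add: exp_minus field_simps)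
    then have "?B * exp (- ?x) \<le> ?B * (1 / ?x)" by (intro mult_left_mono) (auto simp: growth_def)
    then have d: "decay \<mu> (Suc i) t s \<le> ?B * (1 / ?x)"
      using exp_rate_le[of "t - s" T \<mu> "Suc i"] \<tau> True by (simp add: decay_def z)
    have "\<bar>source \<mu> (Suc i) t z\<bar> \<le> (?B * (1 / ?x)) * (sqrt 2 * ?l)"
    proof -
      have "decay \<mu> (Suc i) t s * \<bar>mode (Suc i) y\<bar> \<le> (?B * (1 / ?x)) * (sqrt 2 * ?l)"
        by (rule mult_mono[OF d abs_mode_le order_trans[OF decay_nonneg d]]) simp
      then show ?thesis by (simp add: z source_def abs_mult decay_nonneg)
    qed
    also have "\<dots> = ?B * 2 * sqrt 2 / (pi ^ 3 * (t - s)) * (1 / real (Suc i) ^ 3)"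
    proof -
      have "B * (1 / ((r * p) ^ 4 / 2 * \<tau>)) * (q * (r * p)) = B * 2 * q / (p ^ 3 * \<tau>) * (1 / r ^ 3)"
        if "r \<noteq> 0" "p \<noteq> 0" "\<tau> \<noteq> 0" for q r p B \<tau> :: real
        using that by (simp add: field_simps power4_eq_xxxx power3_eq_cube)
      then show ?thesis unfolding lam_def using \<tau>(1) by (metis of_nat_neq_0 pi_neq_zero less_irrefl)
    qed
    finally show ?thesis .
  qed
  show ?thesis
  proof (rule summable_comparison_test'[OF inverse_power_Suc_summable[where m = 3], where N = 0])
    show "norm \<bar>source \<mu> (Suc i) t z\<bar> \<le> ?B * 2 * sqrt 2 / (pi ^ 3 * (t - s)) * (1 / real (Suc i) ^ 3)" for i
      using bound[of i] by simp
  qed simp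
next
  case False
  then have "source \<mu> (Suc i) t z = 0" for i by (cases z) (simp add: source_def decay_def)
  then show ?thesis by simp
qed

text \<open>A mode of size k times an L^1 norm of order k^-4. Integrating before estimating removes
  the singular factor of the pointwise bound; uniformity in \<open>t\<close> is used again for the
  continuity of the energies.\<close>

lemma source_L1_le:
  assumes "t \<in> {0..T}" and "J \<ge> 1" "j \<in> basis_index N J"
  shows "(LINT z|space_time T. \<bar>source \<mu> (Suc i) t z * spline_basis T N J j z\<bar>)
    \<le> 2 * sqrt 2 * growth \<mu> T / pi ^ 3 * (1 / real (Suc i) ^ 3)"
proof -
  interpret finite_measure "space_time T" by (rule finite_measure_space_time)
  let ?l = "lam (Suc i)" and ?B = "growth \<mu> T"
  have l: "?l > 0" by (simp add: lam_def)
  let ?f = "\<lambda>z. source \<mu> (Suc i) t z * spline_basis T N J j z"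
  have b: "bounded_measurable (space_time T) ?f"
    using assms by (intro bounded_measurable_mult bounded_measurable_source bounded_measurable_spline_basis) auto
  have "ennreal (LINT z|space_time T. \<bar>?f z\<bar>) = (\<integral>\<^sup>+z. ennreal \<bar>?f z\<bar> \<partial>space_time T)"
    using bounded_measurable_integrable[OF b] by (subst nn_integral_eq_integral) auto
  also have "\<dots> \<le> (\<integral>\<^sup>+z. ennreal (sqrt 2 * ?l) * ennreal (decay \<mu> (Suc i) t (fst z)) \<partial>space_time T)"
  proof (intro nn_integral_mono)
    fix z assume z: "z \<in> space (space_time T)"
    have "\<bar>?f z\<bar> \<le> (decay \<mu> (Suc i) t (fst z) * (sqrt 2 * ?l)) * 1"
      unfolding abs_mult
      by (intro mult_mono abs_spline_basis_le[OF assms(2,3) z])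
        (use decay_nonneg[of \<mu> "Suc i" t "fst z"] abs_mode_le[of "Suc i" "snd z"] l in
          \<open>auto simp: source_def case_prod_unfold abs_mult intro!: mult_left_mono\<close>)
    then show "ennreal \<bar>?f z\<bar> \<le> ennreal (sqrt 2 * ?l) * ennreal (decay \<mu> (Suc i) t (fst z))"
      using l by (subst ennreal_mult[symmetric]) (auto simp: decay_nonneg mult_ac intro!: ennreal_leI)
  qed
  also have "\<dots> = (\<integral>\<^sup>+s\<in>{0..T}. ennreal (sqrt 2 * ?l) * ennreal (decay \<mu> (Suc i) t s) \<partial>lborel)"
    by (rule nn_integral_space_time_fst) measurable
  also have "\<dots> \<le> (\<integral>\<^sup>+s. ennreal (sqrt 2 * ?l) * ennreal (decay \<mu> (Suc i) t s) \<partial>lborel)"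
    by (intro nn_integral_mono) (auto simp: indicator_def)
  also have "\<dots> = ennreal (sqrt 2 * ?l) * (\<integral>\<^sup>+s. ennreal (decay \<mu> (Suc i) t s) \<partial>lborel)"
    by (intro nn_integral_cmult) measurable
  also have "\<dots> \<le> ennreal (sqrt 2 * ?l) * ennreal (2 * ?B / ?l ^ 4)"
    using assms by (intro mult_left_mono nn_integral_decay_le) auto
  also have "\<dots> = ennreal (2 * sqrt 2 * ?B / pi ^ 3 * (1 / real (Suc i) ^ 3))"
  proof -
    have "q * (r * p) * (2 * B / (r * p) ^ 4) = 2 * q * B / p ^ 3 * (1 / r ^ 3)"
      if "r \<noteq> 0" "p \<noteq> 0" for q r p B :: real
      using that by (simp add: field_simps power4_eq_xxxx power3_eq_cube)
    then have e: "2 * sqrt 2 * ?B / pi ^ 3 * (1 / real (Suc i) ^ 3) = sqrt 2 * ?l * (2 * ?B / ?l ^ 4)"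
      unfolding lam_def by (metis of_nat_neq_0 pi_neq_zero)
    show ?thesis unfolding e using l by (subst ennreal_mult) (auto simp: growth_def)
  qed
  finally show ?thesis by (subst (asm) ennreal_le_iff) (auto simp: growth_def)
qed

lemma source_L1_summable:
  assumes "t \<in> {0..T}" and "J \<ge> 1" "j \<in> basis_index N J"
  shows "summable (\<lambda>i. LINT z|space_time T. \<bar>source \<mu> (Suc i) t z * spline_basis T N J j z\<bar>)"
proof (rule summable_comparison_test'[OF inverse_power_Suc_summable[where m = 3], where N = 0])
  show "norm (LINT z|space_time T. \<bar>source \<mu> (Suc i) t z * spline_basis T N J j z\<bar>)
      \<le> 2 * sqrt 2 * growth \<mu> T / pi ^ 3 * (1 / real (Suc i) ^ 3)" for i
    using source_L1_le[OF assms, of \<mu> i] by simp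
qed simp

lemma source_moment_summable:
  assumes "t \<in> {0..T}" and "J \<ge> 1" "j \<in> basis_index N J"
  shows "summable (\<lambda>i. \<bar>source_moment \<mu> T N J (Suc i) t j\<bar>)"
  unfolding source_moment_def
  by (rule summable_comparison_test'[OF source_L1_summable[OF assms, of \<mu>], where N = 0])
    (use integral_abs_bound in auto)

section \<open>The regularized solution as a Walsh integral\<close>

definition forcing :: "real \<Rightarrow> real \<Rightarrow> real \<Rightarrow> real \<times> real \<Rightarrow> real" where
  "forcing \<mu> t x = (\<lambda>(s, y). indicator {0<..<t} s * Psi \<mu> (t - s) x y)"

lemma forcing_eq_suminf: "forcing \<mu> t x z = (\<Sum>i. - eps (Suc i) x * source \<mu> (Suc i) t z)"
  if "t \<in> {0..T}"
proof -
  obtain s y where z: "z = (s, y)" by (cases z)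
  have sm: "summable (\<lambda>i. eps (Suc i) x * source \<mu> (Suc i) t z)"
    using summable_mult_eps[OF source_summable[OF that], of \<mu> z Suc x]
    by (simp add: mult.commute summable_rabs_cancel)
  have "forcing \<mu> t x z = - (\<Sum>i. eps (Suc i) x * source \<mu> (Suc i) t z)"
    by (cases "s \<in> {0<..<t}")
      (simp_all add: z forcing_def Psi_def Let_def source_def decay_def deriv_eps rate_def mult_ac)
  then show ?thesis using suminf_minus[OF sm] by simp
qed

text \<open>The pointwise bound behind \<open>source_summable\<close> degenerates at s = t, so
  integrability and termwise integration are both drawn from the summable L^1 norms of the
  terms.\<close>

lemma forcing_moment:
  assumes t: "t \<in> {0..T}" and J: "J \<ge> 1" and j: "j \<in> basis_index N J"
  shows "integrable (space_time T) (\<lambda>z. forcing \<mu> t x z * spline_basis T N J j z)"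
    and "(\<lambda>i. - eps (Suc i) x * source_moment \<mu> T N J (Suc i) t j) sums
      (LINT z|space_time T. forcing \<mu> t x z * spline_basis T N J j z)"
proof -
  interpret finite_measure "space_time T" by (rule finite_measure_space_time)
  let ?b = "spline_basis T N J j"
  let ?f = "\<lambda>i z. - eps (Suc i) x * (source \<mu> (Suc i) t z * ?b z)"
  have bm: "bounded_measurable (space_time T) (\<lambda>z. source \<mu> (Suc i) t z * ?b z)" for i
    using t by (intro bounded_measurable_mult bounded_measurable_source bounded_measurable_spline_basis J j) auto
  have int: "integrable (space_time T) (?f i)" for i
    by (intro integrable_mult_right bounded_measurable_integrable bm)
  have "summable (\<lambda>i. norm (?f i z))" if z: "z \<in> space (space_time T)" for z
  proof -
    have "summable (\<lambda>i. \<bar>source \<mu> (Suc i) t z * eps (Suc i) x\<bar> * \<bar>?b z\<bar>)"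
      by (intro summable_mult2 summable_mult_eps source_summable[OF t])
    then show ?thesis by (simp add: abs_mult mult_ac)
  qed
  then have ae: "AE z in space_time T. summable (\<lambda>i. norm (?f i z))" by (intro AE_I2)
  have "summable (\<lambda>i. \<bar>LINT z|space_time T. \<bar>source \<mu> (Suc i) t z * ?b z\<bar>\<bar>)"
    using source_L1_summable[OF t J j, of \<mu>] by simp
  from summable_mult_eps[OF this, of Suc x]
  have L1: "summable (\<lambda>i. LINT z|space_time T. norm (?f i z))"
    by (simp add: abs_mult mult_ac)
  have eq: "(\<Sum>i. ?f i z) = forcing \<mu> t x z * ?b z" for z
  proof -
    have "summable (\<lambda>i. - eps (Suc i) x * source \<mu> (Suc i) t z)"
      using summable_mult_eps[OF source_summable[OF t], of \<mu> z Suc x]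
      by (rule summable_rabs_cancel[OF summable_cong[THEN iffD1, rotated]]) (simp add: abs_mult)
    from suminf_mult2[OF this, of "?b z"] show ?thesis
      by (simp add: forcing_eq_suminf[OF t] mult.assoc)
  qed
  show "integrable (space_time T) (\<lambda>z. forcing \<mu> t x z * ?b z)"
    using integrable_suminf[OF int ae L1] unfolding eq .
  show "(\<lambda>i. - eps (Suc i) x * source_moment \<mu> T N J (Suc i) t j) sums
      (LINT z|space_time T. forcing \<mu> t x z * ?b z)"
    using sums_integral[OF int ae L1] unfolding eq by (simp add: source_moment_def)
qed

lemma proj_source_eq:
  "proj_noise T N J (source \<mu> k t) z = (\<Sum>j\<in>basis_index N J.
     (\<Sum>i\<in>basis_index N J. dual_coeff T N J i j * source_moment \<mu> T N J k t i) * spline_basis T N J j z)"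
  by (simp add: proj_noise_def span_proj_def source_moment_def)

text \<open>Supplies, for each fixed (s, y), the coefficients to which
  \<open>nn_integral_sine_series_square\<close> is applied. The projected part is a finite
  combination of moments and inherits their summability.\<close>

lemma residual_summable:
  assumes t: "t \<in> {0..T}" and J: "J \<ge> 1"
  shows "summable (\<lambda>i. \<bar>residual \<mu> T N J (Suc i) t z\<bar>)"
proof -
  let ?I = "basis_index N J"
  let ?g = "\<lambda>i. \<Sum>j\<in>?I. (\<Sum>l\<in>?I. \<bar>dual_coeff T N J l j\<bar> * \<bar>source_moment \<mu> T N J (Suc i) t l\<bar>) * \<bar>spline_basis T N J j z\<bar>"
  have "summable (\<lambda>i. \<bar>source \<mu> (Suc i) t z\<bar> + ?g i)"
    by (intro summable_add source_summable[OF t] summable_sum summable_mult2 summable_mult source_moment_summable t J)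
  then show ?thesis
  proof (rule summable_comparison_test'[where N = 0])
    fix i
    have "\<bar>proj_noise T N J (source \<mu> (Suc i) t) z\<bar> \<le> ?g i"
      unfolding proj_source_eq
    proof (intro order_trans[OF sum_abs] sum_mono)
      fix j
      show "\<bar>(\<Sum>l\<in>?I. dual_coeff T N J l j * source_moment \<mu> T N J (Suc i) t l) * spline_basis T N J j z\<bar>
        \<le> (\<Sum>l\<in>?I. \<bar>dual_coeff T N J l j\<bar> * \<bar>source_moment \<mu> T N J (Suc i) t l\<bar>) * \<bar>spline_basis T N J j z\<bar>"
        unfolding abs_mult[of _ "spline_basis T N J j z"]
        by (intro mult_right_mono order_trans[OF sum_abs]) (simp_all add: abs_mult)
    qed
    then show "norm \<bar>residual \<mu> T N J (Suc i) t z\<bar> \<le> \<bar>source \<mu> (Suc i) t z\<bar> + ?g i"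
      using abs_triangle_ineq4[of "source \<mu> (Suc i) t z" "proj_noise T N J (source \<mu> (Suc i) t) z"]
      unfolding residual_def real_norm_def abs_idempotent by linarith
  qed
qed

text \<open>\<open>proj_noise\<close> sees its argument only through finitely many moments, so it
  can be applied term by term by \<open>forcing_moment\<close>. For the whole kernel it is used as
  this formula alone; best approximation is invoked for single modes.\<close>

lemma forcing_residual_eq:
  assumes t: "t \<in> {0..T}" and J: "J \<ge> 1"
  shows "forcing \<mu> t x z - proj_noise T N J (forcing \<mu> t x) z
    = - (\<Sum>i. residual \<mu> T N J (Suc i) t z * eps (Suc i) x)"
proof -
  let ?I = "basis_index N J"
  let ?e = "\<lambda>i. - eps (Suc i) x"
  have "summable (\<lambda>i. ?e i * source \<mu> (Suc i) t z)"
    using summable_mult_eps[OF source_summable[OF t], of \<mu> z Suc x]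
    by (rule summable_rabs_cancel[OF summable_cong[THEN iffD1, rotated]]) (simp add: abs_mult)
  then have 1: "(\<lambda>i. ?e i * source \<mu> (Suc i) t z) sums forcing \<mu> t x z"
    unfolding forcing_eq_suminf[OF t] by (rule summable_sums)
  have "(\<lambda>i. \<Sum>j\<in>?I. (\<Sum>l\<in>?I. dual_coeff T N J l j * (?e i * source_moment \<mu> T N J (Suc i) t l)) * spline_basis T N J j z)
      sums proj_noise T N J (forcing \<mu> t x) z"
    unfolding proj_noise_def span_proj_def
  proof (rule sums_sum)
    fix j
    show "(\<lambda>i. (\<Sum>l\<in>?I. dual_coeff T N J l j * (?e i * source_moment \<mu> T N J (Suc i) t l)) * spline_basis T N J j z)
      sums ((\<Sum>l\<in>?I. dual_coeff T N J l j * (LINT w|space_time T. forcing \<mu> t x w * spline_basis T N J l w)) * spline_basis T N J j z)"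
      by (rule sums_mult2, rule sums_sum, rule sums_mult, rule forcing_moment(2)[OF t J])
  qed
  moreover have "(\<Sum>j\<in>?I. (\<Sum>l\<in>?I. dual_coeff T N J l j * (e * source_moment \<mu> T N J (Suc i) t l)) * spline_basis T N J j z)
      = e * proj_noise T N J (source \<mu> (Suc i) t) z" for i e
    unfolding proj_source_eq sum_distrib_left sum_distrib_right by (simp only: mult_ac)
  ultimately have 2: "(\<lambda>i. ?e i * proj_noise T N J (source \<mu> (Suc i) t) z)
      sums proj_noise T N J (forcing \<mu> t x) z" by (simp only:)
  have "?e i * source \<mu> (Suc i) t z - ?e i * proj_noise T N J (source \<mu> (Suc i) t) z
      = - (residual \<mu> T N J (Suc i) t z * eps (Suc i) x)" for i
    unfolding residual_def by (simp add: algebra_simps)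
  with sums_diff[OF 1 2]
  have "(\<lambda>i. - (residual \<mu> T N J (Suc i) t z * eps (Suc i) x))
      sums (forcing \<mu> t x z - proj_noise T N J (forcing \<mu> t x) z)" by (simp only:)
  from sums_minus[OF this]
  have "(\<lambda>i. residual \<mu> T N J (Suc i) t z * eps (Suc i) x)
      sums - (forcing \<mu> t x z - proj_noise T N J (forcing \<mu> t x) z)" by (simp only: minus_minus)
  from sums_unique[OF this] show ?thesis by linarith
qed

text \<open>The first index of \<open>dual_coeff\<close> sits on the basis function. After pairing
  with \<open>forcing\<close> it sits on the moments and the second on \<open>R\<close>, which is
  the arrangement in \<open>span_proj\<close>.\<close>

lemma W_hat_eq:
  "W_hat T N J R s y \<omega> = (\<Sum>i\<in>basis_index N J.
     (\<Sum>j\<in>basis_index N J. dual_coeff T N J i j * R (fst j) (snd j) \<omega>) * spline_basis T N J i (s, y))"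
proof -
  have K: "(\<Sum>j\<in>basis_index N J. dual_coeff T N J (n, l) j * R (fst j) (snd j) \<omega>)
      = 1 / (T / real N) * (\<Sum>m\<in>{1..J+1}. gram_inv J l m * R n m \<omega>)" if n: "n \<in> {1..N}" for n l
  proof -
    have "(\<Sum>j\<in>basis_index N J. dual_coeff T N J (n, l) j * R (fst j) (snd j) \<omega>)
        = (\<Sum>n'\<in>{1..N}. \<Sum>m\<in>{1..J+1}. dual_coeff T N J (n, l) (n', m) * R n' m \<omega>)"
      unfolding basis_index_def by (subst sum.cartesian_product) (simp add: case_prod_unfold)
    also have "\<dots> = (\<Sum>n'\<in>{1..N}. if n' = n then (\<Sum>m\<in>{1..J+1}. 1 / (T / real N) * gram_inv J l m * R n m \<omega>) else 0)"
      by (intro sum.cong refl) (auto simp: dual_coeff_def)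
    also have "\<dots> = 1 / (T / real N) * (\<Sum>m\<in>{1..J+1}. gram_inv J l m * R n m \<omega>)"
      using n by (simp only: sum.delta finite_atLeastAtMost if_True sum_distrib_left mult.assoc)
    finally show ?thesis .
  qed
  have "(\<Sum>i\<in>basis_index N J. (\<Sum>j\<in>basis_index N J. dual_coeff T N J i j * R (fst j) (snd j) \<omega>) * spline_basis T N J i (s, y))
      = (\<Sum>n\<in>{1..N}. \<Sum>l\<in>{1..J+1}. (\<Sum>j\<in>basis_index N J. dual_coeff T N J (n, l) j * R (fst j) (snd j) \<omega>) * spline_basis T N J (n, l) (s, y))"
    by (subst (2) basis_index_def, subst sum.cartesian_product) (simp add: case_prod_unfold basis_index_def)
  also have "\<dots> = (\<Sum>n\<in>{1..N}. \<Sum>l\<in>{1..J+1}. 1 / (T / real N) * (\<Sum>m\<in>{1..J+1}. gram_inv J l m * R n m \<omega>) * (indicator (time_slab T N n) s * hat J l y))"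
    by (intro sum.cong refl arg_cong2[where f = "(*)"] K) (auto simp: spline_basis_def)
  also have "\<dots> = W_hat T N J R s y \<omega>"
    unfolding W_hat_def sum_distrib_left sum_distrib_right by (simp only: mult_ac)
  finally show ?thesis by simp
qed

text \<open>These numbers have two roles: coefficients of the projected kernel in
  \<open>spline_basis\<close>, and coefficients of \<open>u_hat\<close> in the random variables
  \<open>R\<close>.\<close>

definition noise_weight :: "real \<Rightarrow> real \<Rightarrow> nat \<Rightarrow> nat \<Rightarrow> real \<Rightarrow> real \<Rightarrow> nat \<times> nat \<Rightarrow> real" where
  "noise_weight \<mu> T N J t x j = (\<Sum>i\<in>basis_index N J.
     dual_coeff T N J i j * (LINT z|space_time T. forcing \<mu> t x z * spline_basis T N J i z))"

lemma u_hat_eq: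
  assumes t: "t \<in> {0..T}" and J: "J \<ge> 1"
  shows "u_hat \<mu> T N J R t x \<omega> = (\<Sum>j\<in>basis_index N J. noise_weight \<mu> T N J t x j * R (fst j) (snd j) \<omega>)"
proof -
  let ?I = "basis_index N J"
  let ?w = "\<lambda>i. \<Sum>j\<in>?I. dual_coeff T N J i j * R (fst j) (snd j) \<omega>"
  let ?m = "\<lambda>i. LINT z|space_time T. forcing \<mu> t x z * spline_basis T N J i z"
  have eq: "forcing \<mu> t x (s, y) * W_hat T N J R s y \<omega>
      = (\<Sum>i\<in>?I. ?w i * (forcing \<mu> t x (s, y) * spline_basis T N J i (s, y)))" for s y
    unfolding W_hat_eq sum_distrib_left by (intro sum.cong refl) (simp only: mult_ac)
  let ?F = "\<lambda>z. \<Sum>i\<in>?I. ?w i * (forcing \<mu> t x z * spline_basis T N J i z)"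
  have int: "integrable (space_time T) ?F"
    by (intro Bochner_Integration.integrable_sum integrable_mult_right forcing_moment(1)[OF t J])
  \<comment> \<open>\<open>u_hat\<close> integrates over (0,t), the Fubini formula over [0,T]; the
    cut-off contained in \<open>forcing\<close> reconciles the two.\<close>
  have ind: "indicator {0..T} s * indicator {0<..<t} s = (indicator {0<..<t} s :: real)" for s :: real
    using t by (auto simp: indicator_def)
  have "u_hat \<mu> T N J R t x \<omega> = (LINT s|lborel. indicator {0..T} s * (indicator {0<..<t} s *
      (LINT y:{0<..<1}|lborel. Psi \<mu> (t - s) x y * W_hat T N J R s y \<omega>)))"
    unfolding u_hat_def set_lebesgue_integral_def[of _ "{0<..<t}"] by (simp add: ind mult.assoc[symmetric])
  also have "\<dots> = (LINT s:{0..T}|lborel. LINT y:{0<..<1}|lborel. ?F (s, y))"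
  proof -
    have "(\<Sum>i\<in>?I. ?w i * (forcing \<mu> t x (s, y) * spline_basis T N J i (s, y)))
        = indicator {0<..<t} s * (Psi \<mu> (t - s) x y * W_hat T N J R s y \<omega>)" for s y
      unfolding eq[symmetric] by (simp add: forcing_def)
    then show ?thesis
      by (simp only: set_lebesgue_integral_def[of _ "{0..T}"] real_scaleR_def set_integral_mult_right)
  qed
  also have "\<dots> = (LINT z|space_time T. ?F z)" by (rule integral_space_time[OF int, symmetric])
  also have "\<dots> = (\<Sum>i\<in>?I. ?w i * ?m i)"
    by (subst Bochner_Integration.integral_sum) (auto intro!: integrable_mult_right forcing_moment(1)[OF t J])
  also have "\<dots> = (\<Sum>j\<in>?I. noise_weight \<mu> T N J t x j * R (fst j) (snd j) \<omega>)"
    unfolding noise_weight_def sum_distrib_right by (subst sum.swap) (simp only: mult_ac)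
  finally show ?thesis .
qed

lemma proj_forcing_eq:
  "proj_noise T N J (forcing \<mu> t x) z = (\<Sum>j\<in>basis_index N J. noise_weight \<mu> T N J t x j * spline_basis T N J j z)"
  by (simp add: proj_noise_def span_proj_def noise_weight_def)

text \<open>Each \<open>R\<close> is the Walsh integral of one basis function, so linearity matches
  the two roles of \<open>noise_weight\<close>.\<close>

lemma has_walsh_integral_u_hat:
  assumes wn: "white_noise M (space_time T) W" and R: "noise_coeffs M W T N J R"
    and t: "t \<in> {0..T}" and J: "J \<ge> 1"
  shows "has_walsh_integral M (space_time T) W (proj_noise T N J (forcing \<mu> t x)) (u_hat \<mu> T N J R t x)"
proof -
  have "has_walsh_integral M (space_time T) W (spline_basis T N J j) (R (fst j) (snd j))"
    if "j \<in> basis_index N J" for j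
    using R that unfolding noise_coeffs_def basis_index_def spline_basis_def by (cases j) auto
  from has_walsh_integral_sum[OF wn finite_basis_index this, of N J "\<lambda>j. j" "noise_weight \<mu> T N J t x"]
  show ?thesis unfolding proj_forcing_eq[abs_def] u_hat_eq[OF t J, abs_def] .
qed

text \<open>As functions of x the moments are series of multiples of \<open>eps k\<close>, so their
  measurability follows without treating the kernel as a function of all its variables.\<close>

lemma noise_weight_measurable:
  assumes "t \<in> {0..T}" "J \<ge> 1"
  shows "(\<lambda>x. noise_weight \<mu> T N J t x j) \<in> borel_measurable borel"
proof -
  have "(\<lambda>x. LINT z|space_time T. forcing \<mu> t x z * spline_basis T N J i z) \<in> borel_measurable borel"
    if i: "i \<in> basis_index N J" for i
  proof -
    have "(LINT z|space_time T. forcing \<mu> t x z * spline_basis T N J i z)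
        = (\<Sum>l. - eps (Suc l) x * source_moment \<mu> T N J (Suc l) t i)" for x
      by (rule sums_unique[OF forcing_moment(2)[OF assms i]])
    then show ?thesis by simp
  qed
  then show ?thesis unfolding noise_weight_def by measurable
qed

section \<open>The error estimate\<close>

lemma ennsqrt_square: "(ennsqrt a)\<^sup>2 = a"
  by (cases a) (auto simp: ennsqrt_def ennreal_power)

lemma energy_summable:
  assumes "T > 0" "N \<ge> 1" "J \<ge> 1" "t \<in> {0..T}"
  shows "summable (\<lambda>i. energy \<mu> T N J (Suc i) t)"
proof (rule summable_comparison_test'[where N = 0])
  show "summable (\<lambda>i. energy_const \<mu> T * (1 / real (Suc i) ^ 2))" by (rule inverse_power_Suc_summable) simp
  show "norm (energy \<mu> T N J (Suc i) t) \<le> energy_const \<mu> T * (1 / real (Suc i) ^ 2)" for i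
    using energy_le_inverse_square'[OF assms, of "Suc i" \<mu>] energy_nonneg[of \<mu> T N J "Suc i" t] by simp
qed

text \<open>All integrands are nonnegative, so Tonelli asks for measurability only. It is used to
  reach the isometry at fixed x, and again to reach Parseval at fixed (s, y). Every step is an
  equality, so a maximum over t can be sought among sums of energies.\<close>

lemma rms_error_eq:
  assumes M: "prob_space M" and T: "T > 0" and wn: "white_noise M (space_time T) W"
    and mild: "mild_solution M W T \<mu> u" and N: "N \<ge> 1" and J: "J \<ge> 1"
    and R: "noise_coeffs M W T N J R" and t: "t \<in> {0..T}"
  shows "rms_error M (u t) (u_hat \<mu> T N J R t) = ennreal (sqrt (\<Sum>i. energy \<mu> T N J (Suc i) t))"
proof -
  interpret M: prob_space M by fact
  interpret E: finite_measure "space_time T" by (rule finite_measure_space_time)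
  interpret U: finite_measure unit_measure by (rule finite_measure_unit)
  interpret UM: pair_sigma_finite unit_measure M by unfold_locales
  interpret UE: pair_sigma_finite unit_measure "space_time T" by unfold_locales
  let ?v = "\<lambda>x \<omega>. u t x \<omega> - u_hat \<mu> T N J R t x \<omega>"
  let ?r = "\<lambda>i. residual \<mu> T N J (Suc i) t"
  have Rm: "R (fst j) (snd j) \<in> borel_measurable M" if "j \<in> basis_index N J" for j
    using R that by (auto simp: noise_coeffs_def basis_index_def has_walsh_integral_def)
  \<comment> \<open>The version of \<open>u\<close> is jointly measurable over the closed interval,
    while the norm integrates over the open one.\<close>
  have um: "(\<lambda>p. u t (fst p) (snd p)) \<in> borel_measurable (unit_measure \<Otimes>\<^sub>M M)"
  proof -
    have "(\<lambda>x. x) \<in> measurable unit_measure (restrict_space lborel {0..1})"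
      by (intro measurable_restrict_space2 measurable_restrict_space1) (auto simp: space_restrict_space)
    then have "(\<lambda>p. (fst p, snd p)) \<in> measurable (unit_measure \<Otimes>\<^sub>M M) (restrict_space lborel {0..1} \<Otimes>\<^sub>M M)"
      by (intro measurable_Pair measurable_compose[OF measurable_fst] measurable_snd)
    moreover have "(\<lambda>(x, \<omega>). u t x \<omega>) \<in> borel_measurable (restrict_space lborel {0..1} \<Otimes>\<^sub>M M)"
      using mild t by (simp add: mild_solution_def)
    ultimately show ?thesis by (auto dest: measurable_compose)
  qed
  have wm: "(\<lambda>p. noise_weight \<mu> T N J t (fst p) j * R (fst j) (snd j) (snd p)) \<in> borel_measurable (unit_measure \<Otimes>\<^sub>M M)"
    if "j \<in> basis_index N J" for j
  proof (rule borel_measurable_times)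
    have "(\<lambda>x. noise_weight \<mu> T N J t x j) \<in> borel_measurable unit_measure"
      using noise_weight_measurable[OF t J] by (intro measurable_restrict_space1) simp
    then show "(\<lambda>p. noise_weight \<mu> T N J t (fst p) j) \<in> borel_measurable (unit_measure \<Otimes>\<^sub>M M)"
      by (rule measurable_compose[OF measurable_fst])
    show "(\<lambda>p. R (fst j) (snd j) (snd p)) \<in> borel_measurable (unit_measure \<Otimes>\<^sub>M M)"
      by (rule measurable_compose[OF measurable_snd Rm[OF that]])
  qed
  \<comment> \<open>For \<open>u_hat\<close> the finite sum \<open>u_hat_eq\<close> displays
    functions of x times random variables.\<close>
  have joint: "(\<lambda>p. ?v (fst p) (snd p)) \<in> borel_measurable (unit_measure \<Otimes>\<^sub>M M)"
    unfolding u_hat_eq[OF t J] by (intro borel_measurable_diff um borel_measurable_sum wm)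
  have L2: "(L2_norm_D f)\<^sup>2 = (\<integral>\<^sup>+x. ennreal ((f x)\<^sup>2) \<partial>unit_measure)" for f
    unfolding L2_norm_D_def ennsqrt_square by (simp add: nn_integral_restrict_space)
  have "(\<integral>\<^sup>+\<omega>. (L2_norm_D (\<lambda>x. ?v x \<omega>))\<^sup>2 \<partial>M) = (\<integral>\<^sup>+\<omega>. (\<integral>\<^sup>+x. ennreal ((?v x \<omega>)\<^sup>2) \<partial>unit_measure) \<partial>M)"
    unfolding L2 ..
  also have "\<dots> = (\<integral>\<^sup>+x. (\<integral>\<^sup>+\<omega>. ennreal ((?v x \<omega>)\<^sup>2) \<partial>M) \<partial>unit_measure)"
    using joint by (intro UM.Fubini') (simp add: case_prod_unfold)
  also have "\<dots> = (\<integral>\<^sup>+x. (\<integral>\<^sup>+z. ennreal ((\<Sum>i. ?r i z * eps (Suc i) x)\<^sup>2) \<partial>space_time T) \<partial>unit_measure)"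
  proof (intro nn_integral_cong)
    fix x assume x: "x \<in> space unit_measure"
    have "has_walsh_integral M (space_time T) W (forcing \<mu> t x) (u t x)"
      using mild t x unfolding mild_solution_def forcing_def by (auto simp: space_restrict_space)
    from has_walsh_integral_combination[OF wn this has_walsh_integral_u_hat[OF wn R t J], of 1 "-1"]
    have "has_walsh_integral M (space_time T) W (\<lambda>z. forcing \<mu> t x z - proj_noise T N J (forcing \<mu> t x) z) (?v x)"
      by simp
    from walsh_isometry[OF M wn this]
    show "(\<integral>\<^sup>+\<omega>. ennreal ((?v x \<omega>)\<^sup>2) \<partial>M) = (\<integral>\<^sup>+z. ennreal ((\<Sum>i. ?r i z * eps (Suc i) x)\<^sup>2) \<partial>space_time T)"
      unfolding forcing_residual_eq[OF t J] by simp
  qed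
  also have "\<dots> = (\<integral>\<^sup>+z. (\<integral>\<^sup>+x. ennreal ((\<Sum>i. ?r i z * eps (Suc i) x)\<^sup>2) \<partial>unit_measure) \<partial>space_time T)"
  proof (intro UE.Fubini'[symmetric])
    have rm: "?r i \<in> borel_measurable (space_time T)" for i
      using t by (intro bounded_measurable_measurable bounded_measurable_residual J) auto
    have "eps (Suc i) \<in> borel_measurable unit_measure" for i by (intro measurable_restrict_space1) simp
    then have "(\<lambda>p. \<Sum>i. ?r i (snd p) * eps (Suc i) (fst p)) \<in> borel_measurable (unit_measure \<Otimes>\<^sub>M space_time T)"
      by (intro borel_measurable_suminf borel_measurable_times measurable_compose[OF measurable_fst]
          measurable_compose[OF measurable_snd rm])
    then show "(\<lambda>(x, z). ennreal ((\<Sum>i. ?r i z * eps (Suc i) x)\<^sup>2)) \<in> borel_measurable (unit_measure \<Otimes>\<^sub>M space_time T)"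
      by (simp add: case_prod_unfold)
  qed
  also have "\<dots> = (\<integral>\<^sup>+z. (\<Sum>i. ennreal ((?r i z)\<^sup>2)) \<partial>space_time T)"
    by (intro nn_integral_cong nn_integral_sine_series_square residual_summable[OF t J])
  also have "\<dots> = (\<Sum>i. \<integral>\<^sup>+z. ennreal ((?r i z)\<^sup>2) \<partial>space_time T)"
  proof (rule nn_integral_suminf)
    have "(\<lambda>z. (?r i z)\<^sup>2) \<in> borel_measurable (space_time T)" for i
      using t by (intro bounded_measurable_measurable bounded_measurable_power2 bounded_measurable_residual J) auto
    then show "(\<lambda>z. ennreal ((?r i z)\<^sup>2)) \<in> borel_measurable (space_time T)" for i by simp
  qed
  also have "\<dots> = (\<Sum>i. ennreal (energy \<mu> T N J (Suc i) t))"
    unfolding energy_def using t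
    by (intro suminf_cong nn_integral_eq_integral E.bounded_measurable_integrable bounded_measurable_power2
        bounded_measurable_residual J) auto
  also have "\<dots> = ennreal (\<Sum>i. energy \<mu> T N J (Suc i) t)"
    by (intro suminf_ennreal2 energy_nonneg energy_summable T N J t)
  finally show ?thesis
    unfolding rms_error_def using suminf_nonneg[OF energy_summable[OF T N J t, of \<mu>] energy_nonneg]
    by (simp add: ennsqrt_def)
qed

section \<open>Continuity of the error in time\<close>

lemma decay_tendsto:
  assumes X: "X \<longlonglongrightarrow> t" and s: "s \<noteq> t"
  shows "(\<lambda>n. decay \<mu> k (X n) s) \<longlonglongrightarrow> decay \<mu> k t s"
  unfolding decay_def
proof (rule tendsto_mult)
  \<comment> \<open>Off the limit t, the point s eventually stays on one side of \<open>X n\<close>,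
    so the cut-off is eventually constant.\<close>
  have "\<forall>\<^sub>F n in sequentially. indicator {0<..<X n} s = (indicator {0<..<t} s :: real)"
  proof (cases "s < t")
    case True
    with order_tendstoD(1)[OF X this] show ?thesis by (auto elim!: eventually_mono simp: indicator_def)
  next
    case False
    with s have "t < s" by simp
    with order_tendstoD(2)[OF X this] show ?thesis by (auto elim!: eventually_mono simp: indicator_def)
  qed
  then show "(\<lambda>n. indicator {0<..<X n} s :: real) \<longlonglongrightarrow> indicator {0<..<t} s" by (rule tendsto_eventually)
  show "(\<lambda>n. exp (- (rate \<mu> k * (X n - s)))) \<longlonglongrightarrow> exp (- (rate \<mu> k * (t - s)))"
    by (intro tendsto_intros X)
qed

lemma AE_space_time_fst_neq: "AE z in space_time T. fst z \<noteq> t"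
proof -
  have m: "(\<lambda>z. indicator {t} (fst z) :: ennreal) \<in> borel_measurable (space_time T)"
    by (rule borel_measurable_space_timeI, rule measurable_compose[of fst _ borel])
      (auto intro!: borel_measurable_continuous_onI continuous_on_fst continuous_on_id)
  have "(\<integral>\<^sup>+z. indicator {t} (fst z) \<partial>space_time T) = (\<integral>\<^sup>+s\<in>{0..T}. indicator {t} s \<partial>lborel)"
    by (rule nn_integral_space_time_fst) measurable
  also have "\<dots> \<le> (\<integral>\<^sup>+s. indicator {t} s \<partial>lborel)" by (intro nn_integral_mono) (auto simp: indicator_def)
  also have "\<dots> = 0" by simp
  finally have "AE z in space_time T. indicator {t} (fst z) = (0 :: ennreal)"
    using m by (simp add: nn_integral_0_iff_AE)
  then show ?thesis by eventually_elim (auto simp: indicator_def split: if_splits)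
qed

text \<open>The jump at s = t moves with t, so pointwise convergence is claimed off the null line s
  = t only. Dominated convergence is used twice: for the moments, which gives convergence of the
  projections, and then for the squared residuals.\<close>

lemma energy_continuous:
  assumes J: "J \<ge> 1"
  shows "continuous_on {0..T} (energy \<mu> T N J (Suc i))"
  unfolding continuous_on_sequentially
proof (intro allI ballI impI, elim conjE)
  interpret E: finite_measure "space_time T" by (rule finite_measure_space_time)
  fix X t assume t: "t \<in> {0..T}" and Xr: "\<forall>n. X n \<in> {0..T}" and X: "X \<longlonglongrightarrow> t"
  let ?k = "Suc i" and ?I = "basis_index N J"
  \<comment> \<open>Dominating constants uniform in time: \<open>c\<close> for the source,
    \<open>d\<close> for its moments through \<open>source_L1_le\<close>, and \<open>P\<close> for
    the projection, whose basis functions are at most 1 in absolute value.\<close>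
  define c where "c = growth \<mu> T * (sqrt 2 * lam ?k)"
  define d where "d = 2 * sqrt 2 * growth \<mu> T / pi ^ 3 * (1 / real (Suc i) ^ 3)"
  define P where "P = (\<Sum>j\<in>?I. \<Sum>l\<in>?I. \<bar>dual_coeff T N J l j\<bar> * d)"
  have d0: "d \<ge> 0" by (simp add: d_def growth_def)
  have sc: "\<bar>source \<mu> ?k \<tau> z\<bar> \<le> c" if "\<tau> \<in> {0..T}" for \<tau> z
    unfolding c_def using that by (intro abs_source_le) auto
  have src: "AE z in space_time T. (\<lambda>n. source \<mu> ?k (X n) z) \<longlonglongrightarrow> source \<mu> ?k t z"
    using AE_space_time_fst_neq[where T = T and t = t]
  proof eventually_elim
    case (elim z)
    then show ?case unfolding source_def case_prod_unfold by (intro tendsto_mult decay_tendsto X tendsto_const)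
  qed
  have mom: "(\<lambda>n. source_moment \<mu> T N J ?k (X n) j) \<longlonglongrightarrow> source_moment \<mu> T N J ?k t j" if j: "j \<in> ?I" for j
    unfolding source_moment_def
  proof (rule integral_dominated_convergence[where w = "\<lambda>_. c"])
    have "(\<lambda>z. source \<mu> ?k \<tau> z * spline_basis T N J j z) \<in> borel_measurable (space_time T)" for \<tau>
      using bounded_measurable_measurable[OF bounded_measurable_spline_basis[OF J j]] by measurable
    then show "(\<lambda>z. source \<mu> ?k t z * spline_basis T N J j z) \<in> borel_measurable (space_time T)"
      "(\<lambda>z. source \<mu> ?k (X n) z * spline_basis T N J j z) \<in> borel_measurable (space_time T)" for n by auto
    show "AE z in space_time T. (\<lambda>n. source \<mu> ?k (X n) z * spline_basis T N J j z)
        \<longlonglongrightarrow> source \<mu> ?k t z * spline_basis T N J j z"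
      using src by eventually_elim (intro tendsto_intros)
    show "AE z in space_time T. norm (source \<mu> ?k (X n) z * spline_basis T N J j z) \<le> c" for n
    proof (rule AE_I2)
      fix z assume z: "z \<in> space (space_time T)"
      have "\<bar>source \<mu> ?k (X n) z\<bar> * \<bar>spline_basis T N J j z\<bar> \<le> c * 1"
        using sc[of "X n" z] Xr abs_spline_basis_le[OF J j z] by (intro mult_mono) (auto simp: c_def growth_def lam_def)
      then show "norm (source \<mu> ?k (X n) z * spline_basis T N J j z) \<le> c" by (simp add: abs_mult)
    qed
  qed simp
  have momd: "\<bar>source_moment \<mu> T N J ?k \<tau> j\<bar> \<le> d" if "\<tau> \<in> {0..T}" "j \<in> ?I" for \<tau> j
    unfolding source_moment_def d_def
    by (rule order_trans[OF integral_abs_bound source_L1_le[OF that(1) J that(2)]])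
  have proj: "(\<lambda>n. proj_noise T N J (source \<mu> ?k (X n)) z) \<longlonglongrightarrow> proj_noise T N J (source \<mu> ?k t) z" for z
    unfolding proj_source_eq by (intro tendsto_sum tendsto_mult tendsto_const mom)
  have projP: "\<bar>proj_noise T N J (source \<mu> ?k \<tau>) z\<bar> \<le> P" if "\<tau> \<in> {0..T}" "z \<in> space (space_time T)" for \<tau> z
    unfolding proj_source_eq P_def
  proof (intro order_trans[OF sum_abs] sum_mono)
    fix j assume j: "j \<in> ?I"
    have "\<bar>\<Sum>l\<in>?I. dual_coeff T N J l j * source_moment \<mu> T N J ?k \<tau> l\<bar> \<le> (\<Sum>l\<in>?I. \<bar>dual_coeff T N J l j\<bar> * d)"
      by (intro order_trans[OF sum_abs] sum_mono) (auto simp: abs_mult intro!: mult_left_mono momd[OF that(1)])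
    then have "\<bar>\<Sum>l\<in>?I. dual_coeff T N J l j * source_moment \<mu> T N J ?k \<tau> l\<bar> * \<bar>spline_basis T N J j z\<bar>
        \<le> (\<Sum>l\<in>?I. \<bar>dual_coeff T N J l j\<bar> * d) * 1"
      using abs_spline_basis_le[OF J j that(2)] d0 by (intro mult_mono sum_nonneg) auto
    then show "\<bar>(\<Sum>l\<in>?I. dual_coeff T N J l j * source_moment \<mu> T N J ?k \<tau> l) * spline_basis T N J j z\<bar>
        \<le> (\<Sum>l\<in>?I. \<bar>dual_coeff T N J l j\<bar> * d)" by (simp add: abs_mult)
  qed
  have "(\<lambda>n. energy \<mu> T N J ?k (X n)) \<longlonglongrightarrow> energy \<mu> T N J ?k t"
    unfolding energy_def
  proof (rule integral_dominated_convergence[where w = "\<lambda>_. (c + P)\<^sup>2"])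
    have "(\<lambda>z. (residual \<mu> T N J ?k \<tau> z)\<^sup>2) \<in> borel_measurable (space_time T)" if "\<tau> \<in> {0..T}" for \<tau>
      using that by (intro bounded_measurable_measurable bounded_measurable_power2 bounded_measurable_residual J) auto
    then show "(\<lambda>z. (residual \<mu> T N J ?k t z)\<^sup>2) \<in> borel_measurable (space_time T)"
      "(\<lambda>z. (residual \<mu> T N J ?k (X n) z)\<^sup>2) \<in> borel_measurable (space_time T)" for n
      using t Xr by auto
    show "AE z in space_time T. (\<lambda>n. (residual \<mu> T N J ?k (X n) z)\<^sup>2) \<longlonglongrightarrow> (residual \<mu> T N J ?k t z)\<^sup>2"
      using src unfolding residual_def by eventually_elim (intro tendsto_power tendsto_diff proj)
    show "AE z in space_time T. norm ((residual \<mu> T N J ?k (X n) z)\<^sup>2) \<le> (c + P)\<^sup>2" for n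
    proof (rule AE_I2)
      fix z assume z: "z \<in> space (space_time T)"
      have "\<bar>residual \<mu> T N J ?k (X n) z\<bar> \<le> c + P"
        unfolding residual_def using sc[of "X n" z] projP[OF _ z, of "X n"] Xr
        by (intro order_trans[OF abs_triangle_ineq4] add_mono) auto
      from power_mono[OF this, of 2] show "norm ((residual \<mu> T N J ?k (X n) z)\<^sup>2) \<le> (c + P)\<^sup>2" by simp
    qed
  qed simp
  then show "(energy \<mu> T N J ?k \<circ> X) \<longlonglongrightarrow> energy \<mu> T N J ?k t" by (simp add: comp_def)
qed

lemma energy_sum_attains_max:
  assumes T: "T > 0" and N: "N \<ge> 1" and J: "J \<ge> 1"
  shows "\<exists>t\<in>{0..T}. \<forall>s\<in>{0..T}. (\<Sum>i. energy \<mu> T N J (Suc i) s) \<le> (\<Sum>i. energy \<mu> T N J (Suc i) t)"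
proof (rule continuous_attains_sup)
  have "summable (\<lambda>i. energy_const \<mu> T * (1 / real (Suc i) ^ 2))" by (rule inverse_power_Suc_summable) simp
  then have "uniform_limit {0..T} (\<lambda>n t. \<Sum>i<n. energy \<mu> T N J (Suc i) t) (\<lambda>t. \<Sum>i. energy \<mu> T N J (Suc i) t) sequentially"
  proof (rule Weierstrass_m_test[rotated])
    show "norm (energy \<mu> T N J (Suc i) t) \<le> energy_const \<mu> T * (1 / real (Suc i) ^ 2)" if "t \<in> {0..T}" for i t
      using energy_le_inverse_square'[OF T N J that, of "Suc i" \<mu>] energy_nonneg[of \<mu> T N J "Suc i" t] by simp
  qed
  then show "continuous_on {0..T} (\<lambda>t. \<Sum>i. energy \<mu> T N J (Suc i) t)"
    by (rule uniform_limit_theorem[rotated])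
      (auto intro!: always_eventually continuous_on_sum energy_continuous J)
qed (use T in auto)

section \<open>Summation of the two bounds\<close>

lemma suminf_inverse_square_tail:
  assumes "L \<ge> 1"
  shows "summable (\<lambda>n. 1 / (real (Suc (n + L)))\<^sup>2)" "(\<Sum>n. 1 / (real (Suc (n + L)))\<^sup>2) \<le> 1 / real L"
proof -
  have "(\<lambda>n. 1 / real (n + L)) \<longlonglongrightarrow> 0"
    using LIMSEQ_ignore_initial_segment[OF lim_1_over_n] by simp
  from telescope_sums'[OF this]
  have tele: "(\<lambda>n. 1 / real (n + L) - 1 / real (Suc n + L)) sums (1 / real L)" by simp
  \<comment> \<open>With \<open>m = n + L\<close> this is
    \<open>m * (m + 1) \<le> (m + 1)\<^sup>2\<close>, divided out; \<open>L \<ge> 1\<close> keeps m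
    positive.\<close>
  have le: "1 / (real (Suc (n + L)))\<^sup>2 \<le> 1 / real (n + L) - 1 / real (Suc n + L)" for n
  proof -
    have p: "real (n + L) > 0" using assms by simp
    have "1 / real (n + L) - 1 / real (Suc n + L) = 1 / (real (n + L) * (real (n + L) + 1))"
      using p by (simp add: field_simps)
    moreover have "real (n + L) * (real (n + L) + 1) \<le> (real (Suc (n + L)))\<^sup>2"
      using p by (simp add: power2_eq_square algebra_simps)
    ultimately show ?thesis using p by (simp add: frac_le)
  qed
  show sm: "summable (\<lambda>n. 1 / (real (Suc (n + L)))\<^sup>2)"
    by (rule summable_comparison_test'[OF sums_summable[OF tele], where N = 0]) (use le in simp)
  show "(\<Sum>n. 1 / (real (Suc (n + L)))\<^sup>2) \<le> 1 / real L"
    using suminf_le[OF le sm sums_summable[OF tele]] sums_unique[OF tele] by simp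
qed

text \<open>The series is cut at \<open>min \<lceil>\<delta>\<^bsup>-1/4\<^esup>\<rceil> J\<close>, where the two bounds on its terms balance.\<close>

lemma suminf_two_bounds_le:
  fixes Q :: "nat \<Rightarrow> real"
  assumes C: "C \<ge> 0" and \<delta>: "\<delta> > 0" and J: "J \<ge> 1" and sm: "summable Q"
    and small: "\<And>i. Suc i \<le> J \<Longrightarrow> Q i \<le> C * ((real (Suc i))\<^sup>2 * \<delta> + (1 / real J)\<^sup>2)"
    and large: "\<And>i. Q i \<le> C / (real (Suc i))\<^sup>2"
  shows "(\<Sum>i. Q i) \<le> 5 * C * ((1 + \<delta> powr (3/4)) * \<delta> powr (1/4) + 1 / real J)"
proof -
  define x where "x = \<delta> powr (-1/4)"
  define K where "K = nat \<lceil>x\<rceil>"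
  \<comment> \<open>The mesh bound holds for modes up to \<open>J\<close> only, which forces the
    minimum. If \<open>J\<close> is the smaller number, the tail costs \<open>1 / real J\<close>,
    the same as the interpolation error.\<close>
  define L where "L = min K J"
  have x: "x > 0" using \<delta> by (simp add: x_def)
  have K: "K \<ge> 1" "x \<le> real K" "real K \<le> x + 1" using x unfolding K_def by linarith+
  have L: "L \<ge> 1" "L \<le> J" "L \<le> K" using K J by (auto simp: L_def)
  have xinv: "1 / x = \<delta> powr (1/4)" by (simp add: x_def powr_minus_divide)
  have x3: "x ^ 3 * \<delta> = \<delta> powr (1/4)"
  proof -
    have "x ^ 3 * \<delta> = \<delta> powr (-3/4) * \<delta> powr 1"
      using \<delta> by (simp add: x_def powr_powr flip: powr_realpow)
    also have "\<dots> = \<delta> powr (1/4)" by (subst powr_add[symmetric]) simp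
    finally show ?thesis .
  qed
  have d: "\<delta> = \<delta> powr (3/4) * \<delta> powr (1/4)" using \<delta> by (simp flip: powr_add)
  have "(\<Sum>i<L. Q i) \<le> (\<Sum>i<L. C * ((real L)\<^sup>2 * \<delta> + (1 / real J)\<^sup>2))"
  proof (intro sum_mono)
    fix i assume "i \<in> {..<L}"
    then have i: "Suc i \<le> L" by simp
    have "Q i \<le> C * ((real (Suc i))\<^sup>2 * \<delta> + (1 / real J)\<^sup>2)" using i L by (intro small) simp
    also have "\<dots> \<le> C * ((real L)\<^sup>2 * \<delta> + (1 / real J)\<^sup>2)"
      using i C \<delta> by (intro mult_left_mono add_right_mono mult_right_mono power_mono) auto
    finally show "Q i \<le> C * ((real L)\<^sup>2 * \<delta> + (1 / real J)\<^sup>2)" .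
  qed
  also have "\<dots> = C * ((real L) ^ 3 * \<delta> + real L * (1 / real J)\<^sup>2)"
    by (simp add: algebra_simps power2_eq_square power3_eq_cube)
  \<comment> \<open>The minimum is released separately in each term, towards \<open>K\<close> in the
    first and \<open>J\<close> in the second.\<close>
  also have "\<dots> \<le> C * ((real K) ^ 3 * \<delta> + real J * (1 / real J)\<^sup>2)"
    using C \<delta> L by (intro mult_left_mono add_mono mult_right_mono power_mono) auto
  also have "real J * (1 / real J)\<^sup>2 = 1 / real J" using J by (simp add: power2_eq_square)
  finally have head: "(\<Sum>i<L. Q i) \<le> C * ((real K) ^ 3 * \<delta> + 1 / real J)" .
  have "(real K) ^ 3 \<le> (x + 1) ^ 3" using K by (intro power_mono) auto
  \<comment> \<open>The difference of the two sides is
    \<open>3 * ((x - 1)\<^sup>2 * (x + 1))\<close>. The summand 1, due to rounding x up to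
    \<open>K\<close>, contributes \<delta> itself, hence the factor
    \<open>1 + \<delta> powr (3/4)\<close>: the origin of \<open>omega0\<close>.\<close>
  also have "\<dots> \<le> 4 * (x ^ 3 + 1)"
  proof -
    have "0 \<le> 3 * ((x - 1)\<^sup>2 * (x + 1))" using x by simp
    then show ?thesis by (simp add: power2_eq_square power3_eq_cube algebra_simps)
  qed
  finally have "(real K) ^ 3 * \<delta> \<le> 4 * (x ^ 3 + 1) * \<delta>" using \<delta> by (intro mult_right_mono) auto
  also have "\<dots> = 4 * (x ^ 3 * \<delta> + \<delta>)" by (simp add: algebra_simps)
  also have "\<dots> = 4 * ((1 + \<delta> powr (3/4)) * \<delta> powr (1/4))" unfolding x3 using d by (simp add: algebra_simps)
  finally have K3: "(real K) ^ 3 * \<delta> \<le> 4 * ((1 + \<delta> powr (3/4)) * \<delta> powr (1/4))" .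
  have "1 / real L \<le> 1 / real K + 1 / real J" by (simp add: L_def min_def)
  moreover have "1 / real K \<le> \<delta> powr (1/4)" unfolding xinv[symmetric] using K x by (intro divide_left_mono) auto
  moreover have "\<delta> powr (1/4) \<le> (1 + \<delta> powr (3/4)) * \<delta> powr (1/4)" by (simp add: algebra_simps)
  ultimately have iL: "1 / real L \<le> (1 + \<delta> powr (3/4)) * \<delta> powr (1/4) + 1 / real J" by linarith
  have "(\<Sum>n. Q (n + L)) \<le> (\<Sum>n. C * (1 / (real (Suc (n + L)))\<^sup>2))"
  proof (rule suminf_le)
    show "Q (n + L) \<le> C * (1 / (real (Suc (n + L)))\<^sup>2)" for n using large[of "n + L"] by simp
    show "summable (\<lambda>n. Q (n + L))" by (rule summable_ignore_initial_segment[OF sm])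
    show "summable (\<lambda>n. C * (1 / (real (Suc (n + L)))\<^sup>2))"
      by (intro summable_mult suminf_inverse_square_tail(1) L)
  qed
  also have "\<dots> = C * (\<Sum>n. 1 / (real (Suc (n + L)))\<^sup>2)"
    by (rule suminf_mult[OF suminf_inverse_square_tail(1)[OF L(1)]])
  also have "\<dots> \<le> C * (1 / real L)" by (intro mult_left_mono suminf_inverse_square_tail L C)
  finally have tail: "(\<Sum>n. Q (n + L)) \<le> C * (1 / real L)" .
  have "(\<Sum>i. Q i) = (\<Sum>n. Q (n + L)) + (\<Sum>i<L. Q i)" by (rule suminf_split_initial_segment[OF sm])
  also have "\<dots> \<le> C * (1 / real L) + C * ((real K) ^ 3 * \<delta> + 1 / real J)" using tail head by (rule add_mono)
  also have "\<dots> = C * (1 / real L + ((real K) ^ 3 * \<delta> + 1 / real J))" by (simp add: distrib_left)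
  \<comment> \<open>The temporal part collects 4 from the cubic estimate and 1 from the tail; the
    spatial part collects 2.\<close>
  also have "\<dots> \<le> C * (5 * ((1 + \<delta> powr (3/4)) * \<delta> powr (1/4) + 1 / real J))"
  proof (intro mult_left_mono C)
    have "1 / real J \<ge> 0" by simp
    then show "1 / real L + ((real K) ^ 3 * \<delta> + 1 / real J)
        \<le> 5 * ((1 + \<delta> powr (3/4)) * \<delta> powr (1/4) + 1 / real J)"
      using iL K3 unfolding distrib_left by linarith
  qed
  finally show ?thesis by (simp only: mult_ac)
qed

text \<open>The estimate produces the square root of the mesh width. The stated form is weaker on
  the whole range: \<epsilon> < 1 makes its negative power at least 1, and
  \<open>\<eta> \<le> 1\<close> makes the smaller exponent give the larger value.\<close>

lemma sqrt_le_powr_half_minus: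
  assumes "0 < \<eta>" "\<eta> \<le> (1::real)" "\<epsilon> \<in> {0<..1/2}"
  shows "sqrt \<eta> \<le> \<epsilon> powr (-1/2) * \<eta> powr (1/2 - \<epsilon>)"
proof -
  have "1 \<le> \<epsilon> powr (-1/2)"
    using assms powr_mono'[of "-1/2" 0 \<epsilon>] by simp
  moreover have "\<eta> powr (1/2) \<le> \<eta> powr (1/2 - \<epsilon>)" using assms by (intro powr_mono') auto
  ultimately have "1 * \<eta> powr (1/2) \<le> \<epsilon> powr (-1/2) * \<eta> powr (1/2 - \<epsilon>)" by (intro mult_mono) auto
  then show ?thesis using assms by (simp add: powr_half_sqrt)
qed

theorem theorem3p1:
  fixes M :: "'w measure"
    and W :: "(real \<times> real) set \<Rightarrow> 'w \<Rightarrow> real"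
    and u :: "real \<Rightarrow> real \<Rightarrow> 'w \<Rightarrow> real"
    and T \<mu> :: real
    and \<kappa> :: nat
  assumes "prob_space M" and "complete_measure M"
    and "T > 0"
    and "\<kappa> \<ge> 1" and "(real \<kappa> - 1)\<^sup>2 * pi\<^sup>2 \<le> \<mu>" and "\<mu> < (real \<kappa>)\<^sup>2 * pi\<^sup>2"
    and "white_noise M (space_time T) W"
    and "mild_solution M W T \<mu> u"
  shows "\<exists>C>0. \<forall>N\<ge>1. \<forall>J\<ge>1. \<forall>R. noise_coeffs M W T N J R \<longrightarrow>
    (let \<Delta>t = T / real N; \<Delta>x = 1 / real J;
         err = (\<lambda>t. rms_error M (u t) (u_hat \<mu> T N J R t))
     in \<exists>t\<^sub>m. is_arg_max err (\<lambda>t. t \<in> {0..T}) t\<^sub>m \<and>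
          (\<forall>\<epsilon>\<in>{0<..1/2}.
             err t\<^sub>m \<le> ennreal (C * (omega0 \<Delta>t * \<Delta>t powr (1/8)
                                    + \<epsilon> powr (-1/2) * \<Delta>x powr (1/2 - \<epsilon>)))))"
proof -
  \<comment> \<open>The 5 comes from \<open>suminf_two_bounds_le\<close> and the root from passing
    to the root mean square; only \<mu> and T enter.\<close>
  define C where "C = sqrt (5 * energy_const \<mu> T)"
  have ec: "energy_const \<mu> T > 0"
    unfolding energy_const_def growth_def by (intro mult_pos_pos add_pos_nonneg) auto
  then have C: "C > 0" by (simp add: C_def)
  have main: "\<exists>t\<^sub>m. is_arg_max (\<lambda>t. rms_error M (u t) (u_hat \<mu> T N J R t)) (\<lambda>t. t \<in> {0..T}) t\<^sub>m \<and>
      (\<forall>\<epsilon>\<in>{0<..1/2}. rms_error M (u t\<^sub>m) (u_hat \<mu> T N J R t\<^sub>m)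
         \<le> ennreal (C * (omega0 (T / real N) * (T / real N) powr (1/8) + \<epsilon> powr (-1/2) * (1 / real J) powr (1/2 - \<epsilon>))))"
    if N: "N \<ge> 1" and J: "J \<ge> 1" and R: "noise_coeffs M W T N J R" for N J R
  proof -
    let ?Q = "\<lambda>t. \<Sum>i. energy \<mu> T N J (Suc i) t" and ?D = "T / real N" and ?h = "1 / real J"
    have D: "?D > 0" using assms(3) N by simp
    have err: "rms_error M (u t) (u_hat \<mu> T N J R t) = ennreal (sqrt (?Q t))" if "t \<in> {0..T}" for t
      by (rule rms_error_eq[OF assms(1,3,7,8) N J R that])
    \<comment> \<open>The maximiser is fixed before \<epsilon>, as the order of quantifiers demands.
      It maximises the mean square, and monotonicity of the root transfers this to
      \<open>rms_error\<close>.\<close>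
    obtain t\<^sub>m where tm: "t\<^sub>m \<in> {0..T}" "\<And>s. s \<in> {0..T} \<Longrightarrow> ?Q s \<le> ?Q t\<^sub>m"
      using energy_sum_attains_max[OF assms(3) N J, of \<mu>] by blast
    have "is_arg_max (\<lambda>t. rms_error M (u t) (u_hat \<mu> T N J R t)) (\<lambda>t. t \<in> {0..T}) t\<^sub>m"
      unfolding is_arg_max_def
    proof (intro conjI notI tm(1))
      assume "\<exists>s. s \<in> {0..T} \<and> rms_error M (u t\<^sub>m) (u_hat \<mu> T N J R t\<^sub>m) < rms_error M (u s) (u_hat \<mu> T N J R s)"
      then obtain s where s: "s \<in> {0..T}" "ennreal (sqrt (?Q t\<^sub>m)) < ennreal (sqrt (?Q s))"
        using err tm(1) by metis
      have "ennreal (sqrt (?Q s)) \<le> ennreal (sqrt (?Q t\<^sub>m))"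
        using tm(2)[OF s(1)] by (intro ennreal_leI real_sqrt_le_mono)
      then show False using s(2) by simp
    qed
    moreover have "rms_error M (u t\<^sub>m) (u_hat \<mu> T N J R t\<^sub>m)
        \<le> ennreal (C * (omega0 ?D * ?D powr (1/8) + \<epsilon> powr (-1/2) * ?h powr (1/2 - \<epsilon>)))"
      if \<epsilon>: "\<epsilon> \<in> {0<..1/2}" for \<epsilon>
    proof -
      let ?a = "(1 + ?D powr (3/4)) * ?D powr (1/4)"
      have "?Q t\<^sub>m \<le> 5 * energy_const \<mu> T * (?a + ?h)"
        using ec by (intro suminf_two_bounds_le D J energy_summable energy_le_mesh' energy_le_inverse_square' assms(3) N tm(1)) auto
      then have "sqrt (?Q t\<^sub>m) \<le> C * sqrt (?a + ?h)"
        unfolding C_def real_sqrt_mult[symmetric] by (rule real_sqrt_le_mono)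
      also have "\<dots> \<le> C * (sqrt ?a + sqrt ?h)"
        using C by (intro mult_left_mono sqrt_add_le_add_sqrt) auto
      also have "sqrt ?a = omega0 ?D * ?D powr (1/8)"
      proof -
        have "sqrt (?D powr (1/4)) = ?D powr (1/8)"
          by (simp add: powr_powr flip: powr_half_sqrt)
        then show ?thesis by (simp add: omega0_def real_sqrt_mult)
      qed
      also have "C * (omega0 ?D * ?D powr (1/8) + sqrt ?h)
          \<le> C * (omega0 ?D * ?D powr (1/8) + \<epsilon> powr (-1/2) * ?h powr (1/2 - \<epsilon>))"
        using C J by (intro mult_left_mono add_left_mono sqrt_le_powr_half_minus \<epsilon>) auto
      finally show ?thesis unfolding err[OF tm(1)] by (rule ennreal_leI)
    qed
    ultimately show ?thesis by blast
  qed
  show ?thesis unfolding Let_def using C main by blast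
qed

end
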